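(* Let $n,m\geq 2$ be integers and let $\mathbb{K}$ be a field of characteristic zero containing a primitive $n$th root of unity $q$. Then there exists a semisimple Hopf algebra $H_{n,m}=\mathbb{K}\mathbb{Z}_n^{\otimes m}\#_\gamma\Sigma_m$ of dimension $n^m m!$ that is an extension of $\mathbb{K}\Sigma_m$ by $\mathbb{K}\mathbb{Z}_n^{\otimes m}$ and that is generated by elements $x_1,\ldots,x_m,z_1,\ldots,z_{m-1}$ such that $$x_i^n=1,\qquad x_ix_j=x_jx_i,\qquad z_kx_i=x_{s_k(i)}z_k\qquad\text{for all } 1\le i,j\le m,\ 1\le k\le m-1,$$ where $s_k$ is the transposition $(k,k+1)$, and $$z_kz_l=z_lz_k\ (|k-l|>1),\qquad z_kz_{k+1}z_k=z_{k+1}z_kz_{k+1}\ (1\le k\le m-2),\qquad z_k^2=\frac1n\sum_{i,j=0}^{n-1}q^{-ij}x_k^ix_{k+1}^j\ (1\le k\le m-1).$$ The elements $x_i$ are group-like, while for all $1\le k\le m-1$ $$\Delta(z_k)=\left(\frac1n\sum_{i,j=0}^{n-1}q^{-ij}x_k^i\otimes x_{k+1}^j\right)(z_k\otimes z_k),\qquad \epsilon(z_k)=1,\qquad S(z_k)=z_k.$$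
   Context: $\mathbb{Z}_n$ is the cyclic group of order $n$, $\Sigma_m$ the symmetric group on $\{1,\dots,m\}$; $R=\mathbb{K}\mathbb{Z}_n^{\otimes m}$ is the $m$-fold tensor power of the group algebra, with $x_i$ the generator of the $i$th copy of $\mathbb{Z}_n$. $\Sigma_m$ acts on $R$ by automorphisms $\sigma_w$ with $\sigma_w(x_i)=x_{w(i)}$. For a normalized $2$-cocycle $\gamma:\Sigma_m\times\Sigma_m\to R^\times$ (i.e. $\gamma(w,v)\gamma(wv,u)=\sigma_w(\gamma(v,u))\gamma(w,vu)$ and $\gamma(\mathrm{id},w)=\gamma(w,\mathrm{id})=1$), the crossed product $R\#_\gamma\Sigma_m$ is the algebra that is the free left $R$-module with basis $\{\overline{w}:w\in\Sigma_m\}$ and multiplication $(a\overline{w})(b\overline{v})=a\sigma_w(b)\gamma(w,v)\overline{wv}$; here $z_k=\overline{s_k}$. A Hopf algebra $H$ is an extension of a Hopf algebra $Q$ by a Hopf algebra $R$ if $R$ is (isomorphic to) a Hopf subalgebra of $H$, there is a surjective Hopf algebra map $\pi:H\to Q$, and $R=\{h\in H:(\mathrm{id}\otimes\pi)\Delta(h)=h\otimes 1\}$. *)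

theory Defs
  imports Complex_Main "HOL-Algebra.Sym_Groups" "HOL-Algebra.Elementary_Groups" "HOL-Library.Poly_Mapping"
begin

text \<open>
  Vector spaces over a field \<open>'k\<close> are given together with a basis \<open>B\<close>: the space is the set of all
  finitely supported \<open>f :: 'b \<Rightarrow>\<^sub>0 'k\<close> with support in \<open>B\<close>. The tensor product of the spaces with
  bases \<open>B\<close> and \<open>C\<close> is the space with basis \<open>B \<times> C\<close>, the pair \<open>(b, c)\<close> standing for \<open>b \<otimes> c\<close>; the
  \<open>m\<close>-fold tensor power has basis \<open>PiE {1..m} (\<lambda>_. B)\<close>. Linear maps are only constrained on
  the spaces themselves, so values outside them are irrelevant.
\<close>

subsection \<open>Vector spaces and tensor products\<close>

definition scl :: "'k::field \<Rightarrow> ('b \<Rightarrow>\<^sub>0 'k) \<Rightarrow> ('b \<Rightarrow>\<^sub>0 'k)"  (infixr \<open>*\<^sub>p\<close> 75)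
  where "c *\<^sub>p f = Poly_Mapping.map ((*) c) f"

lemma lookup_scl [simp]: "Poly_Mapping.lookup (c *\<^sub>p f) b = c * Poly_Mapping.lookup f b"
  by (simp add: scl_def Poly_Mapping.map.rep_eq when_def)

interpretation pm: vector_space "scl :: 'k::field \<Rightarrow> ('b \<Rightarrow>\<^sub>0 'k) \<Rightarrow> ('b \<Rightarrow>\<^sub>0 'k)"
  by unfold_locales (auto intro!: poly_mapping_eqI simp: lookup_add algebra_simps)

abbreviation bvec :: "'b \<Rightarrow> ('b \<Rightarrow>\<^sub>0 'k::field)"
  where "bvec b \<equiv> Poly_Mapping.single b 1"

definition vec_on :: "'b set \<Rightarrow> ('b \<Rightarrow>\<^sub>0 'k::field) set"
  where "vec_on B = {f. Poly_Mapping.keys f \<subseteq> B}"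

definition linear_map :: "'b set \<Rightarrow> 'c set \<Rightarrow> (('b \<Rightarrow>\<^sub>0 'k::field) \<Rightarrow> ('c \<Rightarrow>\<^sub>0 'k)) \<Rightarrow> bool"
  where "linear_map B C f \<longleftrightarrow>
    f \<in> vec_on B \<rightarrow> vec_on C \<and>
    (\<forall>x\<in>vec_on B. \<forall>y\<in>vec_on B. f (x + y) = f x + f y) \<and>
    (\<forall>c. \<forall>x\<in>vec_on B. f (c *\<^sub>p x) = c *\<^sub>p f x)"

definition linear_form :: "'b set \<Rightarrow> (('b \<Rightarrow>\<^sub>0 'k::field) \<Rightarrow> 'k) \<Rightarrow> bool"
  where "linear_form B f \<longleftrightarrow>
    (\<forall>x\<in>vec_on B. \<forall>y\<in>vec_on B. f (x + y) = f x + f y) \<and>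
    (\<forall>c. \<forall>x\<in>vec_on B. f (c *\<^sub>p x) = c * f x)"

definition lin_ext :: "('b \<Rightarrow> ('c \<Rightarrow>\<^sub>0 'k)) \<Rightarrow> ('b \<Rightarrow>\<^sub>0 'k::field) \<Rightarrow> ('c \<Rightarrow>\<^sub>0 'k)"
  where "lin_ext \<phi> f = (\<Sum>b\<in>Poly_Mapping.keys f. Poly_Mapping.lookup f b *\<^sub>p \<phi> b)"

definition bilin_ext ::
    "('b \<Rightarrow> 'c \<Rightarrow> ('d \<Rightarrow>\<^sub>0 'k)) \<Rightarrow> ('b \<Rightarrow>\<^sub>0 'k::field) \<Rightarrow> ('c \<Rightarrow>\<^sub>0 'k) \<Rightarrow> ('d \<Rightarrow>\<^sub>0 'k)"
  where "bilin_ext \<phi> f g = lin_ext (\<lambda>b. lin_ext (\<phi> b) g) f"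

definition tens :: "('b \<Rightarrow>\<^sub>0 'k::field) \<Rightarrow> ('c \<Rightarrow>\<^sub>0 'k) \<Rightarrow> ('b \<times> 'c \<Rightarrow>\<^sub>0 'k)"  (infixr \<open>\<boxtimes>\<close> 76)
  where "tens = bilin_ext (\<lambda>b c. bvec (b, c))"

definition tens_map ::
    "(('b \<Rightarrow>\<^sub>0 'k::field) \<Rightarrow> ('d \<Rightarrow>\<^sub>0 'k)) \<Rightarrow> (('c \<Rightarrow>\<^sub>0 'k) \<Rightarrow> ('e \<Rightarrow>\<^sub>0 'k)) \<Rightarrow>
     ('b \<times> 'c \<Rightarrow>\<^sub>0 'k) \<Rightarrow> ('d \<times> 'e \<Rightarrow>\<^sub>0 'k)"
  where "tens_map f g = lin_ext (\<lambda>(b, c). f (bvec b) \<boxtimes> g (bvec c))"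

definition tens_assoc :: "(('b \<times> 'c) \<times> 'd \<Rightarrow>\<^sub>0 'k::field) \<Rightarrow> ('b \<times> ('c \<times> 'd) \<Rightarrow>\<^sub>0 'k)"
  where "tens_assoc = lin_ext (\<lambda>((b, c), d). bvec (b, (c, d)))"

text \<open>The pure tensor \<open>a 1 \<otimes> \<dots> \<otimes> a m\<close> in the \<open>m\<close>-fold tensor power.\<close>

definition mtens :: "nat \<Rightarrow> (nat \<Rightarrow> ('b \<Rightarrow>\<^sub>0 'k::field)) \<Rightarrow> ((nat \<Rightarrow> 'b) \<Rightarrow>\<^sub>0 'k)"
  where "mtens m a = (\<Sum>f\<in>PiE {1..m} (\<lambda>i. Poly_Mapping.keys (a i)).
           Poly_Mapping.single f (\<Prod>i=1..m. Poly_Mapping.lookup (a i) (f i)))"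


subsection \<open>Algebras\<close>

record (overloaded) ('b, 'k::field) alg_data =
  vbasis :: "'b set"
  amult :: "('b \<Rightarrow>\<^sub>0 'k) \<Rightarrow> ('b \<Rightarrow>\<^sub>0 'k) \<Rightarrow> ('b \<Rightarrow>\<^sub>0 'k)"  (infixl \<open>\<bullet>\<index>\<close> 70)
  aone :: "'b \<Rightarrow>\<^sub>0 'k"

abbreviation acarrier :: "('b, 'k::field, 'x) alg_data_scheme \<Rightarrow> ('b \<Rightarrow>\<^sub>0 'k) set"
  where "acarrier A \<equiv> vec_on (vbasis A)"

locale k_algebra =
  fixes A :: "('b, 'k::field, 'x) alg_data_scheme" (structure)
  assumes mult_linear_left: "y \<in> acarrier A \<Longrightarrow> linear_map (vbasis A) (vbasis A) (\<lambda>x. x \<bullet> y)"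
    and mult_linear_right: "x \<in> acarrier A \<Longrightarrow> linear_map (vbasis A) (vbasis A) (\<lambda>y. x \<bullet> y)"
    and mult_assoc: "\<lbrakk>x \<in> acarrier A; y \<in> acarrier A; z \<in> acarrier A\<rbrakk>
          \<Longrightarrow> (x \<bullet> y) \<bullet> z = x \<bullet> (y \<bullet> z)"
    and one_closed: "aone A \<in> acarrier A"
    and mult_one_left: "x \<in> acarrier A \<Longrightarrow> aone A \<bullet> x = x"
    and mult_one_right: "x \<in> acarrier A \<Longrightarrow> x \<bullet> aone A = x"

definition apow :: "('b, 'k::field, 'x) alg_data_scheme \<Rightarrow> ('b \<Rightarrow>\<^sub>0 'k) \<Rightarrow> nat \<Rightarrow> ('b \<Rightarrow>\<^sub>0 'k)"
  where "apow A x i = ((\<lambda>y. y \<bullet>\<^bsub>A\<^esub> x) ^^ i) (aone A)"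

definition aunits :: "('b, 'k::field, 'x) alg_data_scheme \<Rightarrow> ('b \<Rightarrow>\<^sub>0 'k) set"
  where "aunits A = {u \<in> acarrier A. \<exists>v\<in>acarrier A. u \<bullet>\<^bsub>A\<^esub> v = aone A \<and> v \<bullet>\<^bsub>A\<^esub> u = aone A}"

definition is_subalg :: "('b \<Rightarrow>\<^sub>0 'k::field) set \<Rightarrow> ('b, 'k, 'x) alg_data_scheme \<Rightarrow> bool"
  where "is_subalg U A \<longleftrightarrow> U \<subseteq> acarrier A \<and> pm.subspace U \<and> aone A \<in> U \<and>
    (\<forall>x\<in>U. \<forall>y\<in>U. x \<bullet>\<^bsub>A\<^esub> y \<in> U)"

definition gen_subalg ::
    "('b, 'k::field, 'x) alg_data_scheme \<Rightarrow> ('b \<Rightarrow>\<^sub>0 'k) set \<Rightarrow> ('b \<Rightarrow>\<^sub>0 'k) set"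
  where "gen_subalg A X = \<Inter> {U. is_subalg U A \<and> X \<subseteq> U}"

definition left_ideal :: "('b \<Rightarrow>\<^sub>0 'k::field) set \<Rightarrow> ('b, 'k, 'x) alg_data_scheme \<Rightarrow> bool"
  where "left_ideal I A \<longleftrightarrow> I \<subseteq> acarrier A \<and> pm.subspace I \<and>
    (\<forall>a\<in>acarrier A. \<forall>x\<in>I. a \<bullet>\<^bsub>A\<^esub> x \<in> I)"

text \<open>
  Semisimplicity of the regular left module: every submodule is a direct summand.
\<close>

definition semisimple_algebra :: "('b, 'k::field, 'x) alg_data_scheme \<Rightarrow> bool"
  where "semisimple_algebra A \<longleftrightarrow>
    (\<forall>I. left_ideal I A \<longrightarrow>
      (\<exists>J. left_ideal J A \<and> I \<inter> J = {0} \<and> {x + y | x y. x \<in> I \<and> y \<in> J} = acarrier A))"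

definition tensor_alg ::
    "('b, 'k::field, 'x) alg_data_scheme \<Rightarrow> ('c, 'k, 'y) alg_data_scheme \<Rightarrow> ('b \<times> 'c, 'k) alg_data"
  where "tensor_alg A B = \<lparr>
    vbasis = vbasis A \<times> vbasis B,
    amult = bilin_ext (\<lambda>(b, c) (b', c'). (bvec b \<bullet>\<^bsub>A\<^esub> bvec b') \<boxtimes> (bvec c \<bullet>\<^bsub>B\<^esub> bvec c')),
    aone = aone A \<boxtimes> aone B \<rparr>"


subsection \<open>Hopf algebras\<close>

record (overloaded) ('b, 'k::field) hopf_data = "('b, 'k) alg_data" +
  comult :: "('b \<Rightarrow>\<^sub>0 'k) \<Rightarrow> ('b \<times> 'b \<Rightarrow>\<^sub>0 'k)"
  counit :: "('b \<Rightarrow>\<^sub>0 'k) \<Rightarrow> 'k"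
  antipode :: "('b \<Rightarrow>\<^sub>0 'k) \<Rightarrow> ('b \<Rightarrow>\<^sub>0 'k)"

locale hopf_algebra = k_algebra H for H :: "('b, 'k::field, 'x) hopf_data_scheme" (structure) +
  assumes comult_linear: "linear_map (vbasis H) (vbasis H \<times> vbasis H) (comult H)"
    and counit_linear: "linear_form (vbasis H) (counit H)"
    and antipode_linear: "linear_map (vbasis H) (vbasis H) (antipode H)"
    and coassoc: "h \<in> acarrier H \<Longrightarrow>
          tens_assoc (tens_map (comult H) id (comult H h)) = tens_map id (comult H) (comult H h)"
    and counit_left: "h \<in> acarrier H \<Longrightarrow>
          lin_ext (\<lambda>(b, c). counit H (bvec b) *\<^sub>p bvec c) (comult H h) = h"
    and counit_right: "h \<in> acarrier H \<Longrightarrow>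
          lin_ext (\<lambda>(b, c). counit H (bvec c) *\<^sub>p bvec b) (comult H h) = h"
    and comult_mult: "\<lbrakk>g \<in> acarrier H; h \<in> acarrier H\<rbrakk> \<Longrightarrow>
          comult H (g \<bullet> h) = comult H g \<bullet>\<^bsub>tensor_alg H H\<^esub> comult H h"
    and comult_one: "comult H (aone H) = aone H \<boxtimes> aone H"
    and counit_mult: "\<lbrakk>g \<in> acarrier H; h \<in> acarrier H\<rbrakk> \<Longrightarrow>
          counit H (g \<bullet> h) = counit H g * counit H h"
    and counit_one: "counit H (aone H) = 1"
    and antipode_left: "h \<in> acarrier H \<Longrightarrow>
          lin_ext (\<lambda>(b, c). antipode H (bvec b) \<bullet> bvec c) (comult H h) = counit H h *\<^sub>p aone H"
    and antipode_right: "h \<in> acarrier H \<Longrightarrow>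
          lin_ext (\<lambda>(b, c). bvec b \<bullet> antipode H (bvec c)) (comult H h) = counit H h *\<^sub>p aone H"

definition grouplike :: "('b, 'k::field, 'x) hopf_data_scheme \<Rightarrow> ('b \<Rightarrow>\<^sub>0 'k) \<Rightarrow> bool"
  where "grouplike H g \<longleftrightarrow> g \<in> acarrier H \<and> comult H g = g \<boxtimes> g \<and> counit H g = 1"

definition hopf_hom ::
    "(('b \<Rightarrow>\<^sub>0 'k::field) \<Rightarrow> ('c \<Rightarrow>\<^sub>0 'k)) \<Rightarrow>
     ('b, 'k, 'x) hopf_data_scheme \<Rightarrow> ('c, 'k, 'y) hopf_data_scheme \<Rightarrow> bool"
  where "hopf_hom f G H \<longleftrightarrow>
    linear_map (vbasis G) (vbasis H) f \<and>
    (\<forall>x\<in>acarrier G. \<forall>y\<in>acarrier G. f (x \<bullet>\<^bsub>G\<^esub> y) = f x \<bullet>\<^bsub>H\<^esub> f y) \<and>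
    f (aone G) = aone H \<and>
    (\<forall>x\<in>acarrier G. comult H (f x) = tens_map f f (comult G x)) \<and>
    (\<forall>x\<in>acarrier G. counit H (f x) = counit G x) \<and>
    (\<forall>x\<in>acarrier G. antipode H (f x) = f (antipode G x))"

definition hopf_subalg :: "('b \<Rightarrow>\<^sub>0 'k::field) set \<Rightarrow> ('b, 'k, 'x) hopf_data_scheme \<Rightarrow> bool"
  where "hopf_subalg U H \<longleftrightarrow> is_subalg U H \<and>
    (\<forall>u\<in>U. comult H u \<in> pm.span {v \<boxtimes> w | v w. v \<in> U \<and> w \<in> U}) \<and>
    (\<forall>u\<in>U. antipode H u \<in> U)"

text \<open>\<open>H\<close> is an extension of \<open>Q\<close> by \<open>R\<close>; \<open>\<iota>\<close> identifies \<open>R\<close> with a Hopf subalgebra of \<open>H\<close>.\<close>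

definition hopf_extension ::
    "('b, 'k::field, 'x) hopf_data_scheme \<Rightarrow> ('c, 'k, 'y) hopf_data_scheme \<Rightarrow>
     ('d, 'k, 'z) hopf_data_scheme \<Rightarrow> bool"
  where "hopf_extension H Q R \<longleftrightarrow>
    hopf_algebra H \<and> hopf_algebra Q \<and> hopf_algebra R \<and>
    (\<exists>\<iota> \<pi>.
      hopf_hom \<iota> R H \<and> inj_on \<iota> (acarrier R) \<and> hopf_subalg (\<iota> ` acarrier R) H \<and>
      hopf_hom \<pi> H Q \<and> \<pi> ` acarrier H = acarrier Q \<and>
      \<iota> ` acarrier R = {h \<in> acarrier H. tens_map id \<pi> (comult H h) = h \<boxtimes> aone Q})"


subsection \<open>Group algebras, tensor powers, crossed products\<close>

definition group_hopf :: "('g, 'x) monoid_scheme \<Rightarrow> ('g, 'k::field) hopf_data"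
  where "group_hopf G = \<lparr>
    vbasis = carrier G,
    amult = bilin_ext (\<lambda>g h. bvec (g \<otimes>\<^bsub>G\<^esub> h)),
    aone = bvec \<one>\<^bsub>G\<^esub>,
    comult = lin_ext (\<lambda>g. bvec (g, g)),
    counit = (\<lambda>f. \<Sum>g\<in>Poly_Mapping.keys f. Poly_Mapping.lookup f g),
    antipode = lin_ext (\<lambda>g. bvec (inv\<^bsub>G\<^esub> g)) \<rparr>"

text \<open>
  The comultiplication first forms \<open>\<Delta>(b\<^sub>1) \<otimes> \<dots> \<otimes> \<Delta>(b\<^sub>m)\<close> in the \<open>m\<close>-th power of \<open>H \<otimes> H\<close> and then
  regroups the factors into the product of two \<open>m\<close>-th powers of \<open>H\<close>.
\<close>

definition hopf_power :: "nat \<Rightarrow> ('b, 'k::field, 'x) hopf_data_scheme \<Rightarrow> (nat \<Rightarrow> 'b, 'k) hopf_data"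
  where "hopf_power m H = \<lparr>
    vbasis = PiE {1..m} (\<lambda>_. vbasis H),
    amult = bilin_ext (\<lambda>f g. mtens m (\<lambda>i. bvec (f i) \<bullet>\<^bsub>H\<^esub> bvec (g i))),
    aone = mtens m (\<lambda>_. aone H),
    comult = lin_ext (\<lambda>f. lin_ext (\<lambda>p. bvec (restrict (fst \<circ> p) {1..m}, restrict (snd \<circ> p) {1..m}))
                            (mtens m (\<lambda>i. comult H (bvec (f i))))),
    counit = (\<lambda>t. \<Sum>f\<in>Poly_Mapping.keys t.
                Poly_Mapping.lookup t f * (\<Prod>i=1..m. counit H (bvec (f i)))),
    antipode = lin_ext (\<lambda>f. mtens m (\<lambda>i. antipode H (bvec (f i)))) \<rparr>"

abbreviation cyclic_power :: "nat \<Rightarrow> nat \<Rightarrow> (nat \<Rightarrow> int, 'k::field) hopf_data"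
  where "cyclic_power n m \<equiv> hopf_power m (group_hopf (integer_mod_group n))"

text \<open>The generator of the \<open>i\<close>-th copy of the cyclic group.\<close>

definition cyclic_gen :: "nat \<Rightarrow> nat \<Rightarrow> nat \<Rightarrow> ((nat \<Rightarrow> int) \<Rightarrow>\<^sub>0 'k::field)"
  where "cyclic_gen n m i =
    mtens m (\<lambda>j. if j = i then bvec 1 else aone (group_hopf (integer_mod_group n)))"

text \<open>
  Permutation of the tensor factors: factor \<open>i\<close> is moved to position \<open>w i\<close>, so position \<open>j\<close> of the
  image of a basis tensor \<open>f\<close> carries \<open>f (w\<^sup>-\<^sup>1 j)\<close>.
\<close>

definition perm_act :: "(nat \<Rightarrow> nat) \<Rightarrow> ((nat \<Rightarrow> 'b) \<Rightarrow>\<^sub>0 'k::field) \<Rightarrow> ((nat \<Rightarrow> 'b) \<Rightarrow>\<^sub>0 'k)"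
  where "perm_act w = lin_ext (\<lambda>f. bvec (f \<circ> inv_into UNIV w))"

definition normalized_2cocycle ::
    "('b, 'k::field, 'x) alg_data_scheme \<Rightarrow> ('g, 'y) monoid_scheme \<Rightarrow>
     ('g \<Rightarrow> ('b \<Rightarrow>\<^sub>0 'k) \<Rightarrow> ('b \<Rightarrow>\<^sub>0 'k)) \<Rightarrow> ('g \<Rightarrow> 'g \<Rightarrow> ('b \<Rightarrow>\<^sub>0 'k)) \<Rightarrow> bool"
  where "normalized_2cocycle A G \<sigma> \<gamma> \<longleftrightarrow>
    (\<forall>w\<in>carrier G. \<forall>v\<in>carrier G. \<gamma> w v \<in> aunits A) \<and>
    (\<forall>w\<in>carrier G. \<forall>v\<in>carrier G. \<forall>u\<in>carrier G.
      \<gamma> w v \<bullet>\<^bsub>A\<^esub> \<gamma> (w \<otimes>\<^bsub>G\<^esub> v) u = \<sigma> w (\<gamma> v u) \<bullet>\<^bsub>A\<^esub> \<gamma> w (v \<otimes>\<^bsub>G\<^esub> u)) \<and>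
    (\<forall>w\<in>carrier G. \<gamma> \<one>\<^bsub>G\<^esub> w = aone A \<and> \<gamma> w \<one>\<^bsub>G\<^esub> = aone A)"

text \<open>
  The free left \<open>A\<close>-module on the symbols \<open>\<^bold>w\<close> for \<open>w\<close> in \<open>G\<close> is the vector space
  with basis \<open>vbasis A \<times> carrier G\<close>, the element \<open>a \<^bold>w\<close> being \<open>a \<boxtimes> bvec w\<close>.
\<close>

definition crossed_product ::
    "('b, 'k::field, 'x) alg_data_scheme \<Rightarrow> ('g, 'y) monoid_scheme \<Rightarrow>
     ('g \<Rightarrow> ('b \<Rightarrow>\<^sub>0 'k) \<Rightarrow> ('b \<Rightarrow>\<^sub>0 'k)) \<Rightarrow> ('g \<Rightarrow> 'g \<Rightarrow> ('b \<Rightarrow>\<^sub>0 'k)) \<Rightarrow> ('b \<times> 'g, 'k) alg_data"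
  where "crossed_product A G \<sigma> \<gamma> = \<lparr>
    vbasis = vbasis A \<times> carrier G,
    amult = bilin_ext (\<lambda>(a, w) (b, v).
              (bvec a \<bullet>\<^bsub>A\<^esub> \<sigma> w (bvec b) \<bullet>\<^bsub>A\<^esub> \<gamma> w v) \<boxtimes> bvec (w \<otimes>\<^bsub>G\<^esub> v)),
    aone = aone A \<boxtimes> bvec \<one>\<^bsub>G\<^esub> \<rparr>"


subsection \<open>Basic properties\<close>

lemma keys_scl: "Poly_Mapping.keys (c *\<^sub>p f) \<subseteq> Poly_Mapping.keys f"
  by (auto simp: in_keys_iff)

lemma lin_ext_superset:
  assumes "finite A" "Poly_Mapping.keys f \<subseteq> A"
  shows "lin_ext \<phi> f = (\<Sum>b\<in>A. Poly_Mapping.lookup f b *\<^sub>p \<phi> b)"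
  unfolding lin_ext_def using assms
  by (intro sum.mono_neutral_left) (auto simp: in_keys_iff)

lemma lin_ext_single: "lin_ext \<phi> (bvec b) = \<phi> b"
  by (simp add: lin_ext_def)
lemma lin_ext_add: "lin_ext \<phi> (f + g) = lin_ext \<phi> f + lin_ext \<phi> g"
proof -
  let ?A = "Poly_Mapping.keys f \<union> Poly_Mapping.keys g"
  have "Poly_Mapping.keys (f+g) \<subseteq> ?A" by (rule keys_add)
  then show ?thesis
    by (subst (1 2 3) lin_ext_superset[where A="?A"])
      (auto simp: lookup_add pm.scale_left_distrib sum.distrib)
qed
lemma lin_ext_scl: "lin_ext \<phi> (c *\<^sub>p f) = c *\<^sub>p lin_ext \<phi> f"
  by (subst (1 2) lin_ext_superset[where A="Poly_Mapping.keys f"])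
     (auto simp: pm.scale_sum_right in_keys_iff)
lemma expand: "f = lin_ext bvec f"
  by (rule poly_mapping_eqI) (auto simp: lin_ext_def lookup_sum lookup_single when_def in_keys_iff if_distrib[of "\<lambda>x. _ * x"] cong: if_cong)
lemma lin_ext_closed: "(\<And>b. b \<in> B \<Longrightarrow> \<phi> b \<in> vec_on C) \<Longrightarrow> f \<in> vec_on B \<Longrightarrow> lin_ext \<phi> f \<in> vec_on C"
  unfolding lin_ext_def vec_on_def using keys_scl by (fastforce dest!: subsetD[OF keys_sum])
lemma lin_ext_linear: "(\<And>b. b \<in> B \<Longrightarrow> \<phi> b \<in> vec_on C) \<Longrightarrow> linear_map B C (lin_ext \<phi>)"
  unfolding linear_map_def by (auto simp: lin_ext_add lin_ext_scl intro: lin_ext_closed)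
lemma tens_bvec [simp]: "bvec b \<boxtimes> bvec c = bvec (b,c)"
  by (simp add: tens_def bilin_ext_def lin_ext_single)
lemma lookup_tens: "Poly_Mapping.lookup (f \<boxtimes> g) (b,c) = Poly_Mapping.lookup f b * Poly_Mapping.lookup g c"
proof -
  have 1: "Poly_Mapping.lookup (lin_ext (\<lambda>c. bvec (b', c)) g) (b,c) = (if b'=b then Poly_Mapping.lookup g c else 0)" for b'
    by (auto simp: lin_ext_def lookup_sum lookup_single when_def in_keys_iff if_distrib[of "\<lambda>x. _ * x"] cong: if_cong)
  show ?thesis
    unfolding tens_def bilin_ext_def lin_ext_def[of _ f]
    by (simp add: lookup_sum 1 if_distrib cong: if_cong) (auto simp: in_keys_iff)
qed

lemma lin_ext_0[simp]: "lin_ext \<phi> 0 = 0" by (simp add: lin_ext_def)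
lemma lin_ext_sum: "lin_ext \<phi> (sum h A) = (\<Sum>a\<in>A. lin_ext \<phi> (h a))"
  by (induction A rule: infinite_finite_induct) (auto simp: lin_ext_add)
lemma lin_ext_cong: "(\<And>b. b \<in> B \<Longrightarrow> \<phi> b = \<psi> b) \<Longrightarrow> f \<in> vec_on B \<Longrightarrow> lin_ext \<phi> f = lin_ext \<psi> f"
  unfolding lin_ext_def vec_on_def by (intro sum.cong) auto
lemma lin_ext_lin_ext: "lin_ext \<psi> (lin_ext \<phi> f) = lin_ext (\<lambda>b. lin_ext \<psi> (\<phi> b)) f"
  by (simp add: lin_ext_def[of \<phi>] lin_ext_def[of "\<lambda>b. lin_ext \<psi> (\<phi> b)"] lin_ext_sum lin_ext_scl)
lemma lin_ext_eqI: "(\<And>b. b \<in> B \<Longrightarrow> \<phi> b = bvec b) \<Longrightarrow> f \<in> vec_on B \<Longrightarrow> lin_ext \<phi> f = f"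
  using lin_ext_cong[of B \<phi> bvec f] expand[of f] by simp
lemma bvec_in[simp]: "bvec b \<in> vec_on B \<longleftrightarrow> b \<in> B" by (auto simp: vec_on_def)
lemma bilin_swap: "bilin_ext \<phi> f g = lin_ext (\<lambda>c. lin_ext (\<lambda>b. \<phi> b c) f) g"
  unfolding bilin_ext_def lin_ext_def pm.scale_sum_right
  by (subst sum.swap) (simp add: mult.commute)
lemma bilin_add1: "bilin_ext \<phi> (f+f') g = bilin_ext \<phi> f g + bilin_ext \<phi> f' g"
 by (simp add: bilin_ext_def lin_ext_add)
lemma bilin_scl1: "bilin_ext \<phi> (c *\<^sub>p f) g = c *\<^sub>p bilin_ext \<phi> f g"
 by (simp add: bilin_ext_def lin_ext_scl)
lemma bilin_add2: "bilin_ext \<phi> f (g+g') = bilin_ext \<phi> f g + bilin_ext \<phi> f g'"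
 by (simp add: bilin_swap lin_ext_add)
lemma bilin_scl2: "bilin_ext \<phi> f (c *\<^sub>p g) = c *\<^sub>p bilin_ext \<phi> f g"
 by (simp add: bilin_swap lin_ext_scl)
lemma bilin_bvec[simp]: "bilin_ext \<phi> (bvec b) (bvec c) = \<phi> b c"
 by (simp add: bilin_ext_def lin_ext_single)
lemma zero_in[simp]: "0 \<in> vec_on B" by (auto simp: vec_on_def)
lemma add_in: "f \<in> vec_on B \<Longrightarrow> g \<in> vec_on B \<Longrightarrow> f+g \<in> vec_on B"
  using keys_add[of f g] by (auto simp: vec_on_def)
lemma scl_in: "f \<in> vec_on B \<Longrightarrow> c *\<^sub>p f \<in> vec_on B"
  by (auto simp: vec_on_def in_keys_iff)

lemma vec_induct [consumes 1, case_names zero add]: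
  assumes "f \<in> vec_on B" "P 0" "\<And>c b g. b \<in> B \<Longrightarrow> g \<in> vec_on B \<Longrightarrow> P g \<Longrightarrow> P (c *\<^sub>p bvec b + g)"
  shows "P f"
proof -
  have "finite A \<Longrightarrow> A \<subseteq> B \<Longrightarrow> P (\<Sum>b\<in>A. Poly_Mapping.lookup f b *\<^sub>p bvec b) \<and> (\<Sum>b\<in>A. Poly_Mapping.lookup f b *\<^sub>p bvec b) \<in> vec_on B" for A
    by (induction A rule: finite_induct) (auto intro!: assms add_in scl_in)
  from this[of "Poly_Mapping.keys f"] show ?thesis
    using assms(1) expand[of f] by (auto simp: vec_on_def lin_ext_def)
qed

lemma crossed_product_mult:
  fixes A :: "('b,'k::field,'x) alg_data_scheme" (structure) and G :: "('g,'y) monoid_scheme"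
  assumes "k_algebra A" assumes a: "a \<in> acarrier A" and b: "b \<in> acarrier A" and s: "linear_map (vbasis A) (vbasis A) (\<sigma> w)"
    and g: "\<gamma> w v \<in> acarrier A"
  shows "(a \<boxtimes> bvec w) \<bullet>\<^bsub>crossed_product A G \<sigma> \<gamma>\<^esub> (b \<boxtimes> bvec v)
     = (a \<bullet> \<sigma> w b \<bullet> \<gamma> w v) \<boxtimes> bvec (w \<otimes>\<^bsub>G\<^esub> v)"
proof -
  interpret k_algebra A by fact
  have ml: "linear_map (vbasis A) (vbasis A) (\<lambda>x. x \<bullet> y)" "linear_map (vbasis A) (vbasis A) (\<lambda>x. y \<bullet> x)"  if "y \<in> acarrier A" for y
    using that by (rule mult_linear_left, intro mult_linear_right)
  have l0: "L 0 = 0" if "linear_map B C L" for L :: "('b \<Rightarrow>\<^sub>0 'k) \<Rightarrow> 'b \<Rightarrow>\<^sub>0 'k" and B C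
    using that unfolding linear_map_def by (metis zero_in pm.scale_zero_left)
  have t: "(f + f') \<boxtimes> h = f \<boxtimes> h + f' \<boxtimes> h" "(c *\<^sub>p f) \<boxtimes> h = c *\<^sub>p (f \<boxtimes> h)" "0 \<boxtimes> h = 0"
    for f f' :: "'b \<Rightarrow>\<^sub>0 'k" and h :: "'g \<Rightarrow>\<^sub>0 'k" and c
    by (simp_all add: tens_def bilin_add1 bilin_scl1, simp add: bilin_ext_def)
  have bs: "\<sigma> w y \<in> acarrier A" if "y \<in> acarrier A" for y using s that by (auto simp: linear_map_def)
  have cl: "y \<bullet> y' \<in> acarrier A" if "y \<in> acarrier A" "y' \<in> acarrier A" for y y' using ml(1)[OF that(2)] that by (auto simp: linear_map_def)
  let ?M = "amult (crossed_product A G \<sigma> \<gamma>)"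
  have M: "?M = bilin_ext (\<lambda>(a, w) (b, v).
              (bvec a \<bullet> \<sigma> w (bvec b) \<bullet> \<gamma> w v) \<boxtimes> bvec (w \<otimes>\<^bsub>G\<^esub> v))" by (simp add: crossed_product_def)
  have 1: "?M (bvec x \<boxtimes> bvec w) (b \<boxtimes> bvec v) = (bvec x \<bullet> \<sigma> w b \<bullet> \<gamma> w v) \<boxtimes> bvec (w \<otimes>\<^bsub>G\<^esub> v)" if x: "x \<in> vbasis A" for x
    using b
  proof (induction b rule: vec_induct)
    case zero
    have "bvec x \<bullet> 0 = 0" "0 \<bullet> \<gamma> w v = 0" using l0[OF ml(2)] l0[OF ml(1)] g x by auto
    then show ?case by (simp add: t l0[OF s] M bilin_swap)
  next
    case (add c y h)
    have [simp]: "\<sigma> w (c *\<^sub>p bvec y + h) = c *\<^sub>p \<sigma> w (bvec y) + \<sigma> w h"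
      using add s by (auto simp: linear_map_def scl_in)
    have [simp]: "bvec x \<bullet> (c *\<^sub>p \<sigma> w (bvec y) + \<sigma> w h) = c *\<^sub>p (bvec x \<bullet> \<sigma> w (bvec y)) + bvec x \<bullet> \<sigma> w h"
      using ml(2)[of "bvec x"] x add by (auto simp: linear_map_def bs scl_in)
    have [simp]: "(c *\<^sub>p (bvec x \<bullet> \<sigma> w (bvec y)) + bvec x \<bullet> \<sigma> w h) \<bullet> \<gamma> w v = c *\<^sub>p (bvec x \<bullet> \<sigma> w (bvec y) \<bullet> \<gamma> w v) + bvec x \<bullet> \<sigma> w h \<bullet> \<gamma> w v"
      using ml(1)[OF g] x add by (auto simp: linear_map_def bs scl_in cl)
    show ?case using add.IH by (simp add: t M bilin_add2 bilin_scl2)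
  qed
  show ?thesis using a
  proof (induction a rule: vec_induct)
    case zero
    have "0 \<bullet> \<sigma> w b = 0" "0 \<bullet> \<gamma> w v = 0" using l0[OF ml(1)] g bs b by auto
    then show ?case by (simp add: t M bilin_ext_def)
  next
    case (add c x h)
    have [simp]: "(c *\<^sub>p bvec x + h) \<bullet> \<sigma> w b = c *\<^sub>p (bvec x \<bullet> \<sigma> w b) + h \<bullet> \<sigma> w b"
      using ml(1)[OF bs[OF b]] add by (auto simp: linear_map_def scl_in)
    have [simp]: "(c *\<^sub>p (bvec x \<bullet> \<sigma> w b) + h \<bullet> \<sigma> w b) \<bullet> \<gamma> w v = c *\<^sub>p (bvec x \<bullet> \<sigma> w b \<bullet> \<gamma> w v) + h \<bullet> \<sigma> w b \<bullet> \<gamma> w v"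
      using ml(1)[OF g] add by (auto simp: linear_map_def bs b scl_in cl)
    show ?case using add.IH 1[OF add(1)] by (simp add: t M bilin_add1 bilin_scl1)
  qed
qed

lemma mtens_bvec: "mtens m (\<lambda>i. bvec (f i)) = (bvec (restrict f {1..m}) :: _ \<Rightarrow>\<^sub>0 'k::field)"
proof -
  have "PiE {1..m} (\<lambda>i. Poly_Mapping.keys (bvec (f i) :: _ \<Rightarrow>\<^sub>0 'k)) = {restrict f {1..m}}"
    by (auto simp: PiE_iff extensional_def fun_eq_iff restrict_def)
  then show ?thesis by (simp add: mtens_def)
qed

lemma cyclic_gen_eq: "cyclic_gen n m i = (bvec (\<lambda>j\<in>{1..m}. if j = i then 1 else 0) :: _ \<Rightarrow>\<^sub>0 'k::field)"
proof -
  have "cyclic_gen n m i = mtens m (\<lambda>j. bvec (if j = i then 1 else 0))"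
    unfolding cyclic_gen_def by (rule arg_cong[where f="mtens m"]) (auto simp: group_hopf_def)
  then show ?thesis by (simp add: mtens_bvec)
qed

lemma perm_act_cyclic_gen:
  assumes "w permutes {1..m}" 
  shows "perm_act w (cyclic_gen n m i) = (cyclic_gen n m (w i) :: _ \<Rightarrow>\<^sub>0 'k::field)"
proof -
  have "(\<lambda>j\<in>{1..m}. if j = i then 1 else 0) \<circ> inv_into UNIV w = (\<lambda>j\<in>{1..m}. if j = w i then 1 else (0::int))"
    using permutes_in_image[OF permutes_inv[OF assms]] permutes_inv_eq[OF assms]
    by (auto simp: fun_eq_iff)
  then show ?thesis by (simp add: cyclic_gen_eq perm_act_def lin_ext_single)
qed

end

theory Submission
  imports Defs "HOL-Algebra.Product_Groups" "HOL-Number_Theory.Cong"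
begin

text \<open>
  Diagonalise the group algebra of \<open>A = Z\<^sub>n\<^sup>m\<close>: the idempotents \<open>e a\<close> indexed by the characters
  \<open>a\<close> of \<open>A\<close> turn \<open>R\<close> into the algebra of functions on \<open>A\<close>, and the elements \<open>E a w = e a \<otimes> w\<close> span
  the crossed product. The prescribed squares and coproducts of the \<open>z\<^sub>k\<close> become the functions
  \<open>q ^ (a\<^sub>k a\<^sub>k\<^sub>+\<^sub>1)\<close> and \<open>q ^ (a\<^sub>k b\<^sub>k\<^sub>+\<^sub>1)\<close>. They extend to all permutations: let \<open>J w a b\<close> be \<open>q\<close> to the
  sum of \<open>a\<^sub>p b\<^sub>r\<close> over the inversions \<open>(p, r)\<close> of \<open>w\<close>, and \<open>g w v a\<close> be \<open>q\<close> to the sum of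
  \<open>a\<^sub>p a\<^sub>r\<close> over the inversions of \<open>w\<close> which are undone by \<open>v\<close>. Comparing the order of \<open>p\<close> and \<open>r\<close>
  before and after applying the permutations shows that \<open>g\<close> is a 2-cocycle and that the failure of
  \<open>J\<close> to be a 1-cocycle is exactly the coboundary of \<open>g\<close> on \<open>A\<close>. These two identities give
  associativity and the multiplicativity of the coproduct; coassociativity holds because \<open>J w\<close> is
  bimultiplicative, and the antipode axiom because all inversions of \<open>w\<close> are undone by its inverse,
  so that \<open>g w w\<inverse> a = J w a a\<close>. Semisimplicity comes from the separability element
  \<open>1/|\<Sigma>\<^sub>m|\<close> times the sum of the \<open>E a w \<otimes> E' a w\<close>, where \<open>E' a w\<close> is the multiple of
  \<open>E (a \<circ> w) w\<inverse>\<close> with \<open>E a w \<bullet> E' a w = e a\<close>.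
\<close>

section \<open>Linear maps on based vector spaces\<close>

abbreviation plinear :: "(('b \<Rightarrow>\<^sub>0 'k::field) \<Rightarrow> ('c \<Rightarrow>\<^sub>0 'k)) \<Rightarrow> bool"
  where "plinear \<equiv> Vector_Spaces.linear scl scl"

abbreviation plinear_form :: "(('b \<Rightarrow>\<^sub>0 'k::field) \<Rightarrow> 'k) \<Rightarrow> bool"
  where "plinear_form \<equiv> Vector_Spaces.linear scl (*)"

lemma plinear_iff:
  "plinear f \<longleftrightarrow> (\<forall>x y. f (x + y) = f x + f y) \<and> (\<forall>c x. f (c *\<^sub>p x) = c *\<^sub>p f x)"
  by (simp add: Vector_Spaces.linear_iff pm.vector_space_axioms)

lemma vector_space_field: "vector_space ((*) :: 'k::field \<Rightarrow> 'k \<Rightarrow> 'k)"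
  by unfold_locales (simp_all add: algebra_simps)

lemma plinear_form_iff:
  "plinear_form f \<longleftrightarrow> (\<forall>x y. f (x + y) = f x + f y) \<and> (\<forall>c x. f (c *\<^sub>p x) = c * f x)"
  by (simp add: Vector_Spaces.linear_iff pm.vector_space_axioms vector_space_field)

lemma plinear_simps:
  assumes "plinear f"
  shows "f 0 = 0" "f (x + y) = f x + f y" "f (c *\<^sub>p x) = c *\<^sub>p f x" "f (sum h I) = (\<Sum>i\<in>I. f (h i))"
  using assms
  by (auto simp: Vector_Spaces.linear.axioms(3)[THEN module_hom.zero] Vector_Spaces.linear.axioms(3)[THEN module_hom.add]
      Vector_Spaces.linear.axioms(3)[THEN module_hom.scale] Vector_Spaces.linear.axioms(3)[THEN module_hom.sum])

lemma plinear_form_simps: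
  assumes "plinear_form f"
  shows "f 0 = 0" "f (x + y) = f x + f y" "f (c *\<^sub>p x) = c * f x" "f (sum h I) = (\<Sum>i\<in>I. f (h i))"
  using assms
  by (auto simp: Vector_Spaces.linear.axioms(3)[THEN module_hom.zero] Vector_Spaces.linear.axioms(3)[THEN module_hom.add]
      Vector_Spaces.linear.axioms(3)[THEN module_hom.scale] Vector_Spaces.linear.axioms(3)[THEN module_hom.sum])

lemma plinear_lin_ext [simp]: "plinear (lin_ext \<phi>)"
  by (simp add: plinear_iff lin_ext_add lin_ext_scl)

lemma plinear_bilin_ext [simp]:
  "plinear (\<lambda>x. bilin_ext \<phi> x y)" "plinear (\<lambda>y. bilin_ext \<phi> x y)" "plinear (bilin_ext \<phi> x)"
  by (simp_all add: plinear_iff bilin_add1 bilin_add2 bilin_scl1 bilin_scl2)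

lemma plinear_tens [simp]: "plinear (\<lambda>x. x \<boxtimes> y)" "plinear (\<lambda>y. x \<boxtimes> y)" "plinear (tens x)"
  by (simp_all add: tens_def)

lemmas tens_simps = plinear_simps[OF plinear_tens(1)] plinear_simps[OF plinear_tens(2)]

lemma plinear_id [simp]: "plinear id" "plinear (\<lambda>x. x)"
  by (simp_all add: plinear_iff)

lemma plinear_form_sum: "plinear_form (\<lambda>f. \<Sum>b\<in>Poly_Mapping.keys f. Poly_Mapping.lookup f b * \<phi> b)"
proof -
  \<comment> \<open>Read as the single coefficient of a linear extension into the one-dimensional
    space with basis \<open>()\<close>, the sum is linear in \<open>f\<close> although its range
    depends on \<open>f\<close>.\<close>
  have "(\<Sum>b\<in>Poly_Mapping.keys f. Poly_Mapping.lookup f b * \<phi> b) =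
     Poly_Mapping.lookup (lin_ext (\<lambda>b. Poly_Mapping.single () (\<phi> b)) f) ()" for f
    by (simp add: lin_ext_def lookup_sum)
  then show ?thesis
    by (simp add: plinear_form_iff lin_ext_add lin_ext_scl lookup_add)
qed

section \<open>Bases, spans and dimension\<close>

lemma subspace_vec_on: "pm.subspace (vec_on B)"
  by (simp add: pm.subspace_def add_in scl_in)

lemma bvec_inject [simp]: "(bvec a :: 'b \<Rightarrow>\<^sub>0 'k::field) = bvec b \<longleftrightarrow> a = b"
  by (metis bvec_in singleton_iff)

lemma span_bvec: "pm.span (bvec ` B) = (vec_on B :: ('b \<Rightarrow>\<^sub>0 'k::field) set)"
proof (rule pm.span_subspace)
  show "(vec_on B :: ('b \<Rightarrow>\<^sub>0 'k) set) \<subseteq> pm.span (bvec ` B)"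
  proof
    fix f :: "'b \<Rightarrow>\<^sub>0 'k" assume "f \<in> vec_on B"
    then show "f \<in> pm.span (bvec ` B)"
      by (induction rule: vec_induct)
        (simp_all add: pm.span_zero pm.span_add pm.span_scale pm.span_base)
  qed
qed (auto simp: subspace_vec_on)

lemma dim_vec_on: "pm.dim (vec_on B :: ('b \<Rightarrow>\<^sub>0 'k::field) set) = card B"
proof -
  have "b \<notin> A" if "bvec b \<in> pm.span (bvec ` A - {bvec b} :: ('b \<Rightarrow>\<^sub>0 'k) set)" for b A
  proof -
    have "bvec ` A - {bvec b} = (bvec ` (A - {b}) :: ('b \<Rightarrow>\<^sub>0 'k) set)"
      by auto
    then show ?thesis using that by (simp add: span_bvec)
  qed
  then have "pm.independent (bvec ` B :: ('b \<Rightarrow>\<^sub>0 'k) set)"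
    unfolding pm.dependent_def by blast
  then have "pm.dim (vec_on B :: ('b \<Rightarrow>\<^sub>0 'k) set) = card (bvec ` B :: ('b \<Rightarrow>\<^sub>0 'k) set)"
    unfolding span_bvec[symmetric] by (rule pm.dim_span_eq_card_independent)
  also have "inj_on (bvec :: 'b \<Rightarrow> 'b \<Rightarrow>\<^sub>0 'k) B"
    by (auto intro!: inj_onI)
  then have "card (bvec ` B :: ('b \<Rightarrow>\<^sub>0 'k) set) = card B"
    by (rule card_image)
  finally show ?thesis .
qed

text \<open>Adding multiples of spanning vectors one at a time keeps \<open>y\<close> inside the
  space, so its membership is available in the step.\<close>

lemma span_eq_induct [consumes 2, case_names zero add]:
  assumes "x \<in> vec_on B" "vec_on B = pm.span X" "P 0"
    "\<And>c x y. x \<in> X \<Longrightarrow> y \<in> vec_on B \<Longrightarrow> P y \<Longrightarrow> P (c *\<^sub>p x + y)"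
  shows "P x"
proof -
  have "x \<in> vec_on B \<and> P x" using assms(1)[unfolded assms(2)]
  proof (induction rule: pm.span_induct_alt)
    case base
    show ?case using assms(3) by simp
  next
    case (step c x y)
    then have "x \<in> vec_on B" "y \<in> vec_on B" "P y" using assms(2) by (auto simp: pm.span_base)
    then show ?case using step(1) assms(4) by (simp add: add_in scl_in)
  qed
  then show ?thesis ..
qed

lemma linear_map_spanI:
  fixes f :: "('b \<Rightarrow>\<^sub>0 'k::field) \<Rightarrow> ('c \<Rightarrow>\<^sub>0 'k)"
    and X :: "('b \<Rightarrow>\<^sub>0 'k) set"
  assumes "plinear f" "vec_on B = pm.span X" "\<And>x. x \<in> X \<Longrightarrow> f x \<in> vec_on C"
  shows "linear_map B C f"
  unfolding linear_map_def
proof (intro conjI ballI allI)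
  show "f \<in> vec_on B \<rightarrow> vec_on C"
  proof
    fix x :: "'b \<Rightarrow>\<^sub>0 'k" assume "x \<in> vec_on B"
    then show "f x \<in> vec_on C" using assms(2)
      by (induction rule: span_eq_induct) (auto simp: plinear_simps[OF assms(1)] assms(3) add_in scl_in)
  qed
qed (auto simp: plinear_simps[OF assms(1)])

section \<open>Maps on tensor products\<close>

lemma lin_ext_tens: "lin_ext \<phi> (x \<boxtimes> y) = bilin_ext (\<lambda>b c. \<phi> (b, c)) x y"
proof -
  have "(\<Sum>b\<in>Poly_Mapping.keys x. Poly_Mapping.lookup x b *\<^sub>p
      (\<Sum>c\<in>Poly_Mapping.keys y. Poly_Mapping.lookup y c *\<^sub>p lin_ext \<phi> (bvec (b,c)))) =
    (\<Sum>b\<in>Poly_Mapping.keys x. Poly_Mapping.lookup x b *\<^sub>p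
      (\<Sum>c\<in>Poly_Mapping.keys y. Poly_Mapping.lookup y c *\<^sub>p \<phi> (b, c)))"
    by (simp add: lin_ext_single)
  then show ?thesis
    by (simp add: tens_def bilin_ext_def lin_ext_lin_ext lin_ext_single)
qed

lemma lin_ext_bvec_plinear:
  fixes f :: "('b \<Rightarrow>\<^sub>0 'k::field) \<Rightarrow> ('c \<Rightarrow>\<^sub>0 'k)"
  assumes f: "plinear f"
  shows "lin_ext (\<lambda>b. f (bvec b)) x = f x"
proof -
  have "f (lin_ext bvec x) = lin_ext (\<lambda>b. f (bvec b)) x"
    by (simp add: lin_ext_def plinear_simps[OF f])
  then show ?thesis using expand[of x] by simp
qed

text \<open>The counit and antipode axioms are written basis vector by basis vector. Bilinearity
  lets them be evaluated on any pure tensor, in particular on tensors of idempotents.\<close>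

lemma lin_ext_tens_bilinear:
  assumes "\<And>y. plinear (\<lambda>x. f x y)" "\<And>x. plinear (f x)"
  shows "lin_ext (\<lambda>(b, c). f (bvec b) (bvec c)) (x \<boxtimes> y) = f x y"
proof -
  have "lin_ext (\<lambda>(b, c). f (bvec b) (bvec c)) (x \<boxtimes> y) = lin_ext (\<lambda>b. f (bvec b) y) x"
    by (simp add: lin_ext_tens bilin_ext_def lin_ext_bvec_plinear[OF assms(2)])
  also have "\<dots> = f x y" using lin_ext_bvec_plinear[OF assms(1)[of y]] .
  finally show ?thesis .
qed

lemma tens_map_tens: "plinear f \<Longrightarrow> plinear g \<Longrightarrow> tens_map f g (x \<boxtimes> y) = f x \<boxtimes> g y"
  unfolding tens_map_def
  by (rule lin_ext_tens_bilinear) (auto simp: plinear_iff tens_simps)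

lemma plinear_tens_map [simp]: "plinear (tens_map f g)"
  by (simp add: tens_map_def)

lemma tens_assoc_tens [simp]: "tens_assoc ((x \<boxtimes> y) \<boxtimes> z) = x \<boxtimes> (y \<boxtimes> z)"
  for x :: "'a \<Rightarrow>\<^sub>0 'k::field" and y :: "'c \<Rightarrow>\<^sub>0 'k" and z :: "'d \<Rightarrow>\<^sub>0 'k"
proof -
  have 1: "tens_assoc (bvec p \<boxtimes> z) = bvec (fst p) \<boxtimes> (bvec (snd p) \<boxtimes> z)" for p :: "'a \<times> 'c"
    unfolding tens_assoc_def
    by (subst lin_ext_tens)
      (simp add: bilin_ext_def lin_ext_single tens_def lin_ext_lin_ext case_prod_unfold)
  have "tens_assoc (p \<boxtimes> z) = lin_ext (\<lambda>(b, c). bvec b \<boxtimes> (bvec c \<boxtimes> z)) p" for p :: "'a \<times> 'c \<Rightarrow>\<^sub>0 'k"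
  proof -
    have "plinear (\<lambda>p. tens_assoc (p \<boxtimes> z))"
      by (simp add: tens_assoc_def plinear_iff tens_simps lin_ext_add lin_ext_scl)
    from lin_ext_bvec_plinear[OF this, of p, symmetric] show ?thesis by (simp add: 1 case_prod_unfold)
  qed
  also have "lin_ext (\<lambda>(b, c). bvec b \<boxtimes> (bvec c \<boxtimes> z)) (x \<boxtimes> y) = x \<boxtimes> (y \<boxtimes> z)"
    by (rule lin_ext_tens_bilinear) (auto simp: plinear_iff tens_simps)
  finally show ?thesis .
qed

lemma plinear_tens_assoc [simp]: "plinear tens_assoc"
  by (simp add: tens_assoc_def)

lemma tens_in: "x \<in> vec_on B \<Longrightarrow> y \<in> vec_on C \<Longrightarrow> x \<boxtimes> y \<in> vec_on (B \<times> C)"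
  by (auto simp: vec_on_def in_keys_iff lookup_tens subset_iff)

lemma sum_in: "(\<And>i. i \<in> I \<Longrightarrow> h i \<in> vec_on B) \<Longrightarrow> sum h I \<in> vec_on B"
  by (rule pm.subspace_sum[OF subspace_vec_on])

lemma tensor_alg_mult:
  assumes "\<And>y. plinear (\<lambda>x. x \<bullet>\<^bsub>A\<^esub> y)" "\<And>x. plinear (amult A x)"
    and "\<And>y. plinear (\<lambda>x. x \<bullet>\<^bsub>B\<^esub> y)" "\<And>x. plinear (amult B x)"
  shows "(a \<boxtimes> b) \<bullet>\<^bsub>tensor_alg A B\<^esub> (a' \<boxtimes> b') = (a \<bullet>\<^bsub>A\<^esub> a') \<boxtimes> (b \<bullet>\<^bsub>B\<^esub> b')"
proof -
  note l = plinear_simps[OF assms(1)] plinear_simps[OF assms(2)]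
    plinear_simps[OF assms(3)] plinear_simps[OF assms(4)]
  have 1: "lin_ext (\<lambda>(b', c'). (bvec x \<bullet>\<^bsub>A\<^esub> bvec b') \<boxtimes> (bvec y \<bullet>\<^bsub>B\<^esub> bvec c')) (a' \<boxtimes> b')
     = (bvec x \<bullet>\<^bsub>A\<^esub> a') \<boxtimes> (bvec y \<bullet>\<^bsub>B\<^esub> b')" for x y
    by (rule lin_ext_tens_bilinear) (auto simp: plinear_iff tens_simps l)
  have "(a \<boxtimes> b) \<bullet>\<^bsub>tensor_alg A B\<^esub> (a' \<boxtimes> b') =
     lin_ext (\<lambda>(x, y). (bvec x \<bullet>\<^bsub>A\<^esub> a') \<boxtimes> (bvec y \<bullet>\<^bsub>B\<^esub> b')) (a \<boxtimes> b)"
    unfolding tensor_alg_def bilin_ext_def using 1 by (simp add: case_prod_unfold)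
  also have "\<dots> = (a \<bullet>\<^bsub>A\<^esub> a') \<boxtimes> (b \<bullet>\<^bsub>B\<^esub> b')"
    by (rule lin_ext_tens_bilinear) (auto simp: plinear_iff tens_simps l)
  finally show ?thesis .
qed

lemma plinear_tensor_alg: "plinear (\<lambda>x. x \<bullet>\<^bsub>tensor_alg A B\<^esub> y)" "plinear (amult (tensor_alg A B) x)"
  by (simp_all add: tensor_alg_def)

section \<open>Hopf algebras given on a spanning set\<close>

text \<open>The Hopf axioms ask for linearity on the carrier only. Here the maps are linear on the
  whole type, as every linear extension is, so identities extend from \<open>X\<close> to its span
  by linearity alone. \<open>X\<close> may be any spanning set: the group elements for group
  algebras, the \<open>E a w\<close> for the crossed product.\<close>

locale bilinear_hopf_data =
  fixes H :: "('b, 'k::field, 'x) hopf_data_scheme" (structure) and X :: "('b \<Rightarrow>\<^sub>0 'k) set"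
  assumes span_X: "acarrier H = pm.span X"
    and amult_linear: "\<And>y. plinear (\<lambda>x. x \<bullet> y)" "\<And>x. plinear (amult H x)"
    and comult_plinear: "plinear (comult H)"
    and counit_plinear: "plinear_form (counit H)"
    and antipode_plinear: "plinear (antipode H)"
begin

lemmas H_simps = plinear_simps[OF amult_linear(1)] plinear_simps[OF amult_linear(2)]
  plinear_simps[OF comult_plinear] plinear_simps[OF antipode_plinear]
  plinear_form_simps[OF counit_plinear]
  tens_simps plinear_simps[OF plinear_lin_ext] plinear_simps[OF plinear_tens_map]
  plinear_simps[OF plinear_tens_assoc] plinear_simps[OF plinear_tensor_alg(1)]
  plinear_simps[OF plinear_tensor_alg(2)] pm.scale_right_distrib pm.scale_left_distrib

lemma counit_left_tens: "lin_ext (\<lambda>(b, c). counit H (bvec b) *\<^sub>p bvec c) (x \<boxtimes> y) = counit H x *\<^sub>p y"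
  by (rule lin_ext_tens_bilinear[where f = "\<lambda>x y. counit H x *\<^sub>p y"])
    (auto simp: plinear_iff H_simps mult.commute)

lemma counit_right_tens: "lin_ext (\<lambda>(b, c). counit H (bvec c) *\<^sub>p bvec b) (x \<boxtimes> y) = counit H y *\<^sub>p x"
  by (rule lin_ext_tens_bilinear[where f = "\<lambda>x y. counit H y *\<^sub>p x"])
    (auto simp: plinear_iff H_simps mult.commute)

lemma antipode_left_tens:
  "lin_ext (\<lambda>(b, c). antipode H (bvec b) \<bullet> bvec c) (x \<boxtimes> y) = antipode H x \<bullet> y"
  by (rule lin_ext_tens_bilinear[where f = "\<lambda>x y. antipode H x \<bullet> y"]) (auto simp: plinear_iff H_simps)

lemma antipode_right_tens:
  "lin_ext (\<lambda>(b, c). bvec b \<bullet> antipode H (bvec c)) (x \<boxtimes> y) = x \<bullet> antipode H y"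
  by (rule lin_ext_tens_bilinear[where f = "\<lambda>x y. x \<bullet> antipode H y"]) (auto simp: plinear_iff H_simps)

lemma tensor_mult: "(a \<boxtimes> b) \<bullet>\<^bsub>tensor_alg H H\<^esub> (a' \<boxtimes> b') = (a \<bullet> a') \<boxtimes> (b \<bullet> b')"
  by (intro tensor_alg_mult amult_linear)

lemma comult_tens_map [simp]:
  "tens_map (comult H) id (x \<boxtimes> y) = comult H x \<boxtimes> y"
  "tens_map id (comult H) (x \<boxtimes> y) = x \<boxtimes> comult H y"
  by (simp_all add: tens_map_tens comult_plinear)

text \<open>Each axiom compares two maps that are linear in every argument, so agreement on
  \<open>X\<close> suffices; axioms in several arguments are treated by nested inductions.\<close>

lemma hopf_algebra_spanI:
  assumes mult_closed: "\<And>x y. x \<in> X \<Longrightarrow> y \<in> X \<Longrightarrow> x \<bullet> y \<in> acarrier H"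
    and assoc: "\<And>x y z. x \<in> X \<Longrightarrow> y \<in> X \<Longrightarrow> z \<in> X \<Longrightarrow> (x \<bullet> y) \<bullet> z = x \<bullet> (y \<bullet> z)"
    and one: "aone H \<in> acarrier H" "\<And>x. x \<in> X \<Longrightarrow> aone H \<bullet> x = x" "\<And>x. x \<in> X \<Longrightarrow> x \<bullet> aone H = x"
    and comult_closed: "\<And>x. x \<in> X \<Longrightarrow> comult H x \<in> vec_on (vbasis H \<times> vbasis H)"
    and antipode_closed: "\<And>x. x \<in> X \<Longrightarrow> antipode H x \<in> acarrier H"
    and coassoc: "\<And>x. x \<in> X \<Longrightarrow>
      tens_assoc (tens_map (comult H) id (comult H x)) = tens_map id (comult H) (comult H x)"
    and counit: "\<And>x. x \<in> X \<Longrightarrow> lin_ext (\<lambda>(b, c). counit H (bvec b) *\<^sub>p bvec c) (comult H x) = x"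
      "\<And>x. x \<in> X \<Longrightarrow> lin_ext (\<lambda>(b, c). counit H (bvec c) *\<^sub>p bvec b) (comult H x) = x"
    and comult_mult: "\<And>x y. x \<in> X \<Longrightarrow> y \<in> X \<Longrightarrow>
      comult H (x \<bullet> y) = comult H x \<bullet>\<^bsub>tensor_alg H H\<^esub> comult H y"
    and comult_one: "comult H (aone H) = aone H \<boxtimes> aone H"
    and counit_mult: "\<And>x y. x \<in> X \<Longrightarrow> y \<in> X \<Longrightarrow> counit H (x \<bullet> y) = counit H x * counit H y"
    and counit_one: "counit H (aone H) = 1"
    and antipode: "\<And>x. x \<in> X \<Longrightarrow>
        lin_ext (\<lambda>(b, c). antipode H (bvec b) \<bullet> bvec c) (comult H x) = counit H x *\<^sub>p aone H"
      "\<And>x. x \<in> X \<Longrightarrow>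
        lin_ext (\<lambda>(b, c). bvec b \<bullet> antipode H (bvec c)) (comult H x) = counit H x *\<^sub>p aone H"
  shows "hopf_algebra H"
proof -
  note ind = span_eq_induct[OF _ span_X, consumes 1, case_names zero add]
  have X: "x \<in> acarrier H" if "x \<in> X" for x using that by (simp add: span_X pm.span_base)
  have cl: "x \<bullet> y \<in> acarrier H" if "x \<in> acarrier H" "y \<in> acarrier H" for x y
    using that(1)
  proof (induction rule: ind)
    case (add c x z)
    have "x \<bullet> y \<in> acarrier H" using that(2)
      by (induction rule: ind) (auto simp: H_simps mult_closed add add_in scl_in)
    then show ?case using add by (auto simp: H_simps add_in scl_in)
  qed (simp add: H_simps)
  have as: "(x \<bullet> y) \<bullet> z = x \<bullet> (y \<bullet> z)" if "x \<in> acarrier H" "y \<in> acarrier H" "z \<in> acarrier H" for x y z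
    using that(1)
  proof (induction rule: ind)
    case (add c x u)
    have "(x \<bullet> y) \<bullet> z = x \<bullet> (y \<bullet> z)" using that(2)
    proof (induction rule: ind)
      case (add c y u)
      have "(x \<bullet> y) \<bullet> z = x \<bullet> (y \<bullet> z)" using that(3)
        by (induction rule: ind) (auto simp: H_simps assoc add \<open>x \<in> X\<close>)
      then show ?case using add by (auto simp: H_simps)
    qed (simp add: H_simps)
    then show ?case using add by (auto simp: H_simps)
  qed (simp add: H_simps)
  have cm: "comult H (x \<bullet> y) = comult H x \<bullet>\<^bsub>tensor_alg H H\<^esub> comult H y \<and>
      counit H (x \<bullet> y) = counit H x * counit H y"
    if "x \<in> acarrier H" "y \<in> acarrier H" for x y
    using that(1)
  proof (induction rule: ind)
    case (add c x z)
    have "comult H (x \<bullet> y) = comult H x \<bullet>\<^bsub>tensor_alg H H\<^esub> comult H y \<and>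
        counit H (x \<bullet> y) = counit H x * counit H y" using that(2)
      by (induction rule: ind) (simp_all add: H_simps comult_mult counit_mult add algebra_simps)
    then show ?case using add by (simp add: H_simps algebra_simps)
  qed (simp add: H_simps)
  have l: "linear_map (vbasis H) (vbasis H) (\<lambda>x. x \<bullet> y)" "linear_map (vbasis H) (vbasis H) (amult H y)"
    if "y \<in> acarrier H" for y
    using that cl by (auto simp: linear_map_def H_simps)
  have l': "linear_map (vbasis H) (vbasis H \<times> vbasis H) (comult H)"
    "linear_map (vbasis H) (vbasis H) (antipode H)"
    using comult_closed antipode_closed
    by (intro linear_map_spanI[OF _ span_X] comult_plinear antipode_plinear; simp)+
  show ?thesis
  proof
    fix h assume h: "h \<in> acarrier H"
    show "aone H \<bullet> h = h" "h \<bullet> aone H = h"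
      using h by (induction rule: ind) (auto simp: H_simps one)
    show "tens_assoc (tens_map (comult H) id (comult H h)) = tens_map id (comult H) (comult H h)"
      using h by (induction rule: ind) (auto simp: H_simps coassoc[unfolded id_def] id_def)
    show "lin_ext (\<lambda>(b, c). counit H (bvec b) *\<^sub>p bvec c) (comult H h) = h"
      "lin_ext (\<lambda>(b, c). counit H (bvec c) *\<^sub>p bvec b) (comult H h) = h"
      using h by (induction rule: ind) (auto simp: H_simps counit)
    show "lin_ext (\<lambda>(b, c). antipode H (bvec b) \<bullet> bvec c) (comult H h) = counit H h *\<^sub>p aone H"
      "lin_ext (\<lambda>(b, c). bvec b \<bullet> antipode H (bvec c)) (comult H h) = counit H h *\<^sub>p aone H"
      using h by (induction rule: ind) (auto simp: H_simps antipode)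
  qed (simp_all add: one as cm l l' comult_one counit_one linear_form_def H_simps)
qed

end

lemma hopf_hom_spanI:
  assumes "bilinear_hopf_data G X" "bilinear_hopf_data H Y" and f: "plinear f"
    and closed: "\<And>x. x \<in> X \<Longrightarrow> f x \<in> acarrier H"
    and mult: "\<And>x y. x \<in> X \<Longrightarrow> y \<in> X \<Longrightarrow> f (x \<bullet>\<^bsub>G\<^esub> y) = f x \<bullet>\<^bsub>H\<^esub> f y"
    and one: "f (aone G) = aone H"
    and comult: "\<And>x. x \<in> X \<Longrightarrow> comult H (f x) = tens_map f f (comult G x)"
    and counit: "\<And>x. x \<in> X \<Longrightarrow> counit H (f x) = counit G x"
    and antipode: "\<And>x. x \<in> X \<Longrightarrow> antipode H (f x) = f (antipode G x)"
  shows "hopf_hom f G H"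
proof -
  interpret G: bilinear_hopf_data G X by fact
  interpret H: bilinear_hopf_data H Y by fact
  note ind = span_eq_induct[OF _ G.span_X, consumes 1, case_names zero add]
  note s = G.H_simps H.H_simps plinear_simps[OF f]
  have "f (x \<bullet>\<^bsub>G\<^esub> y) = f x \<bullet>\<^bsub>H\<^esub> f y" if "x \<in> acarrier G" "y \<in> acarrier G" for x y
    using that(1)
  proof (induction rule: ind)
    case (add c x z)
    have "f (x \<bullet>\<^bsub>G\<^esub> y) = f x \<bullet>\<^bsub>H\<^esub> f y" using that(2)
      by (induction rule: ind) (auto simp: s mult add)
    then show ?case using add by (auto simp: s)
  qed (simp add: s)
  moreover have "comult H (f x) = tens_map f f (comult G x)" "counit H (f x) = counit G x"
    "antipode H (f x) = f (antipode G x)" if "x \<in> acarrier G" for x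
    using that by (induction rule: ind) (auto simp: s comult counit antipode)
  ultimately show ?thesis
    using linear_map_spanI[OF f G.span_X closed] one by (auto simp: hopf_hom_def)
qed

section \<open>Group algebras\<close>

text \<open>Only the values on the group elements matter, so this covers a tensor power of a group algebra
  as well, whose structure maps differ from those of \<^const>\<open>group_hopf\<close> outside the carrier.\<close>

locale group_hopf_algebra = group G for G :: "('g, 'y) monoid_scheme" +
  fixes H :: "('g, 'k::field, 'x) hopf_data_scheme"
  assumes vbasis_eq: "vbasis H = carrier G"
    and bilin: "\<And>y. plinear (\<lambda>x. x \<bullet>\<^bsub>H\<^esub> y)" "\<And>x. plinear (amult H x)" "plinear (comult H)"
      "plinear_form (counit H)" "plinear (antipode H)"
    and bvec_mult: "\<And>g h. g \<in> carrier G \<Longrightarrow> h \<in> carrier G \<Longrightarrow> bvec g \<bullet>\<^bsub>H\<^esub> bvec h = bvec (g \<otimes>\<^bsub>G\<^esub> h)"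
    and one_eq: "aone H = bvec \<one>\<^bsub>G\<^esub>"
    and comult_bvec: "\<And>g. g \<in> carrier G \<Longrightarrow> comult H (bvec g) = bvec (g, g)"
    and counit_bvec: "\<And>g. g \<in> carrier G \<Longrightarrow> counit H (bvec g) = 1"
    and antipode_bvec: "\<And>g. g \<in> carrier G \<Longrightarrow> antipode H (bvec g) = bvec (inv\<^bsub>G\<^esub> g)"
begin

sublocale bilinear_hopf_data H "bvec ` carrier G"
proof (rule bilinear_hopf_data.intro)
  show "acarrier H = pm.span (bvec ` carrier G)"
    unfolding vbasis_eq span_bvec ..
qed (fact bilin)+

lemma comult_bvec': "g \<in> carrier G \<Longrightarrow> comult H (bvec g) = bvec g \<boxtimes> bvec g"
  by (simp add: comult_bvec)

sublocale hopf_algebra H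
proof (rule hopf_algebra_spanI)
  fix x y :: "'g \<Rightarrow>\<^sub>0 'k" assume "x \<in> bvec ` carrier G" "y \<in> bvec ` carrier G"
  then obtain g h where gh: "g \<in> carrier G" "h \<in> carrier G" "x = bvec g" "y = bvec h" by blast
  show "comult H (x \<bullet>\<^bsub>H\<^esub> y) = comult H x \<bullet>\<^bsub>tensor_alg H H\<^esub> comult H y"
    using gh by (simp add: bvec_mult comult_bvec' tensor_mult del: tens_bvec)
next
  fix x :: "'g \<Rightarrow>\<^sub>0 'k" assume "x \<in> bvec ` carrier G"
  then obtain g where g: "g \<in> carrier G" "x = bvec g" by blast
  then show "lin_ext (\<lambda>(b, c). counit H (bvec b) *\<^sub>p bvec c) (comult H x) = x"
      "lin_ext (\<lambda>(b, c). counit H (bvec c) *\<^sub>p bvec b) (comult H x) = x"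
    by (simp_all add: lin_ext_single comult_bvec counit_bvec)
  show "lin_ext (\<lambda>(b, c). antipode H (bvec b) \<bullet>\<^bsub>H\<^esub> bvec c) (comult H x) = counit H x *\<^sub>p aone H"
      "lin_ext (\<lambda>(b, c). bvec b \<bullet>\<^bsub>H\<^esub> antipode H (bvec c)) (comult H x) = counit H x *\<^sub>p aone H"
    using g by (simp_all add: lin_ext_single comult_bvec counit_bvec antipode_bvec bvec_mult one_eq)
  show "tens_assoc (tens_map (comult H) id (comult H x)) = tens_map id (comult H) (comult H x)"
    using g by (simp add: comult_bvec' del: tens_bvec)
  show "aone H \<bullet>\<^bsub>H\<^esub> x = x" "x \<bullet>\<^bsub>H\<^esub> aone H = x"
    using g by (simp_all add: bvec_mult one_eq)
  show "comult H x \<in> vec_on (vbasis H \<times> vbasis H)"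
    using g by (simp add: comult_bvec vbasis_eq)
  show "antipode H x \<in> acarrier H"
    using g by (simp add: antipode_bvec vbasis_eq)
next
  show "aone H \<in> acarrier H" "comult H (aone H) = aone H \<boxtimes> aone H" "counit H (aone H) = 1"
    by (simp_all add: one_eq comult_bvec vbasis_eq counit_bvec)
qed (auto simp: bvec_mult vbasis_eq counit_bvec m_assoc)

end

lemma group_hopf_algebra_group_hopf:
  assumes "group G"
  shows "group_hopf_algebra G (group_hopf G :: ('g, 'k::field) hopf_data)"
proof -
  have "plinear_form (\<lambda>f. \<Sum>g\<in>Poly_Mapping.keys f. Poly_Mapping.lookup f g :: 'k)"
    using plinear_form_sum[of "\<lambda>_. 1 :: 'k"] by simp
  with assms show ?thesis
    by (auto simp: group_hopf_algebra_def group_hopf_algebra_axioms_def group_hopf_def lin_ext_single)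
qed

section \<open>Semisimplicity\<close>

text \<open>A separability element \<open>\<Sum>i. u i \<otimes> v i\<close> averages a linear projection onto a left
  ideal to a module homomorphism, whose kernel is a complement.\<close>

lemma (in bilinear_hopf_data) semisimple_separable:
  fixes u v :: "'i \<Rightarrow> 'b \<Rightarrow>\<^sub>0 'k"
  assumes "k_algebra H"
    and uv: "\<And>i. i \<in> I \<Longrightarrow> u i \<in> acarrier H" "\<And>i. i \<in> I \<Longrightarrow> v i \<in> acarrier H"
    and one: "(\<Sum>i\<in>I. u i \<bullet> v i) = aone H"
    and central: "\<And>x. x \<in> X \<Longrightarrow> (\<Sum>i\<in>I. (x \<bullet> u i) \<boxtimes> v i) = (\<Sum>i\<in>I. u i \<boxtimes> (v i \<bullet> x))"
  shows "semisimple_algebra H"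
  unfolding semisimple_algebra_def
proof (intro allI impI)
  interpret A: k_algebra H by fact
  fix L assume L: "left_ideal L H"
  then have LH: "L \<subseteq> acarrier H" and sL: "pm.subspace L"
    and aL: "\<And>a x. a \<in> acarrier H \<Longrightarrow> x \<in> L \<Longrightarrow> a \<bullet> x \<in> L"
    by (auto simp: left_ideal_def)
  interpret vp: vector_space_pair "scl :: 'k \<Rightarrow> ('b \<Rightarrow>\<^sub>0 'k) \<Rightarrow> _" "scl :: 'k \<Rightarrow> ('b \<Rightarrow>\<^sub>0 'k) \<Rightarrow> _" ..
  \<comment> \<open>A left inverse of the identity on \<open>L\<close> with values in
    \<open>L\<close> is a linear projection onto \<open>L\<close>; it need not be a module
    homomorphism.\<close>
  from vp.linear_exists_left_inverse_on[OF plinear_id(1) sL] obtain p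
    where p: "range p \<subseteq> L" "plinear p" "\<And>x. x \<in> L \<Longrightarrow> p x = x"
    by auto
  have cl: "x \<bullet> y \<in> acarrier H" if "x \<in> acarrier H" "y \<in> acarrier H" for x y
    using A.mult_linear_left[OF that(2)] that(1) by (auto simp: linear_map_def)
  have sc: "pm.subspace (acarrier H)" by (rule subspace_vec_on)
  define P where "P = (\<lambda>h. \<Sum>i\<in>I. u i \<bullet> p (v i \<bullet> h))"
  have lP: "plinear P"
    unfolding P_def plinear_iff by (simp add: plinear_simps[OF p(2)] H_simps sum.distrib pm.scale_sum_right)
  have PX: "P (x \<bullet> h) = x \<bullet> P h" if x: "x \<in> X" and h: "h \<in> acarrier H" for x h
  proof -
    have xH: "x \<in> acarrier H" using x by (simp add: span_X pm.span_base)
    have pH: "p y \<in> acarrier H" for y using p(1) LH by auto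
    \<comment> \<open>The hypothesis \<open>central\<close> is an identity of tensors. Applying the
      bilinear map \<open>?f\<close> to both sides moves \<open>x\<close> from the left factor into
      the argument of \<open>p\<close>.\<close>
    let ?f = "\<lambda>a b. a \<bullet> p (b \<bullet> h)"
    have f: "lin_ext (\<lambda>(b, c). ?f (bvec b) (bvec c)) (a \<boxtimes> b) = ?f a b" for a b
      by (rule lin_ext_tens_bilinear) (auto simp: plinear_iff plinear_simps[OF p(2)] H_simps)
    have "x \<bullet> P h = (\<Sum>i\<in>I. ?f (x \<bullet> u i) (v i))"
      unfolding P_def H_simps(8) using uv xH by (intro sum.cong) (auto simp: A.mult_assoc pH)
    also have "\<dots> = lin_ext (\<lambda>(b, c). ?f (bvec b) (bvec c)) (\<Sum>i\<in>I. (x \<bullet> u i) \<boxtimes> v i)"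
      by (simp add: lin_ext_sum f)
    also have "\<dots> = (\<Sum>i\<in>I. ?f (u i) (v i \<bullet> x))"
      unfolding central[OF x] by (simp add: lin_ext_sum f)
    also have "\<dots> = P (x \<bullet> h)"
      unfolding P_def using uv xH h by (intro sum.cong) (auto simp: A.mult_assoc)
    finally show ?thesis ..
  qed
  have PH: "P (x \<bullet> h) = x \<bullet> P h" if x: "x \<in> acarrier H" and h: "h \<in> acarrier H" for x h
    using x span_X
    by (induction rule: span_eq_induct) (auto simp: H_simps plinear_simps[OF lP] PX h)
  have PL: "P h \<in> L" for h
    unfolding P_def using p(1) uv by (intro pm.subspace_sum[OF sL] aL) auto
  have Pid: "P h = h" if h: "h \<in> L" for h
  proof -
    \<comment> \<open>Since \<open>L\<close> is a left ideal, each product of \<open>v i\<close>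
      with \<open>h\<close> stays in \<open>L\<close>, where \<open>p\<close> is the
      identity.\<close>
    have "P h = (\<Sum>i\<in>I. u i \<bullet> (v i \<bullet> h))"
      unfolding P_def using p(3) aL h uv by (intro sum.cong) auto
    also have "\<dots> = (\<Sum>i\<in>I. u i \<bullet> v i) \<bullet> h"
      using uv h LH unfolding H_simps(4) by (intro sum.cong) (auto simp: A.mult_assoc)
    finally show ?thesis using one h LH by (auto simp: A.mult_one_left)
  qed
  let ?J = "{h \<in> acarrier H. P h = 0}"
  have sJ: "pm.subspace ?J"
    using sc by (auto simp: pm.subspace_def plinear_simps[OF lP])
  have "left_ideal ?J H"
    unfolding left_ideal_def using sJ by (auto simp: PH cl H_simps)
  moreover have "L \<inter> ?J = {0}"
    using Pid pm.subspace_0[OF sL] pm.subspace_0[OF sJ] by auto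
  moreover have "{x + y | x y. x \<in> L \<and> y \<in> ?J} = acarrier H"
  proof (intro equalityI subsetI)
    fix h assume h: "h \<in> acarrier H"
    then have "h - P h \<in> acarrier H"
      using PL LH sc by (auto intro: pm.subspace_diff)
    moreover have "P (h - P h) = 0"
      using Pid[OF PL[of h]] by (simp add: module_hom.diff[OF Vector_Spaces.linear.axioms(3)[OF lP]])
    ultimately have "h = P h + (h - P h)" "P h \<in> L" "h - P h \<in> ?J" using PL by auto
    then show "h \<in> {x + y | x y. x \<in> L \<and> y \<in> ?J}" by blast
  qed (use LH in \<open>auto simp: add_in subset_iff\<close>)
  ultimately show "\<exists>J. left_ideal J H \<and> L \<inter> J = {0} \<and> {x + y | x y. x \<in> L \<and> y \<in> J} = acarrier H"
    by blast
qed

section \<open>Bicrossed products\<close>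

text \<open>The abelian group \<open>A\<close> is both the group inside the algebra and, through the
  symmetric nondegenerate pairing \<open>\<chi>\<close>, its own character group. \<open>act\<close>
  is a right action, hence the inverse in \<open>\<sigma>_bvec\<close>; in the application
  \<open>act w a\<close> is \<open>a \<circ> w\<close>.\<close>

locale bicrossed =
  comm_group A + W: group W + R: group_hopf_algebra A R
  for A :: "('a, 'p) monoid_scheme" (structure) and W :: "('w, 'r) monoid_scheme"
    and R :: "('a, 'k::field_char_0, 'x) hopf_data_scheme" +
  fixes act :: "'w \<Rightarrow> 'a \<Rightarrow> 'a" and \<sigma> :: "'w \<Rightarrow> ('a \<Rightarrow>\<^sub>0 'k) \<Rightarrow> ('a \<Rightarrow>\<^sub>0 'k)"
    and \<chi> :: "'a \<Rightarrow> 'a \<Rightarrow> 'k" and J :: "'w \<Rightarrow> 'a \<Rightarrow> 'a \<Rightarrow> 'k" and g :: "'w \<Rightarrow> 'w \<Rightarrow> 'a \<Rightarrow> 'k"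
  assumes finite_A: "finite (carrier A)" and finite_W: "finite (carrier W)"
    and act_closed [simp]: "\<lbrakk>w \<in> carrier W; a \<in> carrier A\<rbrakk> \<Longrightarrow> act w a \<in> carrier A"
    and act_mult: "\<lbrakk>w \<in> carrier W; a \<in> carrier A; b \<in> carrier A\<rbrakk> \<Longrightarrow> act w (a \<otimes> b) = act w a \<otimes> act w b"
    and act_one [simp]: "a \<in> carrier A \<Longrightarrow> act \<one>\<^bsub>W\<^esub> a = a"
    and act_act: "\<lbrakk>w \<in> carrier W; v \<in> carrier W; a \<in> carrier A\<rbrakk> \<Longrightarrow> act v (act w a) = act (w \<otimes>\<^bsub>W\<^esub> v) a"
    and \<sigma>_plinear: "\<And>w. plinear (\<sigma> w)"
    and \<sigma>_bvec: "\<lbrakk>w \<in> carrier W; f \<in> carrier A\<rbrakk> \<Longrightarrow> \<sigma> w (bvec f) = bvec (act (inv\<^bsub>W\<^esub> w) f)"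
    and \<chi>_nonzero: "\<lbrakk>a \<in> carrier A; f \<in> carrier A\<rbrakk> \<Longrightarrow> \<chi> a f \<noteq> 0"
    and \<chi>_commute: "\<lbrakk>a \<in> carrier A; f \<in> carrier A\<rbrakk> \<Longrightarrow> \<chi> a f = \<chi> f a"
    and \<chi>_mult: "\<lbrakk>a \<in> carrier A; f \<in> carrier A; h \<in> carrier A\<rbrakk> \<Longrightarrow> \<chi> a (f \<otimes> h) = \<chi> a f * \<chi> a h"
    and \<chi>_nondeg: "\<lbrakk>a \<in> carrier A; \<And>f. f \<in> carrier A \<Longrightarrow> \<chi> a f = 1\<rbrakk> \<Longrightarrow> a = \<one>"
    and \<chi>_act: "\<lbrakk>w \<in> carrier W; a \<in> carrier A; f \<in> carrier A\<rbrakk> \<Longrightarrow> \<chi> (act w a) (act w f) = \<chi> a f"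
    and J_nonzero: "\<lbrakk>w \<in> carrier W; a \<in> carrier A; b \<in> carrier A\<rbrakk> \<Longrightarrow> J w a b \<noteq> 0"
    and J_mult_left: "\<lbrakk>w \<in> carrier W; a \<in> carrier A; b \<in> carrier A; c \<in> carrier A\<rbrakk> \<Longrightarrow>
      J w (a \<otimes> b) c = J w a c * J w b c"
    and J_mult_right: "\<lbrakk>w \<in> carrier W; a \<in> carrier A; b \<in> carrier A; c \<in> carrier A\<rbrakk> \<Longrightarrow>
      J w a (b \<otimes> c) = J w a b * J w a c"
    and g_nonzero: "\<lbrakk>w \<in> carrier W; v \<in> carrier W; a \<in> carrier A\<rbrakk> \<Longrightarrow> g w v a \<noteq> 0"
    and g_one: "\<lbrakk>w \<in> carrier W; a \<in> carrier A\<rbrakk> \<Longrightarrow> g \<one>\<^bsub>W\<^esub> w a = 1"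
      "\<lbrakk>w \<in> carrier W; a \<in> carrier A\<rbrakk> \<Longrightarrow> g w \<one>\<^bsub>W\<^esub> a = 1"
    and g_cocycle: "\<lbrakk>w \<in> carrier W; v \<in> carrier W; u \<in> carrier W; a \<in> carrier A\<rbrakk> \<Longrightarrow>
      g w v a * g (w \<otimes>\<^bsub>W\<^esub> v) u a = g v u (act w a) * g w (v \<otimes>\<^bsub>W\<^esub> u) a"
    and g_mult: "\<lbrakk>w \<in> carrier W; v \<in> carrier W; a \<in> carrier A; b \<in> carrier A\<rbrakk> \<Longrightarrow>
      g w v (a \<otimes> b) * J (w \<otimes>\<^bsub>W\<^esub> v) a b = g w v a * g w v b * J w a b * J v (act w a) (act w b)"
    and g_inv: "\<lbrakk>w \<in> carrier W; a \<in> carrier A\<rbrakk> \<Longrightarrow> g w (inv\<^bsub>W\<^esub> w) a * J w a (inv a) = 1"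
begin

subsection \<open>Characters and idempotents\<close>

definition N :: 'k where "N = of_nat (card (carrier A))"

text \<open>The idempotent of \<open>R\<close> belonging to the character \<open>\<chi> a\<close>;
  on it \<open>bvec f\<close> acts by the scalar \<open>\<chi> a f\<close>.\<close>

definition e :: "'a \<Rightarrow> ('a \<Rightarrow>\<^sub>0 'k)"
  where "e a = (\<Sum>f\<in>carrier A. (\<chi> a (inv f) / N) *\<^sub>p bvec f)"

text \<open>The element of \<open>R\<close> corresponding to the function \<open>\<phi>\<close>
  under the isomorphism of \<open>R\<close> with the functions on \<open>A\<close>; products become
  pointwise.\<close>

definition ee :: "('a \<Rightarrow> 'k) \<Rightarrow> ('a \<Rightarrow>\<^sub>0 'k)"
  where "ee \<phi> = (\<Sum>a\<in>carrier A. \<phi> a *\<^sub>p e a)"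

definition E :: "'a \<Rightarrow> 'w \<Rightarrow> ('a \<times> 'w \<Rightarrow>\<^sub>0 'k)"
  where "E a w = e a \<boxtimes> bvec w"

definition \<gamma> :: "'w \<Rightarrow> 'w \<Rightarrow> ('a \<Rightarrow>\<^sub>0 'k)"
  where "\<gamma> w v = ee (g w v)"

text \<open>Linear extension from the basis \<open>E a w\<close> instead of the group basis: the
  coefficients are those of \<open>bvec (f, w)\<close> in the former.\<close>

definition eext :: "('a \<Rightarrow> 'w \<Rightarrow> ('c \<Rightarrow>\<^sub>0 'k)) \<Rightarrow> ('a \<times> 'w \<Rightarrow>\<^sub>0 'k) \<Rightarrow> ('c \<Rightarrow>\<^sub>0 'k)"
  where "eext \<phi> = lin_ext (\<lambda>(f, w). \<Sum>a\<in>carrier A. \<chi> a f *\<^sub>p \<phi> a w)"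

section \<open>The pairing and the action\<close>

lemma N_nonzero [simp]: "N \<noteq> 0"
  using finite_A one_closed by (auto simp: N_def)

lemma \<chi>_one [simp]: "a \<in> carrier A \<Longrightarrow> \<chi> a \<one> = 1" "a \<in> carrier A \<Longrightarrow> \<chi> \<one> a = 1"
proof -
  show *: "\<chi> a \<one> = 1" if "a \<in> carrier A" for a
    using \<chi>_mult[of a \<one> \<one>] \<chi>_nonzero[of a \<one>] that by simp
  show "\<chi> \<one> a = 1" if "a \<in> carrier A"
    using *[OF that] \<chi>_commute[of a \<one>] that by simp
qed

lemma \<chi>_inv: "a \<in> carrier A \<Longrightarrow> f \<in> carrier A \<Longrightarrow> \<chi> a (inv f) = inverse (\<chi> a f)"
  using \<chi>_mult[of a f "inv f"] \<chi>_nonzero[of a f] by (simp add: field_simps)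

lemma \<chi>_mult_left: "\<lbrakk>a \<in> carrier A; b \<in> carrier A; f \<in> carrier A\<rbrakk> \<Longrightarrow> \<chi> (a \<otimes> b) f = \<chi> a f * \<chi> b f"
  using \<chi>_mult[of f a b] by (simp add: \<chi>_commute)

lemma \<chi>_inv_left: "a \<in> carrier A \<Longrightarrow> f \<in> carrier A \<Longrightarrow> \<chi> (inv a) f = inverse (\<chi> a f)"
  using \<chi>_inv[of f a] by (simp add: \<chi>_commute)

lemma \<chi>_inv_swap: "a \<in> carrier A \<Longrightarrow> f \<in> carrier A \<Longrightarrow> \<chi> a (inv f) = \<chi> f (inv a)"
  by (simp add: \<chi>_inv \<chi>_commute)

lemma act_inv: "w \<in> carrier W \<Longrightarrow> a \<in> carrier A \<Longrightarrow> act w (inv a) = inv (act w a)"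
proof -
  assume wa: "w \<in> carrier W" "a \<in> carrier A"
  have "act w \<one> = act w \<one> \<otimes> act w \<one>" using act_mult[of w \<one> \<one>] wa by simp
  then have o: "act w \<one> = \<one>" using wa by (metis act_closed one_closed l_cancel_one)
  have "act w (inv a) \<otimes> act w a = \<one>"
    using act_mult[of w "inv a" a] wa o by simp
  then show ?thesis using wa by (simp add: inv_equality)
qed

lemma act_unit [simp]: "w \<in> carrier W \<Longrightarrow> act w \<one> = \<one>"
  using act_inv[of w \<one>] act_mult[of w \<one> "inv \<one>"] by (metis act_closed inv_one one_closed r_inv r_one)

lemma act_inv_cancel [simp]:
  "w \<in> carrier W \<Longrightarrow> a \<in> carrier A \<Longrightarrow> act (inv\<^bsub>W\<^esub> w) (act w a) = a"
  "w \<in> carrier W \<Longrightarrow> a \<in> carrier A \<Longrightarrow> act w (act (inv\<^bsub>W\<^esub> w) a) = a"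
  by (simp_all add: act_act)

lemma sum_shift:
  fixes F :: "'a \<Rightarrow> 'z::comm_monoid_add"
  assumes "b \<in> carrier A"
  shows "(\<Sum>a\<in>carrier A. F a) = (\<Sum>a\<in>carrier A. F (b \<otimes> a))"
  by (rule sum.reindex_bij_witness[of _ "\<lambda>a. b \<otimes> a" "\<lambda>a. inv b \<otimes> a"])
    (use assms in \<open>auto simp: m_assoc[symmetric]\<close>)

lemma sum_inv:
  fixes F :: "'a \<Rightarrow> 'z::comm_monoid_add"
  shows "(\<Sum>a\<in>carrier A. F a) = (\<Sum>a\<in>carrier A. F (inv a))"
  by (rule sum.reindex_bij_witness[of _ "m_inv A" "m_inv A"]) auto

lemma sum_act:
  fixes F :: "'a \<Rightarrow> 'z::comm_monoid_add"
  assumes "w \<in> carrier W"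
  shows "(\<Sum>a\<in>carrier A. F a) = (\<Sum>a\<in>carrier A. F (act w a))"
  by (rule sum.reindex_bij_witness[of _ "act w" "act (inv\<^bsub>W\<^esub> w)"]) (use assms in auto)

section \<open>Orthogonality of characters\<close>

lemma sum_\<chi>: "a \<in> carrier A \<Longrightarrow> (\<Sum>f\<in>carrier A. \<chi> a f) = (if a = \<one> then N else 0)"
proof (cases "a = \<one>")
  case True
  then show ?thesis by (simp add: N_def)
next
  case False
  assume a: "a \<in> carrier A"
  with False \<chi>_nondeg obtain h where h: "h \<in> carrier A" "\<chi> a h \<noteq> 1" by blast
  \<comment> \<open>Translation by \<open>h\<close> permutes the summands and multiplies the sum by
    \<open>\<chi> a h\<close>, which is not 1.\<close>
  have "(\<Sum>f\<in>carrier A. \<chi> a f) = \<chi> a h * (\<Sum>f\<in>carrier A. \<chi> a f)"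
    by (subst sum_shift[OF h(1)]) (simp add: \<chi>_mult a h sum_distrib_left)
  then show ?thesis using h False by simp
qed

lemma sum_\<chi>_inv:
  assumes "a \<in> carrier A" "b \<in> carrier A"
  shows "(\<Sum>f\<in>carrier A. \<chi> a (inv f) * \<chi> b f / N) = (if b = a then 1 else 0)"
proof -
  have "(\<Sum>f\<in>carrier A. \<chi> a (inv f) * \<chi> b f / N) = (\<Sum>f\<in>carrier A. \<chi> (b \<otimes> inv a) f) / N"
    unfolding sum_divide_distrib
    by (rule sum.cong) (simp_all add: assms \<chi>_mult_left \<chi>_inv \<chi>_inv_left)
  moreover have "b \<otimes> inv a = \<one> \<longleftrightarrow> b = a"
    using assms by (metis inv_closed inv_equality inv_inv r_inv)
  ultimately show ?thesis using assms by (simp add: sum_\<chi>)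
qed

section \<open>The idempotents and Fourier inversion\<close>

lemma e_closed [simp]: "a \<in> carrier A \<Longrightarrow> e a \<in> vec_on (carrier A)"
  unfolding e_def by (intro sum_in scl_in) auto

lemma e_in_R [simp]: "a \<in> carrier A \<Longrightarrow> e a \<in> acarrier R"
  by (simp add: R.vbasis_eq)

lemma ee_closed [simp]: "ee \<phi> \<in> vec_on (carrier A)"
  unfolding ee_def by (intro sum_in scl_in) auto

lemma ee_in_R [simp]: "ee \<phi> \<in> acarrier R"
  by (simp add: R.vbasis_eq)

lemma ee_cong: "(\<And>a. a \<in> carrier A \<Longrightarrow> \<phi> a = \<psi> a) \<Longrightarrow> ee \<phi> = ee \<psi>"
  by (simp add: ee_def)

text \<open>Multiplication by \<open>bvec f\<close> translates the summation index, and
  multiplicativity of \<open>\<chi> a\<close> turns the shift into a scalar.\<close>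

lemma bvec_mult_e:
  assumes "f \<in> carrier A" "a \<in> carrier A"
  shows "bvec f \<bullet>\<^bsub>R\<^esub> e a = \<chi> a f *\<^sub>p e a"
proof -
  have "bvec f \<bullet>\<^bsub>R\<^esub> e a = (\<Sum>h\<in>carrier A. (\<chi> a (inv h) / N) *\<^sub>p bvec (f \<otimes> h))"
    using assms by (simp add: e_def R.H_simps R.bvec_mult)
  also have "\<dots> = (\<Sum>h\<in>carrier A. (\<chi> a f * \<chi> a (inv (f \<otimes> h)) / N) *\<^sub>p bvec (f \<otimes> h))"
    using assms by (intro sum.cong) (auto simp: \<chi>_inv \<chi>_mult \<chi>_nonzero field_simps)
  also have "\<dots> = \<chi> a f *\<^sub>p e a"
    unfolding e_def using sum_shift[OF assms(1), of "\<lambda>h. (\<chi> a f * \<chi> a (inv h) / N) *\<^sub>p bvec h"]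
    by (simp add: pm.scale_sum_right)
  finally show ?thesis .
qed

lemma e_mult:
  assumes "a \<in> carrier A" "b \<in> carrier A"
  shows "e a \<bullet>\<^bsub>R\<^esub> e b = (if b = a then e a else 0)"
proof -
  have "e a \<bullet>\<^bsub>R\<^esub> e b = (\<Sum>f\<in>carrier A. \<chi> a (inv f) * \<chi> b f / N) *\<^sub>p e b"
    by (subst (1) e_def) (simp add: R.H_simps bvec_mult_e assms pm.scale_sum_left)
  then show ?thesis by (simp add: sum_\<chi>_inv assms)
qed

text \<open>Fourier inversion: orthogonality is used in the other variable, by the symmetry of
  \<open>\<chi>\<close>.\<close>

lemma bvec_eq_ee: "f \<in> carrier A \<Longrightarrow> bvec f = ee (\<lambda>a. \<chi> a f)"
proof -
  assume f: "f \<in> carrier A"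
  have "ee (\<lambda>a. \<chi> a f) = (\<Sum>h\<in>carrier A. (\<Sum>a\<in>carrier A. \<chi> h (inv a) * \<chi> f a / N) *\<^sub>p bvec h)"
    unfolding ee_def e_def pm.scale_sum_right pm.scale_sum_left
    by (subst sum.swap) (intro sum.cong refl, simp add: \<chi>_commute[of f] \<chi>_inv_swap f mult.commute)
  also have "\<dots> = bvec f"
    using f finite_A by (simp add: sum_\<chi>_inv if_distrib[of "\<lambda>x. x *\<^sub>p _"] cong: if_cong)
  finally show ?thesis ..
qed

lemma e_mult_ee: "a \<in> carrier A \<Longrightarrow> e a \<bullet>\<^bsub>R\<^esub> ee \<phi> = \<phi> a *\<^sub>p e a"
  unfolding ee_def using finite_A
  by (simp add: R.H_simps e_mult if_distrib[of "(*\<^sub>p) _"] cong: if_cong)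

lemma ee_mult: "ee \<phi> \<bullet>\<^bsub>R\<^esub> ee \<psi> = ee (\<lambda>a. \<phi> a * \<psi> a)"
  by (subst (1 3) ee_def) (simp add: R.H_simps e_mult_ee)

lemma one_eq_ee: "aone R = ee (\<lambda>_. 1)"
  by (simp add: R.one_eq bvec_eq_ee cong: ee_cong)

lemma span_e: "vec_on (carrier A) = pm.span (e ` carrier A)"
proof (rule pm.span_subspace[symmetric])
  show "vec_on (carrier A) \<subseteq> pm.span (e ` carrier A)"
    unfolding span_bvec[symmetric]
    by (rule pm.span_minimal)
      (force simp: bvec_eq_ee ee_def intro: pm.span_sum pm.span_scale pm.span_base, simp)
qed (auto simp: subspace_vec_on)

section \<open>The action and the cocycle in terms of idempotents\<close>

text \<open>Invariance of the pairing under \<open>act\<close> makes \<open>\<sigma> w\<close>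
  permute the idempotents.\<close>

lemma \<sigma>_e:
  assumes "w \<in> carrier W" "a \<in> carrier A"
  shows "\<sigma> w (e a) = e (act (inv\<^bsub>W\<^esub> w) a)"
proof -
  have "\<sigma> w (e a) = (\<Sum>f\<in>carrier A. (\<chi> a (inv f) / N) *\<^sub>p bvec (act (inv\<^bsub>W\<^esub> w) f))"
    unfolding e_def using assms by (simp add: plinear_simps[OF \<sigma>_plinear] \<sigma>_bvec)
  also have "\<dots> = (\<Sum>f\<in>carrier A. (\<chi> (act (inv\<^bsub>W\<^esub> w) a) (inv (act (inv\<^bsub>W\<^esub> w) f)) / N) *\<^sub>p bvec (act (inv\<^bsub>W\<^esub> w) f))"
    using assms by (intro sum.cong) (auto simp: act_inv[symmetric] \<chi>_act)
  also have "\<dots> = e (act (inv\<^bsub>W\<^esub> w) a)"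
    unfolding e_def using assms by (intro sum_act[symmetric]) simp
  finally show ?thesis .
qed

text \<open>On functions the automorphism is composition with \<open>act w\<close>, with no inverse,
  and so matches the term \<open>g v u (act w a)\<close> of \<open>g_cocycle\<close>.\<close>

lemma \<sigma>_ee: "w \<in> carrier W \<Longrightarrow> \<sigma> w (ee \<phi>) = ee (\<lambda>a. \<phi> (act w a))"
proof -
  assume w: "w \<in> carrier W"
  have "\<sigma> w (ee \<phi>) = (\<Sum>a\<in>carrier A. \<phi> a *\<^sub>p e (act (inv\<^bsub>W\<^esub> w) a))"
    unfolding ee_def using w by (simp add: plinear_simps[OF \<sigma>_plinear] \<sigma>_e)
  also have "\<dots> = (\<Sum>a\<in>carrier A. \<phi> (act w a) *\<^sub>p e a)"
    using w by (subst sum_act[OF w]) simp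
  finally show ?thesis by (simp add: ee_def)
qed

lemma \<sigma>_linear_map: "w \<in> carrier W \<Longrightarrow> linear_map (vbasis R) (vbasis R) (\<sigma> w)"
  unfolding R.vbasis_eq
  by (rule linear_map_spanI[OF \<sigma>_plinear span_e]) (auto simp: \<sigma>_e)

text \<open>Under \<open>ee\<close> every condition becomes an equation of scalars at each
  \<open>a\<close>; the inverse of a value of \<open>\<gamma>\<close> is the pointwise
  reciprocal.\<close>

lemma cocycle: "normalized_2cocycle R W \<sigma> \<gamma>"
  unfolding normalized_2cocycle_def
proof (intro conjI ballI)
  fix w v assume wv: "w \<in> carrier W" "v \<in> carrier W"
  have "\<gamma> w v \<bullet>\<^bsub>R\<^esub> ee (\<lambda>a. inverse (g w v a)) = aone R"
    "ee (\<lambda>a. inverse (g w v a)) \<bullet>\<^bsub>R\<^esub> \<gamma> w v = aone R"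
    using wv by (auto simp: \<gamma>_def ee_mult one_eq_ee g_nonzero intro!: ee_cong)
  then show "\<gamma> w v \<in> aunits R"
    unfolding aunits_def by (auto simp: \<gamma>_def intro!: bexI[of _ "ee (\<lambda>a. inverse (g w v a))"])
  fix u assume "u \<in> carrier W"
  with wv show "\<gamma> w v \<bullet>\<^bsub>R\<^esub> \<gamma> (w \<otimes>\<^bsub>W\<^esub> v) u = \<sigma> w (\<gamma> v u) \<bullet>\<^bsub>R\<^esub> \<gamma> w (v \<otimes>\<^bsub>W\<^esub> u)"
    by (auto simp: \<gamma>_def \<sigma>_ee ee_mult g_cocycle intro!: ee_cong)
qed (auto simp: \<gamma>_def one_eq_ee g_one intro!: ee_cong)

subsection \<open>The Hopf algebra\<close>

abbreviation C where "C \<equiv> crossed_product R W \<sigma> \<gamma>"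

text \<open>The sum in the coproduct runs over the factorizations of \<open>a\<close> into two
  factors, weighted by \<open>J w\<close>; for \<open>w\<close> the unit it is the usual coproduct
  of \<open>e a\<close>. The counit is 1 on the group basis, so on the \<open>E a w\<close> it
  detects the trivial character.\<close>

definition H :: "('a \<times> 'w, 'k) hopf_data" where
  "H = \<lparr> vbasis = vbasis C, amult = amult C, aone = aone C,
    comult = eext (\<lambda>a w. \<Sum>c\<in>carrier A. J w c (a \<otimes> inv c) *\<^sub>p (E c w \<boxtimes> E (a \<otimes> inv c) w)),
    counit = (\<lambda>h. \<Sum>b\<in>Poly_Mapping.keys h. Poly_Mapping.lookup h b),
    antipode = eext (\<lambda>a w. E (act w (inv a)) (inv\<^bsub>W\<^esub> w)) \<rparr>"

lemma truncate_H: "alg_data.truncate H = C"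
  by (simp add: H_def alg_data.truncate_def crossed_product_def)

lemma vbasis_H: "vbasis H = carrier A \<times> carrier W"
  by (simp add: H_def crossed_product_def R.vbasis_eq)

lemma dim_H: "pm.dim (acarrier H) = card (carrier A) * card (carrier W)"
  unfolding vbasis_H dim_vec_on by (simp add: card_cartesian_product)

text \<open>Expanding \<open>E a w\<close> into group elements and these back into idempotents
  cancels by orthogonality.\<close>

lemma eext_E: "a \<in> carrier A \<Longrightarrow> eext \<phi> (E a w) = \<phi> a w"
proof -
  assume a: "a \<in> carrier A"
  have "eext \<phi> (E a w) = (\<Sum>f\<in>carrier A. (\<chi> a (inv f) / N) *\<^sub>p (\<Sum>b\<in>carrier A. \<chi> b f *\<^sub>p \<phi> b w))"
    by (simp add: eext_def E_def e_def tens_simps lin_ext_sum lin_ext_scl lin_ext_single)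
  also have "\<dots> = (\<Sum>b\<in>carrier A. (\<Sum>f\<in>carrier A. \<chi> a (inv f) * \<chi> b f / N) *\<^sub>p \<phi> b w)"
    unfolding pm.scale_sum_right pm.scale_sum_left by (subst sum.swap) simp
  also have "\<dots> = \<phi> a w"
    using a finite_A by (simp add: sum_\<chi>_inv if_distrib[of "\<lambda>x. x *\<^sub>p _"] cong: if_cong)
  finally show ?thesis .
qed

lemma bvec_eq_E: "f \<in> carrier A \<Longrightarrow> bvec (f, w) = (\<Sum>a\<in>carrier A. \<chi> a f *\<^sub>p E a w)"
  unfolding E_def tens_bvec[symmetric] by (simp add: bvec_eq_ee ee_def tens_simps)

definition X where "X = (\<lambda>(a, w). E a w) ` (carrier A \<times> carrier W)"

lemma E_closed' [simp]: "a \<in> carrier A \<Longrightarrow> w \<in> carrier W \<Longrightarrow> E a w \<in> vec_on (carrier A \<times> carrier W)"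
  by (simp add: E_def tens_in)

lemma span_E: "acarrier H = pm.span X"
  unfolding vbasis_H
proof (rule pm.span_subspace[symmetric])
  show "vec_on (carrier A \<times> carrier W) \<subseteq> pm.span X"
    unfolding span_bvec[symmetric]
    by (rule pm.span_minimal)
      (force simp: bvec_eq_E X_def intro: pm.span_sum pm.span_scale pm.span_base, simp)
qed (auto simp: subspace_vec_on X_def)

sublocale H: bilinear_hopf_data H X
proof (rule bilinear_hopf_data.intro)
  show "plinear_form (counit H)"
    using plinear_form_sum[of "\<lambda>_. 1 :: 'k"] by (simp add: H_def)
  show "plinear (\<lambda>x. x \<bullet>\<^bsub>H\<^esub> y)" "plinear (amult H y)" for y
    unfolding H_def crossed_product_def alg_data.simps by (rule plinear_bilin_ext)+
  show "plinear (comult H)" "plinear (antipode H)"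
    unfolding H_def hopf_data.simps eext_def by (rule plinear_lin_ext)+
qed (rule span_E)

section \<open>Structure maps on the basis of the \<open>E a w\<close>\<close>

lemma crossed_mult:
  assumes "a \<in> vec_on (carrier A)" "b \<in> vec_on (carrier A)" "w \<in> carrier W"
  shows "(a \<boxtimes> bvec w) \<bullet>\<^bsub>H\<^esub> (b \<boxtimes> bvec v) = (a \<bullet>\<^bsub>R\<^esub> \<sigma> w b \<bullet>\<^bsub>R\<^esub> \<gamma> w v) \<boxtimes> bvec (w \<otimes>\<^bsub>W\<^esub> v)"
  using crossed_product_mult[OF R.k_algebra_axioms, where \<sigma> = \<sigma> and \<gamma> = \<gamma> and G = W] \<sigma>_linear_map assms
  by (simp add: R.vbasis_eq \<gamma>_def H_def)

text \<open>Moving \<open>e b\<close> past \<open>w\<close> gives an idempotent orthogonal to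
  \<open>e a\<close> unless \<open>b\<close> is \<open>act w a\<close>; of the cocycle only its
  value at \<open>a\<close> remains.\<close>

lemma E_mult:
  assumes "a \<in> carrier A" "b \<in> carrier A" "w \<in> carrier W"
  shows "E a w \<bullet>\<^bsub>H\<^esub> E b v = (if b = act w a then g w v a *\<^sub>p E a (w \<otimes>\<^bsub>W\<^esub> v) else 0)"
proof -
  have "act (inv\<^bsub>W\<^esub> w) b = a \<longleftrightarrow> b = act w a" using assms by auto
  then show ?thesis
    using assms unfolding E_def
    by (simp add: crossed_mult \<sigma>_e e_mult e_mult_ee \<gamma>_def tens_simps R.H_simps)
qed

lemma comult_E: "a \<in> carrier A \<Longrightarrow>
    comult H (E a w) = (\<Sum>c\<in>carrier A. J w c (a \<otimes> inv c) *\<^sub>p (E c w \<boxtimes> E (a \<otimes> inv c) w))"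
  by (simp add: H_def eext_E)

lemma antipode_E: "a \<in> carrier A \<Longrightarrow> antipode H (E a w) = E (act w (inv a)) (inv\<^bsub>W\<^esub> w)"
  by (simp add: H_def eext_E)

lemma counit_bvec: "counit H (bvec b) = 1"
  by (simp add: H_def)

lemma counit_E: "a \<in> carrier A \<Longrightarrow> counit H (E a w) = (if a = \<one> then 1 else 0)"
proof -
  assume a: "a \<in> carrier A"
  have "counit H (E a w) = (\<Sum>f\<in>carrier A. \<chi> a (inv f) / N)"
    by (simp add: E_def e_def H.H_simps counit_bvec)
  also have "\<dots> = (\<Sum>f\<in>carrier A. \<chi> a f / N)"
    by (subst sum_inv) simp
  finally show ?thesis using a by (simp add: sum_divide_distrib[symmetric] sum_\<chi>)
qed

lemma one_H: "aone H = (\<Sum>a\<in>carrier A. E a \<one>\<^bsub>W\<^esub>)"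
  by (simp add: H_def crossed_product_def one_eq_ee ee_def E_def tens_simps)

text \<open>By bimultiplicativity these values are idempotents of the field, and they are
  nonzero.\<close>

lemma J_one:
  assumes "w \<in> carrier W" "a \<in> carrier A"
  shows "J w a \<one> = 1" "J w \<one> a = 1"
proof -
  have "J w a \<one> * J w a \<one> = J w a \<one>" "J w \<one> a * J w \<one> a = J w \<one> a"
    using J_mult_left[of w \<one> \<one> a] J_mult_right[of w a \<one> \<one>] assms by (metis one_closed r_one)+
  then show "J w a \<one> = 1" "J w \<one> a = 1"
    using J_nonzero[of w a \<one>] J_nonzero[of w \<one> a] assms by simp_all
qed

lemma J_id:
  assumes "a \<in> carrier A" "b \<in> carrier A"
  shows "J \<one>\<^bsub>W\<^esub> a b = 1"
proof -
  have "J \<one>\<^bsub>W\<^esub> a b = J \<one>\<^bsub>W\<^esub> a b * J \<one>\<^bsub>W\<^esub> a b"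
    using g_mult[of "\<one>\<^bsub>W\<^esub>" "\<one>\<^bsub>W\<^esub>" a b] assms by (simp add: g_one)
  then show ?thesis using J_nonzero[of "\<one>\<^bsub>W\<^esub>" a b] assms by simp
qed

lemma g_unit:
  assumes "w \<in> carrier W" "v \<in> carrier W"
  shows "g w v \<one> = 1"
proof -
  have "g w v \<one> = g w v \<one> * g w v \<one>"
    using g_mult[of w v \<one> \<one>] assms by (simp add: J_one)
  then show ?thesis using g_nonzero[of w v \<one>] assms by simp
qed

text \<open>The cocycle law for \<open>w\<close>, its inverse and \<open>w\<close> again, where both
  neighbouring products are the unit.\<close>

lemma g_inv': "w \<in> carrier W \<Longrightarrow> a \<in> carrier A \<Longrightarrow> g (inv\<^bsub>W\<^esub> w) w (act w a) = g w (inv\<^bsub>W\<^esub> w) a"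
  using g_cocycle[of w "inv\<^bsub>W\<^esub> w" w a] by (simp add: g_one)

lemma diff_eq_iff: "a \<in> carrier A \<Longrightarrow> b \<in> carrier A \<Longrightarrow> a \<otimes> inv b = \<one> \<longleftrightarrow> a = b"
  by (simp add: inv_solve_right')

lemma diff_eq_self: "a \<in> carrier A \<Longrightarrow> c \<in> carrier A \<Longrightarrow> inv c = a \<otimes> inv c \<longleftrightarrow> a = \<one>"
  by (simp add: r_cancel_one')

lemma hopf_H: "hopf_algebra H"
proof (rule H.hopf_algebra_spanI)
  fix x y assume "x \<in> X" "y \<in> X"
  then obtain a w b v where
    x: "x = E a w" "a \<in> carrier A" "w \<in> carrier W" and y: "y = E b v" "b \<in> carrier A" "v \<in> carrier W"
    by (auto simp: X_def)
  note xy = x y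
  show "x \<bullet>\<^bsub>H\<^esub> y \<in> acarrier H"
    using xy by (simp add: E_mult vbasis_H scl_in)
  \<comment> \<open>Only the trivial character contributes, and there the cocycle has value
    1.\<close>
  show "counit H (x \<bullet>\<^bsub>H\<^esub> y) = counit H x * counit H y"
    using xy by (auto simp: E_mult counit_E g_unit H.H_simps)
  show "comult H (x \<bullet>\<^bsub>H\<^esub> y) = comult H x \<bullet>\<^bsub>tensor_alg H H\<^esub> comult H y"
  proof -
    have "comult H x \<bullet>\<^bsub>tensor_alg H H\<^esub> comult H y =
      (\<Sum>c\<in>carrier A. \<Sum>d\<in>carrier A. (J w c (a \<otimes> inv c) * J v d (b \<otimes> inv d)) *\<^sub>p
        ((E c w \<bullet>\<^bsub>H\<^esub> E d v) \<boxtimes> (E (a \<otimes> inv c) w \<bullet>\<^bsub>H\<^esub> E (b \<otimes> inv d) v)))"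
      using xy by (simp add: comult_E H.H_simps H.tensor_mult pm.scale_sum_right)
        (subst sum.swap, simp add: mult.commute)
    also have "\<dots> = (\<Sum>c\<in>carrier A. \<Sum>d\<in>carrier A. if d = act w c then (if b = act w a then
        (g w v a * J (w \<otimes>\<^bsub>W\<^esub> v) c (a \<otimes> inv c)) *\<^sub>p
        (E c (w \<otimes>\<^bsub>W\<^esub> v) \<boxtimes> E (a \<otimes> inv c) (w \<otimes>\<^bsub>W\<^esub> v)) else 0) else 0)"
    proof (intro sum.cong refl)
      fix c d assume cd: "c \<in> carrier A" "d \<in> carrier A"
      \<comment> \<open>The first tensor factor forces \<open>d = act w c\<close>; given this, the
        second one survives exactly when \<open>b = act w a\<close>.\<close>
      have 1: "b \<otimes> inv (act w c) = act w a \<otimes> inv (act w c) \<longleftrightarrow> b = act w a"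
        using cd xy by simp
      \<comment> \<open>This exhibits \<open>a\<close> as the product of the indices of the two
        tensor factors, so that \<open>g_mult\<close> applies.\<close>
      have "c \<otimes> (a \<otimes> inv c) = a" using cd xy by (simp add: m_lcomm)
      then have "g w v a * J (w \<otimes>\<^bsub>W\<^esub> v) c (a \<otimes> inv c) =
        g w v c * g w v (a \<otimes> inv c) * J w c (a \<otimes> inv c) * J v (act w c) (act w a \<otimes> inv (act w c))"
        using g_mult[of w v c "a \<otimes> inv c"] cd xy by (simp add: act_mult act_inv)
      then show "(J w c (a \<otimes> inv c) * J v d (b \<otimes> inv d)) *\<^sub>p
        ((E c w \<bullet>\<^bsub>H\<^esub> E d v) \<boxtimes> (E (a \<otimes> inv c) w \<bullet>\<^bsub>H\<^esub> E (b \<otimes> inv d) v)) =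
        (if d = act w c then (if b = act w a then
        (g w v a * J (w \<otimes>\<^bsub>W\<^esub> v) c (a \<otimes> inv c)) *\<^sub>p
        (E c (w \<otimes>\<^bsub>W\<^esub> v) \<boxtimes> E (a \<otimes> inv c) (w \<otimes>\<^bsub>W\<^esub> v)) else 0) else 0)"
        using cd xy by (simp add: E_mult act_mult act_inv 1 tens_simps mult_ac)
    qed
    also have "\<dots> = comult H (x \<bullet>\<^bsub>H\<^esub> y)"
      using xy finite_A by (simp add: E_mult comult_E H.H_simps pm.scale_sum_right)
    finally show ?thesis ..
  qed
  fix z assume "z \<in> X"
  then obtain c u where z: "z = E c u" "c \<in> carrier A" "u \<in> carrier W" by (auto simp: X_def)
  \<comment> \<open>Both bracketings are nonzero for the same indices, and their scalars agree by
    the cocycle law.\<close>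
  show "(x \<bullet>\<^bsub>H\<^esub> y) \<bullet>\<^bsub>H\<^esub> z = x \<bullet>\<^bsub>H\<^esub> (y \<bullet>\<^bsub>H\<^esub> z)"
    using xy z g_cocycle[of w v u a]
    by (auto simp: E_mult H.H_simps act_act W.m_assoc mult.commute)
next
  fix x assume "x \<in> X"
  then obtain a w where x: "x = E a w" "a \<in> carrier A" "w \<in> carrier W" by (auto simp: X_def)
  show "aone H \<bullet>\<^bsub>H\<^esub> x = x"
    using x finite_A by (simp add: one_H H.H_simps E_mult g_one)
  show "x \<bullet>\<^bsub>H\<^esub> aone H = x"
    using x finite_A by (simp add: one_H H.H_simps E_mult g_one)
  show "comult H x \<in> vec_on (vbasis H \<times> vbasis H)"
    using x unfolding x(1) comult_E[OF x(2)] vbasis_H by (intro sum_in scl_in tens_in) auto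
  show "antipode H x \<in> acarrier H"
    using x by (simp add: antipode_E vbasis_H)
  show "lin_ext (\<lambda>(b, c). counit H (bvec b) *\<^sub>p bvec c) (comult H x) = x"
    using x finite_A by (simp add: comult_E H.H_simps H.counit_left_tens counit_E J_one
        if_distrib[of "\<lambda>x. x *\<^sub>p _"] if_distrib[of "(*\<^sub>p) _"] cong: if_cong)
  show "lin_ext (\<lambda>(b, c). counit H (bvec c) *\<^sub>p bvec b) (comult H x) = x"
    using x finite_A by (simp add: comult_E H.H_simps H.counit_right_tens counit_E J_one diff_eq_iff
        if_distrib[of "\<lambda>x. x *\<^sub>p _"] if_distrib[of "(*\<^sub>p) _"] cong: if_cong)
  have gJ: "J w c (inv c) * g w (inv\<^bsub>W\<^esub> w) c = 1" if "c \<in> carrier A" for c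
    using g_inv[of w c] that x by (simp add: mult.commute)
  show "lin_ext (\<lambda>(b, c). antipode H (bvec b) \<bullet>\<^bsub>H\<^esub> bvec c) (comult H x) = counit H x *\<^sub>p aone H"
  proof -
    have "lin_ext (\<lambda>(b, c). antipode H (bvec b) \<bullet>\<^bsub>H\<^esub> bvec c) (comult H x) =
      (\<Sum>c\<in>carrier A. J w c (a \<otimes> inv c) *\<^sub>p (E (act w (inv c)) (inv\<^bsub>W\<^esub> w) \<bullet>\<^bsub>H\<^esub> E (a \<otimes> inv c) w))"
      using x by (simp add: comult_E H.H_simps H.antipode_left_tens antipode_E)
    also have "\<dots> = (\<Sum>c\<in>carrier A. if a = \<one> then E (act w (inv c)) \<one>\<^bsub>W\<^esub> else 0)"
    proof (intro sum.cong refl)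
      fix c assume c: "c \<in> carrier A"
      have "J w c (inv c) * g (inv\<^bsub>W\<^esub> w) w (act w (inv c)) = 1"
      proof -
        \<comment> \<open>Both sides are the reciprocal of \<open>J w c c\<close>.\<close>
        have "J w (inv c) c = J w c (inv c)"
          using J_mult_left[of w c "inv c" c] J_mult_right[of w c c "inv c"] J_one J_nonzero[of w c c]
            c x by (metis r_inv inv_closed mult_left_cancel)
        \<comment> \<open>The cocycle occurs with the inverse of \<open>w\<close> first and at
          \<open>act w (inv c)\<close>; \<open>g_inv'\<close> brings it into the form of
          \<open>gJ\<close> at \<open>inv c\<close>.\<close>
        then show ?thesis using gJ[of "inv c"] c x by (simp add: g_inv')
      qed
      then show "J w c (a \<otimes> inv c) *\<^sub>p (E (act w (inv c)) (inv\<^bsub>W\<^esub> w) \<bullet>\<^bsub>H\<^esub> E (a \<otimes> inv c) w) =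
        (if a = \<one> then E (act w (inv c)) \<one>\<^bsub>W\<^esub> else 0)"
        using c x diff_eq_self[of a c] by (auto simp: E_mult)
    qed
    \<comment> \<open>The indices \<open>act w (inv c)\<close> run exactly once through
      \<open>A\<close>.\<close>
    also have "\<dots> = (if a = \<one> then (\<Sum>c\<in>carrier A. E c \<one>\<^bsub>W\<^esub>) else 0)"
      using sum_act[OF x(3), of "\<lambda>c. E c \<one>\<^bsub>W\<^esub>"] sum_inv[of "\<lambda>c. E (act w c) \<one>\<^bsub>W\<^esub>"] by simp
    finally show ?thesis using x by (simp add: counit_E one_H)
  qed
  show "lin_ext (\<lambda>(b, c). bvec b \<bullet>\<^bsub>H\<^esub> antipode H (bvec c)) (comult H x) = counit H x *\<^sub>p aone H"
  proof -
    have "lin_ext (\<lambda>(b, c). bvec b \<bullet>\<^bsub>H\<^esub> antipode H (bvec c)) (comult H x) =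
      (\<Sum>c\<in>carrier A. J w c (a \<otimes> inv c) *\<^sub>p (E c w \<bullet>\<^bsub>H\<^esub> E (act w (inv (a \<otimes> inv c))) (inv\<^bsub>W\<^esub> w)))"
      using x by (simp add: comult_E H.H_simps H.antipode_right_tens antipode_E)
    also have "\<dots> = (\<Sum>c\<in>carrier A. if a = \<one> then E c \<one>\<^bsub>W\<^esub> else 0)"
    proof (intro sum.cong refl)
      fix c assume c: "c \<in> carrier A"
      have "act w (inv (a \<otimes> inv c)) = act w c \<longleftrightarrow> inv (a \<otimes> inv c) = c"
        using c x by (metis act_inv_cancel(1) inv_closed m_closed)
      also have "\<dots> \<longleftrightarrow> a = \<one>"
        using c x diff_eq_self[of a c] by (metis inv_inv inv_closed m_closed)
      finally show "J w c (a \<otimes> inv c) *\<^sub>p (E c w \<bullet>\<^bsub>H\<^esub> E (act w (inv (a \<otimes> inv c))) (inv\<^bsub>W\<^esub> w)) =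
        (if a = \<one> then E c \<one>\<^bsub>W\<^esub> else 0)"
        using c x gJ[of c] by (auto simp: E_mult)
    qed
    finally show ?thesis using x by (simp add: counit_E one_H)
  qed
  show "tens_assoc (tens_map (comult H) id (comult H x)) = tens_map id (comult H) (comult H x)"
  proof -
    have "tens_assoc (tens_map (comult H) id (comult H x)) =
      (\<Sum>c\<in>carrier A. \<Sum>d\<in>carrier A. (J w c (a \<otimes> inv c) * J w d (c \<otimes> inv d)) *\<^sub>p
        (E d w \<boxtimes> (E (c \<otimes> inv d) w \<boxtimes> E (a \<otimes> inv c) w)))"
      using x by (simp add: comult_E H.H_simps pm.scale_sum_right)
    also have "\<dots> = (\<Sum>d\<in>carrier A. \<Sum>c\<in>carrier A. (J w c (a \<otimes> inv c) * J w d (c \<otimes> inv d)) *\<^sub>p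
        (E d w \<boxtimes> (E (c \<otimes> inv d) w \<boxtimes> E (a \<otimes> inv c) w)))"
      by (rule sum.swap)
    also have "\<dots> = (\<Sum>d\<in>carrier A. \<Sum>c\<in>carrier A. (J w d (a \<otimes> inv d) * J w c (a \<otimes> inv d \<otimes> inv c)) *\<^sub>p
        (E d w \<boxtimes> (E c w \<boxtimes> E (a \<otimes> inv d \<otimes> inv c) w)))"
    proof (rule sum.cong[OF refl])
      fix d assume d: "d \<in> carrier A"
      \<comment> \<open>With \<open>c\<close> replaced by \<open>d \<otimes> c\<close>, both sides
        are indexed by threefold factorizations of \<open>a\<close>. Bimultiplicativity turns either
        coefficient into the product of \<open>J w\<close> over the three ordered pairs of
        factors.\<close>
      have "(J w (d \<otimes> c) (a \<otimes> inv (d \<otimes> c)) * J w d (d \<otimes> c \<otimes> inv d)) *\<^sub>p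
        (E d w \<boxtimes> (E (d \<otimes> c \<otimes> inv d) w \<boxtimes> E (a \<otimes> inv (d \<otimes> c)) w)) =
        (J w d (a \<otimes> inv d) * J w c (a \<otimes> inv d \<otimes> inv c)) *\<^sub>p
        (E d w \<boxtimes> (E c w \<boxtimes> E (a \<otimes> inv d \<otimes> inv c) w))" if c: "c \<in> carrier A" for c
      proof -
        have 1: "d \<otimes> c \<otimes> inv d = c" using c d by (simp add: m_comm[of d c] m_assoc)
        have 2: "a \<otimes> inv (d \<otimes> c) = a \<otimes> inv d \<otimes> inv c" using c d x by (simp add: inv_mult m_assoc)
        have 3: "a \<otimes> inv d = a \<otimes> inv d \<otimes> inv c \<otimes> c" using c d x by (simp add: m_assoc)
        have "J w d (a \<otimes> inv d) = J w d (a \<otimes> inv d \<otimes> inv c) * J w d c"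
          by (subst 3) (use c d x in \<open>simp add: J_mult_right\<close>)
        then show ?thesis using c d x unfolding 1 2 by (simp add: J_mult_left mult_ac)
      qed
      then show "(\<Sum>c\<in>carrier A. (J w c (a \<otimes> inv c) * J w d (c \<otimes> inv d)) *\<^sub>p
        (E d w \<boxtimes> (E (c \<otimes> inv d) w \<boxtimes> E (a \<otimes> inv c) w))) =
        (\<Sum>c\<in>carrier A. (J w d (a \<otimes> inv d) * J w c (a \<otimes> inv d \<otimes> inv c)) *\<^sub>p
        (E d w \<boxtimes> (E c w \<boxtimes> E (a \<otimes> inv d \<otimes> inv c) w)))"
        by (subst sum_shift[OF d]) simp
    qed
    also have "\<dots> = tens_map id (comult H) (comult H x)"
      using x by (simp add: comult_E H.H_simps pm.scale_sum_right)
    finally show ?thesis .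
  qed
next
  show "aone H \<in> acarrier H"
    unfolding one_H vbasis_H by (intro sum_in) auto
  show "counit H (aone H) = 1"
    using finite_A by (simp add: one_H H.H_simps counit_E)
  show "comult H (aone H) = aone H \<boxtimes> aone H"
  proof -
    have "comult H (aone H) = (\<Sum>a\<in>carrier A. \<Sum>c\<in>carrier A. E c \<one>\<^bsub>W\<^esub> \<boxtimes> E (a \<otimes> inv c) \<one>\<^bsub>W\<^esub>)"
      by (simp add: one_H H.H_simps comult_E J_id)
    also have "\<dots> = (\<Sum>c\<in>carrier A. \<Sum>a\<in>carrier A. E c \<one>\<^bsub>W\<^esub> \<boxtimes> E (a \<otimes> inv c) \<one>\<^bsub>W\<^esub>)"
      by (rule sum.swap)
    also have "\<dots> = (\<Sum>c\<in>carrier A. \<Sum>a\<in>carrier A. E c \<one>\<^bsub>W\<^esub> \<boxtimes> E a \<one>\<^bsub>W\<^esub>)"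
    proof (rule sum.cong[OF refl])
      fix c assume c: "c \<in> carrier A"
      have 1: "c \<otimes> a \<otimes> inv c = a" if "a \<in> carrier A" for a
        using c that by (simp add: m_comm[of c a] m_assoc)
      show "(\<Sum>a\<in>carrier A. E c \<one>\<^bsub>W\<^esub> \<boxtimes> E (a \<otimes> inv c) \<one>\<^bsub>W\<^esub>) = (\<Sum>a\<in>carrier A. E c \<one>\<^bsub>W\<^esub> \<boxtimes> E a \<one>\<^bsub>W\<^esub>)"
        by (subst sum_shift[OF c]) (simp add: 1)
    qed
    also have "\<dots> = aone H \<boxtimes> aone H" by (subst sum.swap) (simp add: one_H tens_simps)
    finally show ?thesis .
  qed
qed

interpretation HH: hopf_algebra H
  by (rule hopf_H)

section \<open>Semisimplicity of the crossed product\<close>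

lemma semisimple_H: "semisimple_algebra H"
proof (rule H.semisimple_separable)
  let ?I = "carrier A \<times> carrier W"
  let ?u = "\<lambda>(a, w). (1 / of_nat (card (carrier W))) *\<^sub>p E a w"
  let ?v = "\<lambda>(a, w). inverse (g w (inv\<^bsub>W\<^esub> w) a) *\<^sub>p E (act w a) (inv\<^bsub>W\<^esub> w)"
  have cW: "card (carrier W) \<noteq> 0"
    using finite_W W.one_closed by auto
  show "k_algebra H" by (rule HH.k_algebra_axioms)
  show "?u i \<in> acarrier H" "?v i \<in> acarrier H" if "i \<in> ?I" for i
    using that by (auto simp: vbasis_H intro!: scl_in)
  show "(\<Sum>i\<in>?I. ?u i \<bullet>\<^bsub>H\<^esub> ?v i) = aone H"
  proof -
    have "(\<Sum>i\<in>?I. ?u i \<bullet>\<^bsub>H\<^esub> ?v i) = (\<Sum>a\<in>carrier A. \<Sum>w\<in>carrier W. (1 / of_nat (card (carrier W))) *\<^sub>p E a \<one>\<^bsub>W\<^esub>)"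
      unfolding sum.cartesian_product
      by (intro sum.cong refl) (auto simp: H.H_simps E_mult g_nonzero)
    also have "\<dots> = aone H"
      unfolding one_H by (simp add: pm.sum_constant_scale cW)
    finally show ?thesis .
  qed
  show "(\<Sum>i\<in>?I. (x \<bullet>\<^bsub>H\<^esub> ?u i) \<boxtimes> ?v i) = (\<Sum>i\<in>?I. ?u i \<boxtimes> (?v i \<bullet>\<^bsub>H\<^esub> x))" if "x \<in> X" for x
  proof -
    from that obtain b v where x: "x = E b v" "b \<in> carrier A" "v \<in> carrier W" by (auto simp: X_def)
    \<comment> \<open>The common shape of both sums: multiplication by \<open>E b v\<close> leaves
      one index \<open>a\<close> for each \<open>w\<close>, and the two sums agree after translating
      \<open>w\<close> by \<open>v\<close>.\<close>
    let ?t = "\<lambda>w. (inverse (g w (inv\<^bsub>W\<^esub> w \<otimes>\<^bsub>W\<^esub> v) b) / of_nat (card (carrier W))) *\<^sub>p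
        (E b w \<boxtimes> E (act w b) (inv\<^bsub>W\<^esub> w \<otimes>\<^bsub>W\<^esub> v))"
    have swap: "(\<Sum>i\<in>?I. F i) = (\<Sum>w\<in>carrier W. \<Sum>a\<in>carrier A. F (a, w))"
      for F :: "'a \<times> 'w \<Rightarrow> (('a \<times> 'w) \<times> ('a \<times> 'w) \<Rightarrow>\<^sub>0 'k)"
      by (subst sum.swap) (simp add: sum.cartesian_product)
    have "(\<Sum>i\<in>?I. ?u i \<boxtimes> (?v i \<bullet>\<^bsub>H\<^esub> x)) = (\<Sum>w\<in>carrier W. \<Sum>a\<in>carrier A. if a = b then ?t w else 0)"
      unfolding swap case_prod_conv
    proof (intro sum.cong refl)
      fix a w assume aw: "a \<in> carrier A" "w \<in> carrier W"
      \<comment> \<open>The cocycle law for \<open>w\<close>, its inverse and \<open>v\<close>; the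
        mirror computation below takes \<open>v\<close>, \<open>w\<close> and the inverse of
        \<open>w\<close>.\<close>
      have "g w (inv\<^bsub>W\<^esub> w) b = g (inv\<^bsub>W\<^esub> w) v (act w b) * g w (inv\<^bsub>W\<^esub> w \<otimes>\<^bsub>W\<^esub> v) b"
        using g_cocycle[of w "inv\<^bsub>W\<^esub> w" v b] aw x by (simp add: g_one)
      then have "inverse (g w (inv\<^bsub>W\<^esub> w) b) * g (inv\<^bsub>W\<^esub> w) v (act w b) =
          inverse (g w (inv\<^bsub>W\<^esub> w \<otimes>\<^bsub>W\<^esub> v) b)"
        using g_nonzero[of "inv\<^bsub>W\<^esub> w" v "act w b"] aw x by (simp add: field_simps)
      then show "((1 / of_nat (card (carrier W))) *\<^sub>p E a w) \<boxtimes>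
          ((inverse (g w (inv\<^bsub>W\<^esub> w) a) *\<^sub>p E (act w a) (inv\<^bsub>W\<^esub> w)) \<bullet>\<^bsub>H\<^esub> x) =
          (if a = b then ?t w else 0)"
        using aw x by (auto simp: H.H_simps E_mult)
    qed
    also have "\<dots> = (\<Sum>w\<in>carrier W. ?t w)"
      using x finite_A by simp
    also have "\<dots> = (\<Sum>w\<in>carrier W. ?t (v \<otimes>\<^bsub>W\<^esub> w))"
      by (rule sum.reindex_bij_witness[of _ "\<lambda>w. v \<otimes>\<^bsub>W\<^esub> w" "\<lambda>w. inv\<^bsub>W\<^esub> v \<otimes>\<^bsub>W\<^esub> w"])
        (use x in \<open>auto simp: W.m_assoc[symmetric]\<close>)
    also have "\<dots> = (\<Sum>w\<in>carrier W. \<Sum>a\<in>carrier A. if a = act v b then ?t (v \<otimes>\<^bsub>W\<^esub> w) else 0)"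
      using x finite_A by simp
    also have "\<dots> = (\<Sum>i\<in>?I. (x \<bullet>\<^bsub>H\<^esub> ?u i) \<boxtimes> ?v i)"
      unfolding swap case_prod_conv
    proof (intro sum.cong refl)
      fix a w assume aw: "a \<in> carrier A" "w \<in> carrier W"
      have "g v w b * g (v \<otimes>\<^bsub>W\<^esub> w) (inv\<^bsub>W\<^esub> w) b = g w (inv\<^bsub>W\<^esub> w) (act v b)"
        using g_cocycle[of v w "inv\<^bsub>W\<^esub> w" b] aw x by (simp add: g_one)
      then have 1: "g v w b * inverse (g w (inv\<^bsub>W\<^esub> w) (act v b)) = inverse (g (v \<otimes>\<^bsub>W\<^esub> w) (inv\<^bsub>W\<^esub> w) b)"
        using g_nonzero[of v w b] g_nonzero[of "v \<otimes>\<^bsub>W\<^esub> w" "inv\<^bsub>W\<^esub> w" b]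
          g_nonzero[of w "inv\<^bsub>W\<^esub> w" "act v b"] aw x
        by (simp add: field_simps)
      have "inv\<^bsub>W\<^esub> (v \<otimes>\<^bsub>W\<^esub> w) \<otimes>\<^bsub>W\<^esub> v = inv\<^bsub>W\<^esub> w"
        using aw x by (simp add: W.inv_mult_group W.m_assoc)
      then show "(if a = act v b then ?t (v \<otimes>\<^bsub>W\<^esub> w) else 0) =
        (x \<bullet>\<^bsub>H\<^esub> ((1 / of_nat (card (carrier W))) *\<^sub>p E a w)) \<boxtimes>
          (inverse (g w (inv\<^bsub>W\<^esub> w) a) *\<^sub>p E (act w a) (inv\<^bsub>W\<^esub> w))"
        using aw x 1 by (auto simp: H.H_simps E_mult act_act mult_ac)
    qed
    finally show ?thesis ..
  qed
qed

subsection \<open>The extension\<close>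

definition \<iota> :: "('a \<Rightarrow>\<^sub>0 'k) \<Rightarrow> ('a \<times> 'w \<Rightarrow>\<^sub>0 'k)"
  where "\<iota> r = r \<boxtimes> bvec \<one>\<^bsub>W\<^esub>"

definition \<pi> :: "('a \<times> 'w \<Rightarrow>\<^sub>0 'k) \<Rightarrow> ('w \<Rightarrow>\<^sub>0 'k)"
  where "\<pi> = lin_ext (\<lambda>(f, w). bvec w)"

lemma plinear_\<iota>: "plinear \<iota>"
  by (simp add: \<iota>_def[abs_def])

lemma plinear_\<pi>: "plinear \<pi>"
  by (simp add: \<pi>_def)

lemma \<iota>_bvec: "\<iota> (bvec f) = bvec (f, \<one>\<^bsub>W\<^esub>)"
  by (simp add: \<iota>_def)

lemma \<iota>_closed: "r \<in> acarrier R \<Longrightarrow> \<iota> r \<in> acarrier H"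
  by (simp add: \<iota>_def R.vbasis_eq vbasis_H tens_in)

lemma \<gamma>_one: "w \<in> carrier W \<Longrightarrow> \<gamma> \<one>\<^bsub>W\<^esub> w = aone R" "w \<in> carrier W \<Longrightarrow> \<gamma> w \<one>\<^bsub>W\<^esub> = aone R"
  using cocycle by (auto simp: normalized_2cocycle_def)

lemma \<sigma>_id: "r \<in> acarrier R \<Longrightarrow> \<sigma> \<one>\<^bsub>W\<^esub> r = r"
  unfolding R.vbasis_eq
  by (induction rule: vec_induct) (simp_all add: plinear_simps[OF \<sigma>_plinear] \<sigma>_bvec)

lemma R_mult_closed: "r \<in> acarrier R \<Longrightarrow> s \<in> acarrier R \<Longrightarrow> r \<bullet>\<^bsub>R\<^esub> s \<in> acarrier R"
  using R.mult_linear_left[of s] by (auto simp: linear_map_def)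

lemma \<iota>_mult_left:
  assumes "r \<in> acarrier R" "s \<in> acarrier R" "w \<in> carrier W"
  shows "\<iota> r \<bullet>\<^bsub>H\<^esub> (s \<boxtimes> bvec w) = (r \<bullet>\<^bsub>R\<^esub> s) \<boxtimes> bvec w"
  using assms crossed_mult[of r s "\<one>\<^bsub>W\<^esub>" w, folded R.vbasis_eq]
  by (simp add: \<iota>_def \<sigma>_id \<gamma>_one R.mult_one_right R_mult_closed)

lemma \<iota>_mult: "r \<in> acarrier R \<Longrightarrow> s \<in> acarrier R \<Longrightarrow> \<iota> (r \<bullet>\<^bsub>R\<^esub> s) = \<iota> r \<bullet>\<^bsub>H\<^esub> \<iota> s"
  using \<iota>_mult_left[of r s "\<one>\<^bsub>W\<^esub>"] by (simp add: \<iota>_def)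

lemma \<iota>_one: "\<iota> (aone R) = aone H"
  by (simp add: \<iota>_def H_def crossed_product_def)

text \<open>Substituting \<open>a = c \<otimes> d\<close> splits the character values and leaves
  \<open>J w\<close> with two independent arguments.\<close>

lemma comult_bvec:
  assumes "f \<in> carrier A" "w \<in> carrier W"
  shows "comult H (bvec (f, w)) =
    (\<Sum>c\<in>carrier A. \<Sum>d\<in>carrier A. (\<chi> c f * \<chi> d f * J w c d) *\<^sub>p (E c w \<boxtimes> E d w))"
proof -
  have "comult H (bvec (f, w)) = (\<Sum>a\<in>carrier A. \<Sum>c\<in>carrier A.
      (\<chi> a f * J w c (a \<otimes> inv c)) *\<^sub>p (E c w \<boxtimes> E (a \<otimes> inv c) w))"
    using assms by (simp add: bvec_eq_E H.H_simps comult_E pm.scale_sum_right)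
  also have "\<dots> = (\<Sum>c\<in>carrier A. \<Sum>a\<in>carrier A.
      (\<chi> a f * J w c (a \<otimes> inv c)) *\<^sub>p (E c w \<boxtimes> E (a \<otimes> inv c) w))"
    by (rule sum.swap)
  also have "\<dots> = (\<Sum>c\<in>carrier A. \<Sum>d\<in>carrier A. (\<chi> c f * \<chi> d f * J w c d) *\<^sub>p (E c w \<boxtimes> E d w))"
  proof (rule sum.cong[OF refl])
    fix c assume c: "c \<in> carrier A"
    have 1: "c \<otimes> d \<otimes> inv c = d" if "d \<in> carrier A" for d
      using c that by (simp add: m_comm[of c d] m_assoc)
    show "(\<Sum>a\<in>carrier A. (\<chi> a f * J w c (a \<otimes> inv c)) *\<^sub>p (E c w \<boxtimes> E (a \<otimes> inv c) w)) =
      (\<Sum>d\<in>carrier A. (\<chi> c f * \<chi> d f * J w c d) *\<^sub>p (E c w \<boxtimes> E d w))"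
      by (subst sum_shift[OF c]) (simp add: 1 \<chi>_mult_left c assms)
  qed
  finally show ?thesis .
qed

lemma comult_\<iota>_bvec: "f \<in> carrier A \<Longrightarrow> comult H (\<iota> (bvec f)) = \<iota> (bvec f) \<boxtimes> \<iota> (bvec f)"
proof -
  assume f: "f \<in> carrier A"
  have "\<iota> (bvec f) \<boxtimes> \<iota> (bvec f) = (\<Sum>c\<in>carrier A. \<Sum>d\<in>carrier A. (\<chi> c f * \<chi> d f * J \<one>\<^bsub>W\<^esub> c d) *\<^sub>p (E c \<one>\<^bsub>W\<^esub> \<boxtimes> E d \<one>\<^bsub>W\<^esub>))"
    unfolding \<iota>_bvec bvec_eq_E[OF f] by (simp add: tens_simps J_id pm.scale_sum_right) (subst sum.swap, simp add: mult.commute)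
  then show ?thesis using f by (simp only: \<iota>_bvec comult_bvec W.one_closed)
qed

lemma antipode_\<iota>_bvec: "f \<in> carrier A \<Longrightarrow> antipode H (\<iota> (bvec f)) = \<iota> (bvec (inv f))"
proof -
  assume f: "f \<in> carrier A"
  have "antipode H (\<iota> (bvec f)) = (\<Sum>a\<in>carrier A. \<chi> a f *\<^sub>p E (inv a) \<one>\<^bsub>W\<^esub>)"
    unfolding \<iota>_bvec bvec_eq_E[OF f] by (simp add: H.H_simps antipode_E)
  also have "\<dots> = (\<Sum>a\<in>carrier A. \<chi> a (inv f) *\<^sub>p E a \<one>\<^bsub>W\<^esub>)"
    by (subst sum_inv) (simp add: \<chi>_inv_left \<chi>_inv f)
  finally show ?thesis using f by (simp add: \<iota>_bvec bvec_eq_E)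
qed

lemma grouplike_\<iota>_bvec: "f \<in> carrier A \<Longrightarrow> grouplike H (\<iota> (bvec f))"
  unfolding grouplike_def using comult_\<iota>_bvec[of f]
  by (simp add: \<iota>_closed R.vbasis_eq) (simp add: \<iota>_bvec counit_bvec)

lemma hopf_hom_\<iota>: "hopf_hom \<iota> R H"
proof (rule hopf_hom_spanI[OF R.bilinear_hopf_data_axioms H.bilinear_hopf_data_axioms plinear_\<iota>])
  fix x :: "'a \<Rightarrow>\<^sub>0 'k" assume "x \<in> bvec ` carrier A"
  then obtain f where f: "x = bvec f" "f \<in> carrier A" by blast
  show "\<iota> x \<in> acarrier H" using f by (simp add: \<iota>_closed R.vbasis_eq)
  show "comult H (\<iota> x) = tens_map \<iota> \<iota> (comult R x)"
    using f by (simp add: comult_\<iota>_bvec R.comult_bvec' tens_map_tens plinear_\<iota> del: tens_bvec)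
  show "counit H (\<iota> x) = counit R x"
    using f by (simp add: \<iota>_bvec counit_bvec R.counit_bvec)
  show "antipode H (\<iota> x) = \<iota> (antipode R x)"
    using f by (simp add: antipode_\<iota>_bvec R.antipode_bvec)
  fix y :: "'a \<Rightarrow>\<^sub>0 'k" assume "y \<in> bvec ` carrier A"
  then show "\<iota> (x \<bullet>\<^bsub>R\<^esub> y) = \<iota> x \<bullet>\<^bsub>H\<^esub> \<iota> y"
    using f by (auto intro!: \<iota>_mult simp: R.vbasis_eq)
qed (rule \<iota>_one)

lemma \<pi>_E: "a \<in> carrier A \<Longrightarrow> \<pi> (E a w) = (if a = \<one> then bvec w else 0)"
proof -
  assume a: "a \<in> carrier A"
  have "\<pi> (E a w) = (\<Sum>f\<in>carrier A. \<chi> a (inv f) / N) *\<^sub>p bvec w"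
    by (simp add: \<pi>_def E_def e_def tens_simps lin_ext_sum lin_ext_scl lin_ext_single pm.scale_sum_left)
  also have "(\<Sum>f\<in>carrier A. \<chi> a (inv f) / N) = (\<Sum>f\<in>carrier A. \<chi> a f / N)"
    by (subst sum_inv) simp
  finally show ?thesis using a by (simp add: sum_divide_distrib[symmetric] sum_\<chi>)
qed

text \<open>Projecting the second tensor factor kills all \<open>E d w\<close> except for
  \<open>d = \<one>\<close>, where \<open>J\<close> is 1. The resulting coaction is the grading of
  the crossed product by \<open>W\<close>, whose part of degree \<open>\<one>\<close> is the image
  of \<open>R\<close>.\<close>

lemma coinvariants:
  assumes "h \<in> acarrier H"
  shows "tens_map id \<pi> (comult H h) = lin_ext (\<lambda>(f, w). bvec ((f, w), w)) h"
proof -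
  have 1: "tens_map id \<pi> (comult H (bvec (f, w))) = bvec ((f, w), w)"
    if "f \<in> carrier A" "w \<in> carrier W" for f w
  proof -
    have "tens_map id \<pi> (comult H (bvec (f, w))) =
      (\<Sum>c\<in>carrier A. \<Sum>d\<in>carrier A. if d = \<one> then \<chi> c f *\<^sub>p (E c w \<boxtimes> bvec w) else 0)"
      using that by (simp add: comult_bvec H.H_simps tens_map_tens plinear_\<pi>)
        (intro sum.cong refl, simp add: \<pi>_E J_one tens_simps)
    also have "\<dots> = bvec (f, w) \<boxtimes> bvec w"
      unfolding bvec_eq_E[OF that(1)] using finite_A by (simp add: tens_simps)
    finally show ?thesis by simp
  qed
  show ?thesis
    using assms unfolding vbasis_H
  proof (induction rule: vec_induct)
    case zero
    show ?case by (simp add: H.H_simps)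
  next
    case (add c b h)
    then show ?case
      by (cases b) (simp add: H.H_simps 1[unfolded id_def] id_def lin_ext_single lin_ext_add lin_ext_scl)
  qed
qed

lemma extension_H:
  assumes "group_hopf_algebra W Q"
  shows "hopf_extension H Q R"
proof -
  interpret Q: group_hopf_algebra W Q by fact
  have hom: "hopf_hom \<pi> H Q"
  proof (rule hopf_hom_spanI[OF H.bilinear_hopf_data_axioms Q.bilinear_hopf_data_axioms plinear_\<pi>])
    show "\<pi> (aone H) = aone Q"
      using finite_A by (simp add: one_H plinear_simps[OF plinear_\<pi>] \<pi>_E Q.one_eq)
    fix x assume "x \<in> X"
    then obtain a w where x: "x = E a w" "a \<in> carrier A" "w \<in> carrier W" by (auto simp: X_def)
    show "\<pi> x \<in> acarrier Q" using x by (simp add: \<pi>_E Q.vbasis_eq)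
    show "counit Q (\<pi> x) = counit H x"
      using x by (simp add: \<pi>_E counit_E Q.counit_bvec Q.H_simps)
    have "act w (inv a) = \<one> \<longleftrightarrow> a = \<one>"
      using x by (metis act_inv act_inv_cancel(1) act_unit inv_inv inv_one act_closed)
    then show "antipode Q (\<pi> x) = \<pi> (antipode H x)"
      using x by (simp add: \<pi>_E antipode_E Q.antipode_bvec Q.H_simps)
    have "tens_map \<pi> \<pi> (comult H x) = (\<Sum>c\<in>carrier A. if c = \<one> then (if a = \<one> then bvec w \<boxtimes> bvec w else 0) else 0)"
      using x unfolding x(1) comult_E[OF x(2)] H.H_simps tens_map_tens[OF plinear_\<pi> plinear_\<pi>]
      by (intro sum.cong refl) (auto simp: \<pi>_E J_one tens_simps)
    also have "\<dots> = comult Q (\<pi> x)"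
      using x finite_A by (simp add: \<pi>_E Q.H_simps Q.comult_bvec)
    finally show "comult Q (\<pi> x) = tens_map \<pi> \<pi> (comult H x)" ..
    fix y assume "y \<in> X"
    then obtain b v where y: "y = E b v" "b \<in> carrier A" "v \<in> carrier W" by (auto simp: X_def)
    show "\<pi> (x \<bullet>\<^bsub>H\<^esub> y) = \<pi> x \<bullet>\<^bsub>Q\<^esub> \<pi> y"
      using x y by (auto simp: \<pi>_E E_mult plinear_simps[OF plinear_\<pi>] Q.H_simps Q.bvec_mult g_unit)
  qed
  have surj: "\<pi> ` acarrier H = acarrier Q"
  proof
    show "\<pi> ` acarrier H \<subseteq> acarrier Q"
      using hom by (auto simp: hopf_hom_def linear_map_def)
    \<comment> \<open>A linear section of \<open>\<pi>\<close>, which gives surjectivity.\<close>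
    have *: "\<pi> (bvec \<one> \<boxtimes> q) = q" for q
      unfolding \<pi>_def lin_ext_tens bilin_ext_def by (simp add: lin_ext_single expand[symmetric])
    show "acarrier Q \<subseteq> \<pi> ` acarrier H"
    proof
      fix q assume "q \<in> acarrier Q"
      then have "bvec \<one> \<boxtimes> q \<in> acarrier H" by (simp add: vbasis_H Q.vbasis_eq tens_in)
      then show "q \<in> \<pi> ` acarrier H" using *[of q] by (metis imageI)
    qed
  qed
  have inj: "inj_on \<iota> (acarrier R)"
  proof (rule inj_onI)
    fix r s assume "\<iota> r = \<iota> s"
    then have "Poly_Mapping.lookup (\<iota> r) (f, \<one>\<^bsub>W\<^esub>) = Poly_Mapping.lookup (\<iota> s) (f, \<one>\<^bsub>W\<^esub>)" for f by simp
    then show "r = s" by (intro poly_mapping_eqI) (simp add: \<iota>_def lookup_tens)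
  qed
  have sub: "hopf_subalg (\<iota> ` acarrier R) H"
    unfolding hopf_subalg_def is_subalg_def
  proof (intro conjI ballI)
    interpret \<iota>: module_hom scl scl \<iota>
      using plinear_\<iota> by (rule Vector_Spaces.linear.axioms(3))
    show "pm.subspace (\<iota> ` acarrier R)"
      by (rule \<iota>.subspace_image[OF subspace_vec_on])
    show "aone H \<in> \<iota> ` acarrier R" using \<iota>_one R.one_closed by (metis imageI)
    show "x \<bullet>\<^bsub>H\<^esub> y \<in> \<iota> ` acarrier R" if "x \<in> \<iota> ` acarrier R" "y \<in> \<iota> ` acarrier R" for x y
      using that by (auto simp: \<iota>_mult[symmetric] R_mult_closed)
    show "antipode H u \<in> \<iota> ` acarrier R" if "u \<in> \<iota> ` acarrier R" for u
      using that hopf_hom_\<iota> R.antipode_linear by (auto simp: hopf_hom_def linear_map_def)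
    let ?S = "{v \<boxtimes> w |v w. v \<in> \<iota> ` acarrier R \<and> w \<in> \<iota> ` acarrier R}"
    show "comult H u \<in> pm.span ?S" if "u \<in> \<iota> ` acarrier R" for u
    proof -
      from that obtain r where r: "r \<in> acarrier R" "u = \<iota> r" by blast
      have "comult H (\<iota> r) \<in> pm.span ?S"
        using r(1) unfolding R.vbasis_eq
      proof (induction rule: vec_induct)
        case zero
        show ?case by (simp add: H.H_simps plinear_simps[OF plinear_\<iota>] pm.span_zero)
      next
        case (add c f h)
        have "\<iota> (bvec f) \<in> \<iota> ` vec_on (carrier A)" using add by simp
        then have "\<iota> (bvec f) \<boxtimes> \<iota> (bvec f) \<in> pm.span {v \<boxtimes> w |v w. v \<in> \<iota> ` vec_on (carrier A) \<and> w \<in> \<iota> ` vec_on (carrier A)}"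
          by (intro pm.span_base) blast
        then show ?case
          using add by (auto simp: H.H_simps plinear_simps[OF plinear_\<iota>] comult_\<iota>_bvec
              intro!: pm.span_add pm.span_scale)
      qed
      then show ?thesis using r by simp
    qed
  qed (use \<iota>_closed in auto)
  have coinv: "\<iota> ` acarrier R = {h \<in> acarrier H. tens_map id \<pi> (comult H h) = h \<boxtimes> aone Q}"
  proof (intro equalityI subsetI)
    fix h assume "h \<in> \<iota> ` acarrier R"
    then obtain r where r: "r \<in> acarrier R" "h = \<iota> r" by blast
    have "tens_map id \<pi> (comult H (\<iota> r)) = \<iota> r \<boxtimes> aone Q"
      using r(1) R.span_X
    proof (induction rule: span_eq_induct)
      case (add c x y)
      then obtain f where f: "f \<in> carrier A" "x = bvec f" by blast
      have "tens_map id \<pi> (comult H (\<iota> x)) = \<iota> x \<boxtimes> aone Q"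
        using f by (simp add: \<iota>_bvec coinvariants vbasis_H lin_ext_single Q.one_eq)
      with add show ?case by (simp add: H.H_simps plinear_simps[OF plinear_\<iota>] id_def)
    qed (simp add: H.H_simps plinear_simps[OF plinear_\<iota>])
    then show "h \<in> {h \<in> acarrier H. tens_map id \<pi> (comult H h) = h \<boxtimes> aone Q}"
      using r \<iota>_closed by simp
  next
    fix h assume "h \<in> {h \<in> acarrier H. tens_map id \<pi> (comult H h) = h \<boxtimes> aone Q}"
    then have h: "h \<in> acarrier H" and eq: "lin_ext (\<lambda>(f, w). bvec ((f, w), w)) h = h \<boxtimes> bvec \<one>\<^bsub>W\<^esub>"
      by (auto simp: coinvariants Q.one_eq)
    have lk: "Poly_Mapping.lookup (lin_ext (\<lambda>(f, w). bvec ((f, w), w)) h) ((f, w), w) = Poly_Mapping.lookup h (f, w)" for f w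
    proof -
      have "Poly_Mapping.lookup (lin_ext (\<lambda>(f, w). bvec ((f, w), w)) h) ((f, w), w) =
        (\<Sum>b\<in>Poly_Mapping.keys h. if b = (f, w) then Poly_Mapping.lookup h b else 0)"
        unfolding lin_ext_def lookup_sum
        by (intro sum.cong refl) (auto simp: lookup_single when_def split: if_splits)
      then show ?thesis by (simp add: in_keys_iff)
    qed
    \<comment> \<open>At \<open>((f, w), w)\<close> the left side of \<open>eq\<close> has the
      coefficient of \<open>h\<close> at \<open>(f, w)\<close>, while the right side vanishes unless
      \<open>w\<close> is the unit.\<close>
    have supp: "w = \<one>\<^bsub>W\<^esub>" if "(f, w) \<in> Poly_Mapping.keys h" for f w
      using lk[of f w] that unfolding eq lookup_tens
      by (auto simp: in_keys_iff lookup_single when_def split: if_splits)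
    \<comment> \<open>The \<open>W\<close> component is the unit on the whole support of
      \<open>h\<close>, so forgetting it yields the preimage under \<open>\<iota>\<close>.\<close>
    let ?r = "lin_ext (\<lambda>(f, w). bvec f) h"
    have "\<iota> ?r = lin_ext (\<lambda>(f, w). bvec (f, \<one>\<^bsub>W\<^esub>)) h"
      unfolding lin_ext_def by (simp add: plinear_simps[OF plinear_\<iota>] \<iota>_bvec case_prod_unfold)
    also have "\<dots> = lin_ext bvec h"
      unfolding lin_ext_def using supp by (intro sum.cong refl) auto
    finally have "\<iota> ?r = h" using expand[of h] by simp
    moreover have "?r \<in> acarrier R"
      using h by (intro lin_ext_closed) (auto simp: R.vbasis_eq vbasis_H)
    ultimately show "h \<in> \<iota> ` acarrier R" by (metis imageI)
  qed
  show ?thesis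
    unfolding hopf_extension_def
    using hopf_H Q.hopf_algebra_axioms R.hopf_algebra_axioms hopf_hom_\<iota> inj sub hom surj coinv by blast
qed

subsection \<open>Generators and relations\<close>

text \<open>The basis element of the free left \<open>R\<close>-module attached to \<open>w\<close>;
  at simple transpositions these are the generators \<open>z\<close>.\<close>

definition zz :: "'w \<Rightarrow> ('a \<times> 'w \<Rightarrow>\<^sub>0 'k)"
  where "zz w = aone R \<boxtimes> bvec w"

lemma zz_eq_bvec: "zz w = bvec (\<one>, w)"
  by (simp add: zz_def R.one_eq)

lemma zz_eq_E: "zz w = (\<Sum>a\<in>carrier A. E a w)"
  by (simp add: zz_eq_bvec bvec_eq_E)

lemma zz_mult:
  "w \<in> carrier W \<Longrightarrow> zz w \<bullet>\<^bsub>H\<^esub> zz v = \<gamma> w v \<boxtimes> bvec (w \<otimes>\<^bsub>W\<^esub> v)"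
  using crossed_mult[of "aone R" "aone R" w v] R.one_closed \<sigma>_ee[of w "\<lambda>_. 1"] R.mult_one_left
  by (simp add: zz_def R.vbasis_eq one_eq_ee[symmetric] \<gamma>_def)

lemma \<iota>_mult_zz: "r \<in> acarrier R \<Longrightarrow> w \<in> carrier W \<Longrightarrow> \<iota> r \<bullet>\<^bsub>H\<^esub> zz w = r \<boxtimes> bvec w"
  by (simp add: zz_def \<iota>_mult_left R.one_closed R.mult_one_right)

lemma zz_mult_trivial:
  assumes "w \<in> carrier W" "\<And>a. a \<in> carrier A \<Longrightarrow> g w v a = 1"
  shows "zz w \<bullet>\<^bsub>H\<^esub> zz v = zz (w \<otimes>\<^bsub>W\<^esub> v)"
proof -
  have "\<gamma> w v = aone R" using assms by (simp add: \<gamma>_def one_eq_ee cong: ee_cong)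
  then show ?thesis using assms by (simp add: zz_mult) (simp add: zz_def)
qed

lemma zz_mult_\<iota>_bvec:
  assumes "w \<in> carrier W" "f \<in> carrier A"
  shows "zz w \<bullet>\<^bsub>H\<^esub> \<iota> (bvec f) = \<iota> (bvec (act (inv\<^bsub>W\<^esub> w) f)) \<bullet>\<^bsub>H\<^esub> zz w"
proof -
  have cl: "bvec (act (inv\<^bsub>W\<^esub> w) f) \<in> acarrier R" using assms by (simp add: R.vbasis_eq)
  have "zz w \<bullet>\<^bsub>H\<^esub> \<iota> (bvec f) = (aone R \<bullet>\<^bsub>R\<^esub> bvec (act (inv\<^bsub>W\<^esub> w) f) \<bullet>\<^bsub>R\<^esub> \<gamma> w \<one>\<^bsub>W\<^esub>) \<boxtimes> bvec w"
    unfolding zz_def \<iota>_def using assms crossed_mult[of "aone R" "bvec f" w "\<one>\<^bsub>W\<^esub>"] R.one_closed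
    by (simp add: R.vbasis_eq \<sigma>_bvec)
  then show ?thesis
    using assms cl by (simp add: R.mult_one_left R.mult_one_right \<gamma>_one \<iota>_mult_zz)
qed

lemma \<iota>_e: "\<iota> (e a) = E a \<one>\<^bsub>W\<^esub>"
  by (simp add: \<iota>_def E_def)

text \<open>The left factor is \<open>J w\<close> read as a function on pairs of characters, that
  is, as an element of the tensor square of \<open>R\<close>.\<close>

lemma comult_zz:
  assumes "w \<in> carrier W"
  shows "comult H (zz w) = (\<Sum>c\<in>carrier A. \<Sum>d\<in>carrier A. J w c d *\<^sub>p (E c \<one>\<^bsub>W\<^esub> \<boxtimes> E d \<one>\<^bsub>W\<^esub>))
    \<bullet>\<^bsub>tensor_alg H H\<^esub> (zz w \<boxtimes> zz w)"
proof -
  have E: "E c \<one>\<^bsub>W\<^esub> \<bullet>\<^bsub>H\<^esub> zz w = E c w" if "c \<in> carrier A" for c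
    using that assms by (simp add: \<iota>_e[symmetric] \<iota>_mult_zz) (simp add: E_def)
  show ?thesis
    using assms by (simp add: H.H_simps H.tensor_mult E) (simp add: zz_eq_bvec comult_bvec)
qed

lemma counit_zz: "counit H (zz w) = 1"
  by (simp add: zz_eq_bvec counit_bvec)

lemma antipode_zz: "w \<in> carrier W \<Longrightarrow> antipode H (zz w) = zz (inv\<^bsub>W\<^esub> w)"
  using sum_act[of w "\<lambda>a. E a (inv\<^bsub>W\<^esub> w)"] sum_inv[of "\<lambda>a. E (act w a) (inv\<^bsub>W\<^esub> w)"]
  by (simp add: zz_eq_E H.H_simps antipode_E)

lemma apow_\<iota>_bvec: "f \<in> carrier A \<Longrightarrow> apow H (\<iota> (bvec f)) k = \<iota> (bvec (f [^] k))"
proof (induction k)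
  case 0
  then show ?case by (simp add: apow_def \<iota>_one[symmetric] R.one_eq)
next
  case (Suc k)
  then show ?case
    using \<iota>_mult[of "bvec (f [^] k)" "bvec f"]
    by (simp add: apow_def R.bvec_mult R.vbasis_eq)
qed

lemma \<iota>_bvec_mult: "f \<in> carrier A \<Longrightarrow> h \<in> carrier A \<Longrightarrow> \<iota> (bvec f) \<bullet>\<^bsub>H\<^esub> \<iota> (bvec h) = \<iota> (bvec (f \<otimes> h))"
  using \<iota>_mult[of "bvec f" "bvec h"] by (simp add: R.bvec_mult R.vbasis_eq)

text \<open>For an involution the square is a cocycle value, hence lies in the image of
  \<open>R\<close>. An expansion of the function \<open>g w w\<close> into characters becomes, by
  Fourier inversion, the same combination of group elements.\<close>

lemma zz_square_bvec:
  assumes "w \<in> carrier W" "inv\<^bsub>W\<^esub> w = w" "\<And>a. a \<in> carrier A \<Longrightarrow> g w w a = (\<Sum>i\<in>I. \<Sum>j\<in>I'. c i j * \<chi> a (f i j))"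
    and "\<And>i j. i \<in> I \<Longrightarrow> j \<in> I' \<Longrightarrow> f i j \<in> carrier A"
  shows "zz w \<bullet>\<^bsub>H\<^esub> zz w = (\<Sum>i\<in>I. \<Sum>j\<in>I'. c i j *\<^sub>p \<iota> (bvec (f i j)))"
proof -
  have "\<gamma> w w = ee (\<lambda>a. \<Sum>i\<in>I. \<Sum>j\<in>I'. c i j * \<chi> a (f i j))"
    unfolding \<gamma>_def using assms(3) by (rule ee_cong)
  also have "\<dots> = (\<Sum>i\<in>I. \<Sum>j\<in>I'. c i j *\<^sub>p ee (\<lambda>a. \<chi> a (f i j)))"
    unfolding ee_def pm.scale_sum_left pm.scale_sum_right pm.scale_scale
    by (subst sum.swap, intro sum.cong refl) (rule sum.swap)
  also have "\<dots> = (\<Sum>i\<in>I. \<Sum>j\<in>I'. c i j *\<^sub>p bvec (f i j))"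
    using assms(4) by (intro sum.cong refl) (simp add: bvec_eq_ee)
  finally have "\<gamma> w w = (\<Sum>i\<in>I. \<Sum>j\<in>I'. c i j *\<^sub>p bvec (f i j))" .
  moreover have "w \<otimes>\<^bsub>W\<^esub> w = \<one>\<^bsub>W\<^esub>" using assms(1,2) W.r_inv[of w] by simp
  ultimately have "zz w \<bullet>\<^bsub>H\<^esub> zz w = \<iota> (\<Sum>i\<in>I. \<Sum>j\<in>I'. c i j *\<^sub>p bvec (f i j))"
    using assms(1) by (simp add: zz_mult) (simp add: \<iota>_def)
  then show ?thesis by (simp add: plinear_simps[OF plinear_\<iota>])
qed

text \<open>The same translation for \<open>J w\<close>, now with one character in each
  variable.\<close>

lemma comult_zz_bvec:
  assumes "w \<in> carrier W"
    and "\<And>a b. a \<in> carrier A \<Longrightarrow> b \<in> carrier A \<Longrightarrow> J w a b = (\<Sum>i\<in>I. \<Sum>j\<in>I'. c i j * (\<chi> a (f i) * \<chi> b (h j)))"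
    and "\<And>i. i \<in> I \<Longrightarrow> f i \<in> carrier A" "\<And>j. j \<in> I' \<Longrightarrow> h j \<in> carrier A"
  shows "comult H (zz w) = (\<Sum>i\<in>I. \<Sum>j\<in>I'. c i j *\<^sub>p (\<iota> (bvec (f i)) \<boxtimes> \<iota> (bvec (h j))))
    \<bullet>\<^bsub>tensor_alg H H\<^esub> (zz w \<boxtimes> zz w)"
proof -
  have 1: "\<iota> (bvec f) = (\<Sum>a\<in>carrier A. \<chi> a f *\<^sub>p E a \<one>\<^bsub>W\<^esub>)" if "f \<in> carrier A" for f
    using that by (simp add: \<iota>_bvec bvec_eq_E)
  have "(\<Sum>i\<in>I. \<Sum>j\<in>I'. c i j *\<^sub>p (\<iota> (bvec (f i)) \<boxtimes> \<iota> (bvec (h j)))) =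
    (\<Sum>i\<in>I. \<Sum>j\<in>I'. \<Sum>(a, b)\<in>carrier A \<times> carrier A. (c i j * (\<chi> a (f i) * \<chi> b (h j))) *\<^sub>p (E a \<one>\<^bsub>W\<^esub> \<boxtimes> E b \<one>\<^bsub>W\<^esub>))"
    unfolding sum.cartesian_product[symmetric]
    using assms(3,4) by (intro sum.cong refl)
     (simp add: 1 tens_simps pm.scale_sum_right, subst sum.swap, simp add: mult_ac)
  also have "\<dots> = (\<Sum>(a, b)\<in>carrier A \<times> carrier A. \<Sum>i\<in>I. \<Sum>j\<in>I'. (c i j * (\<chi> a (f i) * \<chi> b (h j))) *\<^sub>p (E a \<one>\<^bsub>W\<^esub> \<boxtimes> E b \<one>\<^bsub>W\<^esub>))"
    unfolding case_prod_unfold by (rule trans[OF sum.cong[OF refl sum.swap] sum.swap])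
  also have "\<dots> = (\<Sum>(a, b)\<in>carrier A \<times> carrier A. J w a b *\<^sub>p (E a \<one>\<^bsub>W\<^esub> \<boxtimes> E b \<one>\<^bsub>W\<^esub>))"
    by (intro sum.cong refl) (auto simp: assms(2) pm.scale_sum_left)
  finally show ?thesis
    using comult_zz[OF assms(1)] by (simp add: sum.cartesian_product)
qed

text \<open>The product of \<open>zz w\<close> and \<open>zz v\<close> is the desired element up to
  a value of the cocycle; this is a unit of \<open>R\<close>, and its inverse is available in
  \<open>U\<close>.\<close>

lemma subalg_zz_mult:
  assumes U: "is_subalg U H" "\<iota> ` acarrier R \<subseteq> U" and w: "w \<in> carrier W" "v \<in> carrier W"
    and zz: "zz w \<in> U" "zz v \<in> U"
  shows "zz (w \<otimes>\<^bsub>W\<^esub> v) \<in> U"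
proof -
  have "ee (\<lambda>a. inverse (g w v a)) \<bullet>\<^bsub>R\<^esub> \<gamma> w v = aone R"
    using w by (auto simp: \<gamma>_def ee_mult one_eq_ee g_nonzero intro!: ee_cong)
  then have "zz (w \<otimes>\<^bsub>W\<^esub> v) = \<iota> (ee (\<lambda>a. inverse (g w v a))) \<bullet>\<^bsub>H\<^esub> (zz w \<bullet>\<^bsub>H\<^esub> zz v)"
    using w by (simp add: zz_mult \<iota>_mult_left \<gamma>_def) (simp add: zz_def)
  moreover have "\<iota> (ee (\<lambda>a. inverse (g w v a))) \<in> U"
    using U(2) by (rule subsetD) (rule imageI, simp)
  ultimately show ?thesis using U(1) zz by (simp add: is_subalg_def)
qed

lemma subalg_eq_H:
  assumes U: "is_subalg U H" and \<iota>: "\<And>f. f \<in> carrier A \<Longrightarrow> \<iota> (bvec f) \<in> U"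
    and zz: "\<And>w. w \<in> carrier W \<Longrightarrow> zz w \<in> U"
  shows "U = acarrier H"
proof
  show "acarrier H \<subseteq> U"
    unfolding vbasis_H span_bvec[symmetric]
  proof (rule pm.span_minimal)
    show "bvec ` (carrier A \<times> carrier W) \<subseteq> U"
    proof clarify
      fix f w assume "f \<in> carrier A" "w \<in> carrier W"
      then show "bvec (f, w) \<in> U"
        using U \<iota>[of f] zz[of w] \<iota>_mult_zz[of "bvec f" w] by (simp add: is_subalg_def R.vbasis_eq) metis
    qed
  qed (use U in \<open>auto simp: is_subalg_def\<close>)
qed (use U in \<open>auto simp: is_subalg_def\<close>)

lemma subalg_\<iota>:
  assumes U: "is_subalg U H" and \<iota>: "\<And>f. f \<in> carrier A \<Longrightarrow> \<iota> (bvec f) \<in> U"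
  shows "\<iota> ` acarrier R \<subseteq> U"
proof clarify
  fix r assume "r \<in> acarrier R"
  then show "\<iota> r \<in> U"
    unfolding R.vbasis_eq
  proof (induction rule: vec_induct)
    case zero
    show ?case using U by (simp add: plinear_simps[OF plinear_\<iota>] is_subalg_def pm.subspace_0)
  next
    case (add c f h)
    then show ?case
      using U \<iota> by (simp add: plinear_simps[OF plinear_\<iota>] is_subalg_def pm.subspace_add pm.subspace_scale)
  qed
qed

end

section \<open>Quadratic forms attached to permutations\<close>

text \<open>Exponents of \<open>q\<close> are computed as integers from a coefficient matrix
  \<open>c\<close>; reduction modulo \<open>n\<close> happens only when \<open>q\<close> is raised
  to them.\<close>

definition bform :: "nat \<Rightarrow> (nat \<Rightarrow> nat \<Rightarrow> int) \<Rightarrow> (nat \<Rightarrow> int) \<Rightarrow> (nat \<Rightarrow> int) \<Rightarrow> int"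
  where "bform m c a b = (\<Sum>p\<in>{1..m}. \<Sum>r\<in>{1..m}. c p r * (a p * b r))"

text \<open>Inversions are recorded by values: \<open>p\<close> and \<open>r\<close> lie in the image of \<open>w\<close>, their positions are
  \<open>inv' w p\<close> and \<open>inv' w r\<close>.\<close>

definition inversion :: "(nat \<Rightarrow> nat) \<Rightarrow> nat \<Rightarrow> nat \<Rightarrow> int"
  where "inversion w p r = of_bool (p < r \<and> inv' w r < inv' w p)"

text \<open>These are the inversions of \<open>w\<close> that disappear in
  \<open>w \<circ> v\<close>: the last condition compares the positions of \<open>p\<close> and
  \<open>r\<close> in that composite.\<close>

definition undone :: "(nat \<Rightarrow> nat) \<Rightarrow> (nat \<Rightarrow> nat) \<Rightarrow> nat \<Rightarrow> nat \<Rightarrow> int"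
  where "undone w v p r = of_bool (p < r \<and> inv' w r < inv' w p \<and> inv' v (inv' w p) < inv' v (inv' w r))"

lemma bform_add_coeff: "bform m (\<lambda>p r. c p r + d p r) a b = bform m c a b + bform m d a b"
  by (simp add: bform_def algebra_simps sum.distrib)

lemma bform_add:
  "bform m c (\<lambda>i. a i + a' i) b = bform m c a b + bform m c a' b"
  "bform m c a (\<lambda>i. b i + b' i) = bform m c a b + bform m c a b'"
  by (simp_all add: bform_def distrib_left distrib_right sum.distrib)

lemma bform_transpose: "bform m c a b = bform m (\<lambda>p r. c r p) b a"
  unfolding bform_def by (subst sum.swap) (simp add: mult.commute)

text \<open>On the diagonal a form sees only the symmetric part of its matrix, and doubling is
  injective on the integers.\<close>

lemma bform_symmetrize:
  assumes "\<And>p r. p \<in> {1..m} \<Longrightarrow> r \<in> {1..m} \<Longrightarrow> c p r + c r p = d p r + d r p"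
  shows "bform m c a a = bform m d a a"
proof -
  have "2 * bform m c a a = bform m (\<lambda>p r. c p r + c r p) a a" for c
    unfolding bform_add_coeff using bform_transpose[of m c a a] by simp
  moreover have "bform m (\<lambda>p r. c p r + c r p) a a = bform m (\<lambda>p r. d p r + d r p) a a"
    unfolding bform_def by (intro sum.cong refl) (simp add: assms)
  ultimately have "2 * bform m c a a = 2 * bform m d a a" by simp
  then show ?thesis by simp
qed

lemma bform_permute:
  assumes w: "w permutes {1..m}"
  shows "bform m c (a \<circ> w) (b \<circ> w) = bform m (\<lambda>p r. c (inv' w p) (inv' w r)) a b"
proof -
  have "bform m (\<lambda>p r. c (inv' w p) (inv' w r)) a b =
    (\<Sum>p\<in>{1..m}. \<Sum>r\<in>{1..m}. c p (inv' w r) * (a (w p) * b r))"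
    unfolding bform_def by (subst sum.permute[OF w]) (simp add: permutes_inverses[OF w])
  also have "\<dots> = bform m c (a \<circ> w) (b \<circ> w)"
    unfolding bform_def
    by (rule sum.cong[OF refl], subst sum.permute[OF w]) (simp add: permutes_inverses[OF w])
  finally show ?thesis ..
qed

lemma bform_cong:
  assumes "\<And>i. i \<in> {1..m} \<Longrightarrow> [a i = a' i] (mod k)" "\<And>i. i \<in> {1..m} \<Longrightarrow> [b i = b' i] (mod k)"
  shows "[bform m c a b = bform m c a' b'] (mod k)"
  unfolding bform_def by (intro cong_sum cong_mult cong_refl assms)

lemma inv_perm_eq_iff: "w permutes S \<Longrightarrow> inv' w p = inv' w r \<longleftrightarrow> p = r"
  by (rule inj_eq[OF permutes_inj[OF permutes_inv]])

section \<open>Comparison of inversions under composition\<close>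

text \<open>The plain letters are the positions of one value in the identity, in \<open>w\<close>
  and in \<open>w \<circ> v\<close>, the primed letters those of another value. Ties occur only in
  all three at once, so the relative orders decide the identity.\<close>

lemma of_bool_coboundary:
  fixes x x' y y' z z' :: nat
  assumes "y = y' \<longleftrightarrow> x = x'" "z = z' \<longleftrightarrow> y = y'"
  shows "of_bool (x < x' \<and> y' < y \<and> z < z') + of_bool (x' < x \<and> y < y' \<and> z' < z) + of_bool (x < x' \<and> z' < z) =
    of_bool (x < x' \<and> y' < y) + (of_bool (y < y' \<and> z' < z) :: int)"
  using assms
  by (cases x x' rule: linorder_cases; cases y y' rule: linorder_cases; cases z z' rule: linorder_cases) simp_all

text \<open>A fourth arrangement is added. Without the terms for the exchanged pair the identity
  fails, for example when the two values change their order at every step; hence the symmetrized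
  form.\<close>

lemma of_bool_cocycle:
  fixes x x' y y' z z' u u' :: nat
  assumes "y = y' \<longleftrightarrow> x = x'" "z = z' \<longleftrightarrow> y = y'" "u = u' \<longleftrightarrow> z = z'"
  shows "of_bool (x < x' \<and> y' < y \<and> z < z') + of_bool (x < x' \<and> z' < z \<and> u < u') +
      (of_bool (x' < x \<and> y < y' \<and> z' < z) + of_bool (x' < x \<and> z < z' \<and> u' < u)) =
    of_bool (y < y' \<and> z' < z \<and> u < u') + of_bool (x < x' \<and> y' < y \<and> u < u') +
      (of_bool (y' < y \<and> z < z' \<and> u' < u) + (of_bool (x' < x \<and> y < y' \<and> u' < u) :: int))"
  using assms
  by (cases x x' rule: linorder_cases; cases y y' rule: linorder_cases; cases z z' rule: linorder_cases;
      cases u u' rule: linorder_cases) simp_all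
text \<open>Polarizing the quadratic form produces the matrix of undone inversions plus its
  transpose. Added to the inversions of \<open>w \<circ> v\<close>, it accounts for the inversions
  of \<open>w\<close> and those of \<open>v\<close> transported by \<open>w\<close>.\<close>

lemma undone_coboundary:
  assumes w: "w permutes {1..m}" and v: "v permutes {1..m}"
  shows "bform m (undone w v) (\<lambda>i. a i + b i) (\<lambda>i. a i + b i) + bform m (inversion (w \<circ> v)) a b =
    bform m (undone w v) a a + bform m (undone w v) b b +
    bform m (inversion w) a b + bform m (inversion v) (a \<circ> w) (b \<circ> w)"
proof -
  have iwv: "inv' (w \<circ> v) p = inv' v (inv' w p)" for p
    using permutes_inv_o permutes_bij[OF w] permutes_bij[OF v] by (simp add: o_inv_distrib)
  have "bform m (undone w v) a b + bform m (\<lambda>p r. undone w v r p) a b + bform m (inversion (w \<circ> v)) a b =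
    bform m (inversion w) a b + bform m (\<lambda>p r. inversion v (inv' w p) (inv' w r)) a b"
    unfolding bform_add_coeff[symmetric]
  proof (rule arg_cong[where f = "\<lambda>c. bform m c a b"], intro ext)
    fix p r
    show "undone w v p r + undone w v r p + inversion (w \<circ> v) p r =
      inversion w p r + inversion v (inv' w p) (inv' w r)"
      unfolding undone_def inversion_def iwv
      by (rule of_bool_coboundary) (simp_all add: inv_perm_eq_iff[OF w] inv_perm_eq_iff[OF v])
  qed
  then show ?thesis
    unfolding bform_permute[OF w] bform_add using bform_transpose[of m "undone w v" b a] by simp
qed

text \<open>The matrices on the two sides agree after symmetrization, which is enough because both
  arguments of the form coincide.\<close>

lemma undone_cocycle:
  assumes w: "w permutes {1..m}" and v: "v permutes {1..m}" and u: "u permutes {1..m}"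
  shows "bform m (undone w v) a a + bform m (undone (w \<circ> v) u) a a =
    bform m (undone v u) (a \<circ> w) (a \<circ> w) + bform m (undone w (v \<circ> u)) a a"
proof -
  have iwv: "inv' (w \<circ> v) p = inv' v (inv' w p)" "inv' (v \<circ> u) p = inv' u (inv' v p)" for p
    using permutes_bij[OF w] permutes_bij[OF v] permutes_bij[OF u] by (simp_all add: o_inv_distrib)
  show ?thesis
    unfolding bform_permute[OF w] bform_add_coeff[symmetric]
  proof (rule bform_symmetrize)
    fix p r
    show "undone w v p r + undone (w \<circ> v) u p r + (undone w v r p + undone (w \<circ> v) u r p) =
      undone v u (inv' w p) (inv' w r) + undone w (v \<circ> u) p r +
      (undone v u (inv' w r) (inv' w p) + undone w (v \<circ> u) r p)"
      unfolding undone_def iwv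
      by (rule of_bool_cocycle)
        (simp_all add: inv_perm_eq_iff[OF w] inv_perm_eq_iff[OF v] inv_perm_eq_iff[OF u])
  qed
qed

lemma undone_id: "undone id w = (\<lambda>_ _. 0)" "undone w id = (\<lambda>_ _. 0)"
  by (auto simp: undone_def fun_eq_iff)

lemma undone_inv: "w permutes S \<Longrightarrow> undone w (inv' w) = inversion w"
  by (auto simp: undone_def inversion_def fun_eq_iff permutes_inverses permutes_inv_inv)

abbreviation (input) adj :: "nat \<Rightarrow> nat \<Rightarrow> nat"
  where "adj k \<equiv> Transposition.transpose k (k + 1)"

lemma inversion_adj: "inversion (adj k) = (\<lambda>p r. of_bool (p = k \<and> r = k + 1))"
  by (auto simp: inversion_def fun_eq_iff transpose_def split: if_splits)

lemma undone_adj: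
  "undone (adj k) v = (\<lambda>p r. of_bool (p = k \<and> r = k + 1 \<and> inv' v (k + 1) < inv' v k))"
  by (auto simp: undone_def fun_eq_iff transpose_def split: if_splits)

lemma bform_delta:
  assumes "k \<in> {1..m - 1}"
  shows "bform m (\<lambda>p r. of_bool (p = k \<and> r = k + 1 \<and> P)) a b = of_bool P * (a k * b (k + 1))"
proof -
  have "(\<Sum>r\<in>{1..m}. of_bool (p = k \<and> r = k + 1 \<and> P) * (a p * b r)) =
    (if p = k then of_bool P * (a k * b (k + 1)) else 0)" for p
  proof (cases "p = k")
    case True
    then have "(\<Sum>r\<in>{1..m}. of_bool (p = k \<and> r = k + 1 \<and> P) * (a p * b r)) =
      (\<Sum>r\<in>{1..m}. if r = k + 1 then of_bool P * (a k * b (k + 1)) else 0)"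
      by (intro sum.cong refl) simp
    then show ?thesis using True assms by simp linarith
  qed simp
  then have "bform m (\<lambda>p r. of_bool (p = k \<and> r = k + 1 \<and> P)) a b =
    (\<Sum>p\<in>{1..m}. if p = k then of_bool P * (a k * b (k + 1)) else 0)"
    unfolding bform_def by (intro sum.cong refl)
  also have "\<dots> = of_bool P * (a k * b (k + 1))"
    using assms by simp linarith
  finally show ?thesis .
qed

section \<open>Powers of a cyclic group and of its group algebra\<close>

abbreviation Zpow :: "nat \<Rightarrow> nat \<Rightarrow> (nat \<Rightarrow> int) monoid"
  where "Zpow n m \<equiv> product_group {1..m} (\<lambda>_. integer_mod_group n)"

lemma comm_group_Zpow: "comm_group (Zpow n m)"
proof -
  interpret group "Zpow n m" by simp
  show ?thesis
    by (rule group_comm_groupI) (auto simp: add.commute)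
qed

lemma group_hopf_algebra_cyclic_power:
  "group_hopf_algebra (Zpow n m) (cyclic_power n m :: (nat \<Rightarrow> int, 'k::field) hopf_data)"
proof -
  interpret group "Zpow n m" by simp
  interpret Z: group_hopf_algebra "integer_mod_group n" "group_hopf (integer_mod_group n) :: (int, 'k) hopf_data"
    by (rule group_hopf_algebra_group_hopf) simp
  let ?R = "cyclic_power n m :: (nat \<Rightarrow> int, 'k) hopf_data"
  show ?thesis
  proof (intro group_hopf_algebra.intro group_hopf_algebra_axioms.intro is_group)
    show "vbasis ?R = carrier (Zpow n m)"
      by (simp add: hopf_power_def Z.vbasis_eq)
    show "plinear (\<lambda>x. x \<bullet>\<^bsub>?R\<^esub> y)" "plinear (amult ?R y)" for y
      unfolding hopf_power_def alg_data.simps by (rule plinear_bilin_ext)+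
    show "plinear (comult ?R)" "plinear (antipode ?R)"
      unfolding hopf_power_def hopf_data.simps by (rule plinear_lin_ext)+
    show "plinear_form (counit ?R)"
      unfolding hopf_power_def hopf_data.simps by (rule plinear_form_sum)
    show "aone ?R = bvec \<one>\<^bsub>Zpow n m\<^esub>"
      by (simp add: hopf_power_def Z.one_eq mtens_bvec del: single_one)
    fix f assume f: "f \<in> carrier (Zpow n m)"
    then have r: "restrict f {1..m} = f" by (auto simp: PiE_restrict)
    have d: "comult (group_hopf (integer_mod_group n)) (bvec k :: int \<Rightarrow>\<^sub>0 'k) = bvec (k, k)"
      "antipode (group_hopf (integer_mod_group n)) (bvec k :: int \<Rightarrow>\<^sub>0 'k) = bvec (inv\<^bsub>integer_mod_group n\<^esub> k)"
      "counit (group_hopf (integer_mod_group n)) (bvec k :: int \<Rightarrow>\<^sub>0 'k) = 1"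
      "(bvec k :: int \<Rightarrow>\<^sub>0 'k) \<bullet>\<^bsub>group_hopf (integer_mod_group n)\<^esub> bvec l = bvec (k \<otimes>\<^bsub>integer_mod_group n\<^esub> l)"
      for k l
      unfolding group_hopf_def alg_data.simps hopf_data.simps by (simp_all add: lin_ext_single)
    \<comment> \<open>The coproduct first yields the function sending \<open>i\<close> to
      \<open>(f i, f i)\<close>; regrouping its components returns the pair
      \<open>(f, f)\<close>.\<close>
    have p: "restrict (fst \<circ> (\<lambda>i\<in>{1..m}. (f i, f i))) {1..m} = f"
      "restrict (snd \<circ> (\<lambda>i\<in>{1..m}. (f i, f i))) {1..m} = f"
      by (rule trans[OF _ r], rule restrict_ext, simp)+
    show "comult ?R (bvec f) = bvec (f, f)"
      unfolding hopf_power_def hopf_data.simps lin_ext_single d mtens_bvec p ..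
    show "counit ?R (bvec f) = 1"
      unfolding hopf_power_def hopf_data.simps d by simp
    show "antipode ?R (bvec f) = bvec (inv\<^bsub>Zpow n m\<^esub> f)"
      unfolding hopf_power_def hopf_data.simps lin_ext_single d mtens_bvec
      by (subst inv_product_group) (use f in simp_all)
    fix g
    show "bvec f \<bullet>\<^bsub>?R\<^esub> bvec g = bvec (f \<otimes>\<^bsub>Zpow n m\<^esub> g)"
      unfolding hopf_power_def alg_data.simps bilin_bvec d mtens_bvec mult_product_group ..
  qed
qed

section \<open>The cocycle of the symmetric group\<close>

locale cyclic_sym =
  fixes n m :: nat and q :: "'k::field_char_0"
  assumes n2: "n \<ge> 2" and q_n: "q ^ n = 1" and q_prim: "\<And>k. 0 < k \<Longrightarrow> k < n \<Longrightarrow> q ^ k \<noteq> 1"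
begin

abbreviation A where "A \<equiv> Zpow n m"

lemma carrier_A: "carrier A = PiE {1..m} (\<lambda>_. {0..<int n})"
  using n2 by (simp add: carrier_integer_mod_group)

lemma carrier_A_bounds: "a \<in> carrier A \<Longrightarrow> i \<in> {1..m} \<Longrightarrow> 0 \<le> a i \<and> a i < int n"
  unfolding carrier_A by (auto dest: PiE_mem)

lemma mult_A: "f \<otimes>\<^bsub>A\<^esub> h = (\<lambda>i\<in>{1..m}. (f i + h i) mod int n)"
  by simp

interpretation A: comm_group A by (rule comm_group_Zpow)

lemma q_nonzero: "q \<noteq> 0"
  using q_n n2 by (auto simp: power_0_left)

lemma powi_add: "q powi (x + y) = q powi x * q powi y"
  using q_nonzero by (simp add: power_int_add)

text \<open>Powers of \<open>q\<close> depend only on residues, so integer forms need to be compared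
  only modulo \<open>n\<close>.\<close>

lemma powi_cong: "[x = y] (mod int n) \<Longrightarrow> q powi x = q powi y"
proof -
  have "q powi (x + int n * k) = q powi x" for x k
    using q_n by (simp add: powi_add power_int_mult power_int_of_nat)
  moreover assume "[x = y] (mod int n)"
  then obtain k where "y = x + int n * k" by (metis cong_iff_lin)
  ultimately show ?thesis by simp
qed

lemma powi_eq_1: "0 \<le> x \<Longrightarrow> x < int n \<Longrightarrow> q powi x = 1 \<Longrightarrow> x = 0"
  using q_prim[of "nat x"] by (cases "x = 0") (auto simp: power_int_def)

definition \<chi> :: "(nat \<Rightarrow> int) \<Rightarrow> (nat \<Rightarrow> int) \<Rightarrow> 'k"
  where "\<chi> a f = q powi (\<Sum>i\<in>{1..m}. a i * f i)"

definition J :: "(nat \<Rightarrow> nat) \<Rightarrow> (nat \<Rightarrow> int) \<Rightarrow> (nat \<Rightarrow> int) \<Rightarrow> 'k"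
  where "J w a b = q powi bform m (inversion w) a b"

definition g :: "(nat \<Rightarrow> nat) \<Rightarrow> (nat \<Rightarrow> nat) \<Rightarrow> (nat \<Rightarrow> int) \<Rightarrow> 'k"
  where "g w v a = q powi bform m (undone w v) a a"

lemma comp_closed: "w permutes {1..m} \<Longrightarrow> a \<in> carrier A \<Longrightarrow> a \<circ> w \<in> carrier A"
  using permutes_in_image[of w "{1..m}"] permutes_not_in[of w "{1..m}"]
  unfolding carrier_A by (simp add: PiE_iff extensional_def)

lemma inv_sym: "w permutes {1..m} \<Longrightarrow> inv\<^bsub>sym_group m\<^esub> w = inv' w"
  by (rule group.inv_equality[OF sym_group_is_group])
    (auto simp: sym_group_def permutes_inv permutes_inv_o)

lemma mult_A_cong: "i \<in> {1..m} \<Longrightarrow> [(f \<otimes>\<^bsub>A\<^esub> h) i = f i + h i] (mod int n)"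
  by (simp add: cong_def)

lemma J_mult_right: "J w a (b \<otimes>\<^bsub>A\<^esub> c) = J w a b * J w a c"
proof -
  have "J w a (b \<otimes>\<^bsub>A\<^esub> c) = q powi bform m (inversion w) a (\<lambda>i. b i + c i)"
    unfolding J_def by (intro powi_cong bform_cong cong_refl mult_A_cong)
  then show ?thesis by (simp add: J_def bform_add powi_add)
qed

sublocale bicrossed A "sym_group m" "cyclic_power n m" "\<lambda>w a. a \<circ> w" perm_act \<chi> J g
proof (intro bicrossed.intro bicrossed_axioms.intro comm_group_Zpow sym_group_is_group
    group_hopf_algebra_cyclic_power)
  show "finite (carrier A)" unfolding carrier_A by (simp add: finite_PiE)
  show "finite (carrier (sym_group m))" by (simp add: sym_group_def finite_permutations)
  fix w v u a b c f h
  assume a: "a \<in> carrier A"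
  show "\<chi> a h \<noteq> 0" "J w a b \<noteq> 0" "g w v a \<noteq> 0" using q_nonzero by (auto simp: \<chi>_def J_def g_def)
  show "\<chi> a f = \<chi> f a" by (simp add: \<chi>_def mult.commute)
  show "\<chi> a (f \<otimes>\<^bsub>A\<^esub> h) = \<chi> a f * \<chi> a h"
  proof -
    have "\<chi> a (f \<otimes>\<^bsub>A\<^esub> h) = q powi (\<Sum>i\<in>{1..m}. a i * (f i + h i))"
      unfolding \<chi>_def by (intro powi_cong cong_sum cong_mult cong_refl mult_A_cong)
    then show ?thesis by (simp add: \<chi>_def powi_add[symmetric] algebra_simps sum.distrib)
  qed
  show "J w (a \<otimes>\<^bsub>A\<^esub> b) c = J w a c * J w b c"
  proof -
    have "J w (a \<otimes>\<^bsub>A\<^esub> b) c = q powi bform m (inversion w) (\<lambda>i. a i + b i) c"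
      unfolding J_def by (intro powi_cong bform_cong cong_refl mult_A_cong)
    then show ?thesis by (simp add: J_def bform_add powi_add)
  qed
  show "J w a (b \<otimes>\<^bsub>A\<^esub> c) = J w a b * J w a c" by (rule J_mult_right)
  show "a \<circ> \<one>\<^bsub>sym_group m\<^esub> = a" "g \<one>\<^bsub>sym_group m\<^esub> w a = 1" "g w \<one>\<^bsub>sym_group m\<^esub> a = 1"
    by (simp_all add: sym_group_one g_def undone_id bform_def)
  show "a = \<one>\<^bsub>A\<^esub>" if 1: "\<And>f. f \<in> carrier A \<Longrightarrow> \<chi> a f = 1"
  proof -
    have "a i = 0" if i: "i \<in> {1..m}" for i
    proof -
      \<comment> \<open>Unit vectors detect the coordinates of \<open>a\<close>; as
        \<open>a i\<close> is a residue between 0 and \<open>n - 1\<close>, primitivity of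
        \<open>q\<close> forces it to vanish.\<close>
      have "(\<lambda>j\<in>{1..m}. if j = i then 1 else 0) \<in> carrier A"
        unfolding carrier_A using n2 by auto
      then have q: "q powi (\<Sum>j\<in>{1..m}. a j * (\<lambda>j\<in>{1..m}. if j = i then 1 else 0) j) = 1"
        using 1 unfolding \<chi>_def by blast
      have "(\<Sum>j\<in>{1..m}. a j * (\<lambda>j\<in>{1..m}. if j = i then 1 else 0) j) = (\<Sum>j\<in>{1..m}. if j = i then a i else 0)"
        by (intro sum.cong) auto
      then have "(\<Sum>j\<in>{1..m}. a j * (\<lambda>j\<in>{1..m}. if j = i then 1 else 0) j) = a i"
        using i by simp
      with q show ?thesis using powi_eq_1[of "a i"] a i unfolding carrier_A by (auto simp: PiE_iff)
    qed
    then show ?thesis using a unfolding carrier_A by (auto simp: PiE_iff extensional_def fun_eq_iff)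
  qed
  assume "w \<in> carrier (sym_group m)"
  then have w: "w permutes {1..m}" by (simp add: sym_group_carrier)
  show "a \<circ> w \<in> carrier A" by (rule comp_closed[OF w a])
  show "(a \<otimes>\<^bsub>A\<^esub> b) \<circ> w = (a \<circ> w) \<otimes>\<^bsub>A\<^esub> (b \<circ> w)"
    using permutes_in_image[OF w] by (auto simp: fun_eq_iff)
  show "\<chi> (a \<circ> w) (f \<circ> w) = \<chi> a f"
    unfolding \<chi>_def using sum.permute[OF w, of "\<lambda>i. a i * f i"] by (simp add: comp_def)
  \<comment> \<open>Every inversion of \<open>w\<close> is undone by its inverse, so
    \<open>g\<close> at this pair is \<open>J w a a\<close>, which cancels against \<open>J\<close>
    at the inverse of \<open>a\<close>.\<close>
  have "J w a a * J w a (inv\<^bsub>A\<^esub> a) = 1"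
    unfolding J_mult_right[symmetric] A.r_inv[OF a] one_product_group by (simp add: J_def bform_def)
  then show "g w (inv\<^bsub>sym_group m\<^esub> w) a * J w a (inv\<^bsub>A\<^esub> a) = 1"
    using w by (simp add: inv_sym g_def undone_inv J_def)
  show "perm_act w (bvec f :: _ \<Rightarrow>\<^sub>0 'k) = bvec (f \<circ> inv\<^bsub>sym_group m\<^esub> w)"
    using w by (simp add: perm_act_def lin_ext_single inv_sym)
  assume "v \<in> carrier (sym_group m)"
  then have v: "v permutes {1..m}" by (simp add: sym_group_carrier)
  show "a \<circ> w \<circ> v = a \<circ> (w \<otimes>\<^bsub>sym_group m\<^esub> v)"
    by (simp add: sym_group_mult comp_assoc)
  show "g w v (a \<otimes>\<^bsub>A\<^esub> b) * J (w \<otimes>\<^bsub>sym_group m\<^esub> v) a b =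
      g w v a * g w v b * J w a b * J v (a \<circ> w) (b \<circ> w)"
  proof -
    \<comment> \<open>The product in \<open>A\<close> reduces coordinates modulo \<open>n\<close>,
      which powers of \<open>q\<close> do not see; afterwards \<open>undone_coboundary\<close>
      applies to honest sums.\<close>
    have "g w v (a \<otimes>\<^bsub>A\<^esub> b) = q powi bform m (undone w v) (\<lambda>i. a i + b i) (\<lambda>i. a i + b i)"
      unfolding g_def by (intro powi_cong bform_cong mult_A_cong)
    then show ?thesis
      using undone_coboundary[OF w v, of a b]
      by (simp add: g_def J_def sym_group_mult powi_add[symmetric] add.assoc)
  qed
  assume "u \<in> carrier (sym_group m)"
  then have u: "u permutes {1..m}" by (simp add: sym_group_carrier)
  show "g w v a * g (w \<otimes>\<^bsub>sym_group m\<^esub> v) u a = g v u (a \<circ> w) * g w (v \<otimes>\<^bsub>sym_group m\<^esub> u) a"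
    using undone_cocycle[OF w v u, of a] by (simp add: g_def sym_group_mult powi_add[symmetric])
qed (simp_all add: perm_act_def)

section \<open>Simple transpositions and the generators of the cyclic factors\<close>

lemma adj_permutes: "k \<in> {1..m - 1} \<Longrightarrow> adj k permutes {1..m}"
  by (rule permutes_swap_id) auto

lemma adj_in_sym: "k \<in> {1..m - 1} \<Longrightarrow> adj k \<in> carrier (sym_group m)"
  by (simp only: sym_group_carrier adj_permutes)

lemma inv_adj: "inv' (adj k) = adj k"
  by (rule inv_unique_comp) simp_all

lemma J_adj: "k \<in> {1..m - 1} \<Longrightarrow> J (adj k) a b = q powi (a k * b (k + 1))"
  unfolding J_def inversion_adj using bform_delta[of k m True a b] by simp

text \<open>The only inversion of \<open>adj k\<close> is undone by \<open>v\<close> exactly when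
  left multiplication by \<open>adj k\<close> shortens \<open>v\<close>.\<close>

lemma g_adj: "k \<in> {1..m - 1} \<Longrightarrow>
    g (adj k) v a = (if inv' v (k + 1) < inv' v k then q powi (a k * a (k + 1)) else 1)"
  unfolding g_def undone_adj by (subst bform_delta) auto

definition gen :: "nat \<Rightarrow> nat \<Rightarrow> int"
  where "gen i = (\<lambda>j\<in>{1..m}. if j = i then 1 else 0)"

lemma gen_closed: "gen i \<in> carrier A"
  unfolding carrier_A gen_def using n2 by auto

lemma \<chi>_gen: "i \<in> {1..m} \<Longrightarrow> \<chi> a (gen i) = q powi a i"
proof -
  assume i: "i \<in> {1..m}"
  have "(\<Sum>j\<in>{1..m}. a j * gen i j) = (\<Sum>j\<in>{1..m}. if j = i then a i else 0)"
    unfolding gen_def by (intro sum.cong) auto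
  then show ?thesis using i by (simp add: \<chi>_def)
qed

lemma \<chi>_pow: "a \<in> carrier A \<Longrightarrow> f \<in> carrier A \<Longrightarrow> \<chi> a (f [^]\<^bsub>A\<^esub> (k :: nat)) = \<chi> a f ^ k"
proof (induction k)
  case 0
  then show ?case using \<chi>_one(1)[of a] by (simp only: A.nat_pow_0 power_0)
next
  case (Suc k)
  then show ?case using \<chi>_mult[of a "f [^]\<^bsub>A\<^esub> k" f] by (simp only: A.nat_pow_Suc A.nat_pow_closed power_Suc2)
qed

lemma pow_A: "f [^]\<^bsub>A\<^esub> (k :: nat) = (\<lambda>i\<in>{1..m}. (int k * f i) mod int n)"
proof (induction k)
  case 0
  show ?case by (simp only: A.nat_pow_0) simp
next
  case (Suc k)
  have "f [^]\<^bsub>A\<^esub> Suc k = (\<lambda>i\<in>{1..m}. ((f [^]\<^bsub>A\<^esub> k) i + f i) mod int n)"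
    by (simp only: A.nat_pow_Suc mult_A)
  also have "\<dots> = (\<lambda>i\<in>{1..m}. (int (Suc k) * f i) mod int n)"
    unfolding Suc.IH by (rule restrict_ext) (simp add: mod_simps algebra_simps)
  finally show ?case .
qed

text \<open>Fourier inversion on residues modulo \<open>n\<close>: the sum over \<open>i\<close> is
  geometric with ratio \<open>q powi (s - j)\<close> and vanishes unless \<open>j = s\<close>. This
  expands the values of \<open>g\<close> and \<open>J\<close> at a simple transposition into
  characters.\<close>

lemma sum_powi:
  assumes "0 \<le> s" "s < int n" "0 \<le> t" "t < int n"
  shows "(\<Sum>i=0..n-1. \<Sum>j=0..n-1. (1 / of_nat n * q powi (- int (i * j))) * ((q powi s) ^ i * (q powi t) ^ j)) =
    q powi (s * t)"
proof -
  have geom: "(\<Sum>i=0..n-1. (q powi (s - int j)) ^ i) = (if int j = s then of_nat n else 0)" if j: "j \<in> {0..n-1}" for j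
  proof (cases "int j = s")
    case True
    then show ?thesis using n2 by simp
  next
    case False
    have "int j < int n" using j n2 by auto
    \<comment> \<open>Both numbers lie between 0 and \<open>n - 1\<close>, so a difference divisible
      by \<open>n\<close> would be 0.\<close>
    then have "\<not> int n dvd s - int j"
      using False assms(1,2) dvd_imp_le_int[of "s - int j" "int n"] by auto
    then have "(s - int j) mod int n \<noteq> 0" by (simp add: dvd_eq_mod_eq_0)
    moreover have "q powi (s - int j) = q powi ((s - int j) mod int n)"
      by (rule powi_cong) (simp add: cong_def)
    ultimately have ne: "q powi (s - int j) \<noteq> 1"
      using powi_eq_1[of "(s - int j) mod int n"] n2 by auto
    have "(q powi (s - int j)) ^ n = q powi ((s - int j) * int n)"
      by (simp only: power_int_mult power_int_of_nat)
    also have "\<dots> = (q ^ n) powi (s - int j)"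
      by (simp only: mult.commute[of "s - int j"] power_int_mult power_int_of_nat)
    finally have "(q powi (s - int j)) ^ n = 1" using q_n by simp
    moreover have "{0..n-1} = {..<n}" using n2 by auto
    ultimately show ?thesis using geometric_sum[OF ne, of n] False by simp
  qed
  have "(\<Sum>i=0..n-1. \<Sum>j=0..n-1. (1 / of_nat n * q powi (- int (i * j))) * ((q powi s) ^ i * (q powi t) ^ j)) =
    (\<Sum>j=0..n-1. \<Sum>i=0..n-1. (1 / of_nat n * q powi (- int (i * j))) * ((q powi s) ^ i * (q powi t) ^ j))"
    by (rule sum.swap)
  also have "\<dots> = (\<Sum>j=0..n-1. 1 / of_nat n * q powi (t * int j) * (\<Sum>i=0..n-1. (q powi (s - int j)) ^ i))"
    unfolding sum_distrib_left
  proof (intro sum.cong refl)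
    fix i j
    have "q powi (- int (i * j)) * ((q powi s) ^ i * (q powi t) ^ j) = q powi (- int (i * j) + (s * int i + t * int j))"
      by (simp only: powi_add power_int_mult power_int_of_nat)
    also have "\<dots> = q powi (t * int j + (s - int j) * int i)"
      by (rule arg_cong[where f = "power_int q"]) (simp add: algebra_simps)
    also have "\<dots> = q powi (t * int j) * (q powi (s - int j)) ^ i"
      by (simp only: powi_add power_int_mult power_int_of_nat)
    finally show "1 / of_nat n * q powi (- int (i * j)) * ((q powi s) ^ i * (q powi t) ^ j) =
      1 / of_nat n * q powi (t * int j) * (q powi (s - int j)) ^ i" by (simp only: mult.assoc)
  qed
  also have "\<dots> = (\<Sum>j=0..n-1. if j = nat s then q powi (t * int j) else 0)"
    using n2 by (intro sum.cong refl) (subst geom, use assms in auto)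
  also have "\<dots> = q powi (s * t)"
    using assms n2 by (auto simp: mult.commute)
  finally show ?thesis .
qed

lemma gen_pow_n: "gen i [^]\<^bsub>A\<^esub> n = \<one>\<^bsub>A\<^esub>"
  unfolding pow_A by simp

section \<open>Relations between the generators\<close>

lemma zz_closed: "w permutes {1..m} \<Longrightarrow> zz w \<in> acarrier H"
  unfolding zz_eq_bvec vbasis_H bvec_in by (simp only: SigmaI A.one_closed sym_group_carrier mem_Sigma_iff simp_thms)

text \<open>If the inversion of \<open>adj k\<close> is not undone, the cocycle is trivial; the
  elements \<open>zz\<close> thus multiply as in the group as long as lengths add.\<close>

lemma zz_adj_mult:
  assumes "k \<in> {1..m - 1}" "\<not> inv' v (k + 1) < inv' v k"
  shows "zz (adj k) \<bullet>\<^bsub>H\<^esub> zz v = zz (adj k \<circ> v)"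
  using zz_mult_trivial[OF adj_in_sym[OF assms(1)], of v] assms by (simp only: g_adj sym_group_mult if_False)

lemma zz_adj_commute:
  assumes "k \<in> {1..m - 1}" "l \<in> {1..m - 1}" "\<bar>int k - int l\<bar> > 1"
  shows "zz (adj k) \<bullet>\<^bsub>H\<^esub> zz (adj l) = zz (adj l) \<bullet>\<^bsub>H\<^esub> zz (adj k)"
proof -
  have "adj k \<circ> adj l = adj l \<circ> adj k"
    using assms(3) by (auto simp: fun_eq_iff transpose_def)
  moreover have "\<not> adj l (k + 1) < adj l k" "\<not> adj k (l + 1) < adj k l"
    using assms(3) by (auto simp: transpose_def)
  ultimately show ?thesis using assms(1,2) by (simp only: zz_adj_mult inv_adj not_False_eq_True)
qed

text \<open>Both sides are products along reduced words of one permutation, so no cocycle factor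
  appears.\<close>

lemma zz_adj_braid:
  assumes "k \<in> {1..m - 2}"
  shows "zz (adj k) \<bullet>\<^bsub>H\<^esub> zz (adj (k + 1)) \<bullet>\<^bsub>H\<^esub> zz (adj k) =
    zz (adj (k + 1)) \<bullet>\<^bsub>H\<^esub> zz (adj k) \<bullet>\<^bsub>H\<^esub> zz (adj (k + 1))"
proof -
  interpret HH: hopf_algebra H by (rule hopf_H)
  have k: "k \<in> {1..m - 1}" "k + 1 \<in> {1..m - 1}" using assms by auto
  have b: "inv' (adj i) (j + 1) < inv' (adj i) j \<longleftrightarrow> i = j" for i j
    unfolding inv_adj by (auto simp: transpose_def)
  have i: "inv' (adj i \<circ> adj j) = adj j \<circ> adj i" for i j
    by (rule inv_unique_comp) (simp_all add: fun_eq_iff)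
  have c: "\<not> (adj k \<circ> adj (k + 1)) (k + 1) < (adj k \<circ> adj (k + 1)) k"
    "\<not> (adj (k + 1) \<circ> adj k) (k + 1 + 1) < (adj (k + 1) \<circ> adj k) (k + 1)"
    by (auto simp: transpose_def)
  note cl = zz_closed[OF adj_permutes[OF k(1)]] zz_closed[OF adj_permutes[OF k(2)]]
  have "zz (adj (k + 1)) \<bullet>\<^bsub>H\<^esub> zz (adj k) = zz (adj (k + 1) \<circ> adj k)"
    "zz (adj k) \<bullet>\<^bsub>H\<^esub> zz (adj (k + 1)) = zz (adj k \<circ> adj (k + 1))"
    using zz_adj_mult[OF k(2), of "adj k", unfolded b] zz_adj_mult[OF k(1), of "adj (k + 1)", unfolded b]
    by simp_all
  moreover have "zz (adj k) \<bullet>\<^bsub>H\<^esub> zz (adj (k + 1) \<circ> adj k) = zz (adj k \<circ> (adj (k + 1) \<circ> adj k))"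
    using zz_adj_mult[OF k(1), of "adj (k + 1) \<circ> adj k", unfolded i, OF c(1)] .
  moreover have "zz (adj (k + 1)) \<bullet>\<^bsub>H\<^esub> zz (adj k \<circ> adj (k + 1)) = zz (adj (k + 1) \<circ> (adj k \<circ> adj (k + 1)))"
    using zz_adj_mult[OF k(2), of "adj k \<circ> adj (k + 1)", unfolded i, OF c(2)] .
  moreover have "adj k \<circ> (adj (k + 1) \<circ> adj k) = adj (k + 1) \<circ> (adj k \<circ> adj (k + 1))"
    by (auto simp: fun_eq_iff transpose_def)
  \<comment> \<open>Brackets are moved to the right so that each step multiplies on the left by a
    simple transposition.\<close>
  ultimately show ?thesis
    unfolding HH.mult_assoc[OF cl(1,2,1)] HH.mult_assoc[OF cl(2,1,2)] by (simp only:)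
qed

text \<open>The transposition undoes its own inversion, so \<open>g\<close> takes the value
  \<open>q powi (a k * a (k + 1))\<close>, to which \<open>sum_powi\<close> applies.\<close>

lemma zz_adj_square:
  assumes "k \<in> {1..m - 1}"
  shows "zz (adj k) \<bullet>\<^bsub>H\<^esub> zz (adj k) = (1 / of_nat n) *\<^sub>p (\<Sum>i=0..n-1. \<Sum>j=0..n-1.
    (q powi (- int (i * j))) *\<^sub>p (apow H (\<iota> (bvec (gen k))) i \<bullet>\<^bsub>H\<^esub> apow H (\<iota> (bvec (gen (k + 1)))) j))"
proof -
  have k: "k \<in> {1..m}" "k + 1 \<in> {1..m}" using assms by auto
  have "g (adj k) (adj k) a = (\<Sum>i=0..n-1. \<Sum>j=0..n-1. (1 / of_nat n * q powi (- int (i * j))) *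
      \<chi> a (gen k [^]\<^bsub>A\<^esub> i \<otimes>\<^bsub>A\<^esub> gen (k + 1) [^]\<^bsub>A\<^esub> j))" if a: "a \<in> carrier A" for a
  proof -
    have "0 \<le> a k" "a k < int n" "0 \<le> a (k + 1)" "a (k + 1) < int n"
      using carrier_A_bounds[OF a k(1)] carrier_A_bounds[OF a k(2)] by simp_all
    moreover have "\<chi> a (gen k [^]\<^bsub>A\<^esub> i \<otimes>\<^bsub>A\<^esub> gen (k + 1) [^]\<^bsub>A\<^esub> j) = (q powi a k) ^ i * (q powi a (k + 1)) ^ j" for i j
      using \<chi>_mult[of a "gen k [^]\<^bsub>A\<^esub> i" "gen (k + 1) [^]\<^bsub>A\<^esub> j"] a k
      by (simp only: A.nat_pow_closed gen_closed \<chi>_pow \<chi>_gen)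
    ultimately show ?thesis
      using assms by (simp only: sum_powi g_adj) (simp add: inv_adj)
  qed
  moreover have "inv\<^bsub>sym_group m\<^esub> adj k = adj k" using assms by (simp only: inv_sym adj_permutes inv_adj)
  ultimately have "zz (adj k) \<bullet>\<^bsub>H\<^esub> zz (adj k) = (\<Sum>i=0..n-1. \<Sum>j=0..n-1. (1 / of_nat n * q powi (- int (i * j))) *\<^sub>p
      \<iota> (bvec (gen k [^]\<^bsub>A\<^esub> i \<otimes>\<^bsub>A\<^esub> gen (k + 1) [^]\<^bsub>A\<^esub> j)))"
    by (intro zz_square_bvec adj_in_sym assms A.m_closed A.nat_pow_closed gen_closed)
  then show ?thesis
    by (simp only: pm.scale_sum_right pm.scale_scale apow_\<iota>_bvec gen_closed \<iota>_bvec_mult A.nat_pow_closed)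
qed

text \<open>The expansion is the one used for the square, but \<open>J\<close> has independent
  arguments, so the two characters fall into different tensor factors.\<close>

lemma comult_zz_adj:
  assumes "k \<in> {1..m - 1}"
  shows "comult H (zz (adj k)) = ((1 / of_nat n) *\<^sub>p (\<Sum>i=0..n-1. \<Sum>j=0..n-1.
    (q powi (- int (i * j))) *\<^sub>p (apow H (\<iota> (bvec (gen k))) i \<boxtimes> apow H (\<iota> (bvec (gen (k + 1)))) j)))
    \<bullet>\<^bsub>tensor_alg H H\<^esub> (zz (adj k) \<boxtimes> zz (adj k))"
proof -
  have k: "k \<in> {1..m}" "k + 1 \<in> {1..m}" using assms by auto
  have "J (adj k) a b = (\<Sum>i=0..n-1. \<Sum>j=0..n-1. (1 / of_nat n * q powi (- int (i * j))) *
      (\<chi> a (gen k [^]\<^bsub>A\<^esub> i) * \<chi> b (gen (k + 1) [^]\<^bsub>A\<^esub> j)))"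
    if a: "a \<in> carrier A" and b: "b \<in> carrier A" for a b
  proof -
    have "0 \<le> a k" "a k < int n" "0 \<le> b (k + 1)" "b (k + 1) < int n"
      using carrier_A_bounds[OF a k(1)] carrier_A_bounds[OF b k(2)] by simp_all
    then show ?thesis
      using assms a b k by (simp only: sum_powi J_adj \<chi>_pow \<chi>_gen gen_closed)
  qed
  then have "comult H (zz (adj k)) = (\<Sum>i=0..n-1. \<Sum>j=0..n-1. (1 / of_nat n * q powi (- int (i * j))) *\<^sub>p
      (\<iota> (bvec (gen k [^]\<^bsub>A\<^esub> i)) \<boxtimes> \<iota> (bvec (gen (k + 1) [^]\<^bsub>A\<^esub> j)))) \<bullet>\<^bsub>tensor_alg H H\<^esub> (zz (adj k) \<boxtimes> zz (adj k))"
    by (intro comult_zz_bvec adj_in_sym assms A.nat_pow_closed gen_closed)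
  then show ?thesis
    by (simp only: pm.scale_sum_right pm.scale_scale apow_\<iota>_bvec gen_closed A.nat_pow_closed)
qed

lemma zz_adj_gen:
  assumes "k \<in> {1..m - 1}" "i \<in> {1..m}"
  shows "zz (adj k) \<bullet>\<^bsub>H\<^esub> \<iota> (bvec (gen i)) = \<iota> (bvec (gen (adj k i))) \<bullet>\<^bsub>H\<^esub> zz (adj k)"
proof -
  \<comment> \<open>Precomposition moves a unit vector by the inverse permutation, and a
    transposition is its own inverse.\<close>
  have "gen i \<circ> adj k = gen (adj k i)"
  proof
    fix j
    have "adj k j = i \<longleftrightarrow> j = adj k i" by (metis transpose_involutory)
    then show "(gen i \<circ> adj k) j = gen (adj k i) j"
      unfolding gen_def comp_def restrict_def permutes_in_image[OF adj_permutes[OF assms(1)]]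
      by (simp only:)
  qed
  then show ?thesis
    using zz_mult_\<iota>_bvec[OF adj_in_sym[OF assms(1)] gen_closed[of i]] assms(1)
    by (simp only: inv_sym adj_permutes inv_adj)
qed

section \<open>Generation and dimension\<close>

text \<open>Induction on the sum of the exponents, splitting off one generator at a time.\<close>

lemma gen_generates:
  assumes U: "is_subalg U H" and gen: "\<And>i. i \<in> {1..m} \<Longrightarrow> \<iota> (bvec (gen i)) \<in> U" and f: "f \<in> carrier A"
  shows "\<iota> (bvec f) \<in> U"
  using f
proof (induction "\<Sum>i\<in>{1..m}. nat (f i)" arbitrary: f rule: less_induct)
  case less
  show ?case
  proof (cases "\<forall>i\<in>{1..m}. f i = 0")
    case True
    then have "f = \<one>\<^bsub>A\<^esub>" using less.prems unfolding carrier_A by (auto simp: PiE_iff extensional_def fun_eq_iff)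
    then have "\<iota> (bvec f) = aone H" by (simp only: R.one_eq[symmetric] \<iota>_one)
    then show ?thesis using U by (simp add: is_subalg_def)
  next
    case False
    then obtain i where i: "i \<in> {1..m}" "f i > 0"
      using less.prems unfolding carrier_A by (force simp: PiE_iff)
    define h where "h = f(i := f i - 1)"
    have h: "h \<in> carrier A"
    proof -
      have "0 \<le> f i - 1 \<and> f i - 1 < int n" using i carrier_A_bounds[OF less.prems i(1)] by linarith
      then show ?thesis using less.prems i unfolding carrier_A h_def by (simp add: PiE_iff extensional_def)
    qed
    \<comment> \<open>Restoring the exponent does not wrap around, since \<open>f i\<close> is below
      \<open>n\<close>.\<close>
    have "h \<otimes>\<^bsub>A\<^esub> gen i = f"
    proof
      fix j show "(h \<otimes>\<^bsub>A\<^esub> gen i) j = f j"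
        using less.prems i unfolding mult_A carrier_A h_def gen_def
        by (cases "j \<in> {1..m}") (auto simp: PiE_iff extensional_def)
    qed
    moreover have "(\<Sum>i\<in>{1..m}. nat (h i)) < (\<Sum>i\<in>{1..m}. nat (f i))"
      by (rule sum_strict_mono_ex1) (use i in \<open>auto simp: h_def\<close>)
    then have "\<iota> (bvec h) \<in> U" using less.hyps h by blast
    ultimately show ?thesis
      using U gen[OF i(1)] \<iota>_bvec_mult[OF h gen_closed[of i]] unfolding is_subalg_def by metis
  qed
qed

text \<open>Closure under composition inside \<open>zz\<close> reduces the claim to the generation
  of the symmetric group by simple transpositions.\<close>

lemma adj_generates:
  assumes U: "is_subalg U H" "\<iota> ` acarrier (cyclic_power n m) \<subseteq> U"
    and adj: "\<And>k. k \<in> {1..m - 1} \<Longrightarrow> zz (adj k) \<in> U" and w: "w permutes {1..m}"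
  shows "zz w \<in> U"
proof -
  have mult: "zz (w \<circ> v) \<in> U" if "w permutes {1..m}" "v permutes {1..m}" "zz w \<in> U" "zz v \<in> U" for w v
    using subalg_zz_mult[OF U, of w v] that by (simp only: sym_group_carrier sym_group_mult)
  \<comment> \<open>Induction on the distance of the two entries; \<open>d = 0\<close> is the simple
    case.\<close>
  have tr: "zz (Transposition.transpose a (a + 1 + d)) \<in> U" if "1 \<le> a" "a + 1 + d \<le> m" for a d
    using that
  proof (induction d)
    case 0
    then have "a \<in> {1..m - 1}" by auto
    then show ?case using adj[of a] by simp
  next
    case (Suc d)
    let ?b = "a + 1 + d"
    have b: "?b \<in> {1..m - 1}" using Suc.prems by auto
    have t: "Transposition.transpose a ?b permutes {1..m}"
      by (rule permutes_swap_id) (use Suc.prems in auto)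
    \<comment> \<open>Conjugation by \<open>adj ?b\<close> moves the upper entry of the
      transposition from \<open>?b\<close> to its successor.\<close>
    have "adj ?b \<circ> (Transposition.transpose a ?b \<circ> adj ?b) = Transposition.transpose a (a + 1 + Suc d)"
      by (auto simp: fun_eq_iff transpose_def)
    moreover have "zz (adj ?b \<circ> (Transposition.transpose a ?b \<circ> adj ?b)) \<in> U"
      using Suc by (intro mult adj b adj_permutes t permutes_compose) auto
    ultimately show ?case by simp
  qed
  have tr': "zz (Transposition.transpose a b) \<in> U" if "a \<in> {1..m}" "b \<in> {1..m}" "a < b" for a b
  proof -
    from \<open>a < b\<close> obtain d where "b = a + 1 + d" using less_iff_Suc_add by auto
    then show ?thesis using tr[of a d] that by simp
  qed
  show ?thesis
    using w finite_atLeastAtMost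
  proof (induction rule: permutes_induct)
    case id
    have "zz id = aone H" using \<iota>_one by (simp only: zz_def \<iota>_def sym_group_one)
    then show ?case using U(1) by (simp only: is_subalg_def)
  next
    case (swap a b p)
    have "zz (Transposition.transpose a b) \<in> U"
      using swap tr'[of a b] tr'[of b a] by (metis linorder_neqE_nat transpose_commute)
    then show ?case using swap by (intro mult permutes_swap_id)
  qed
qed

lemma gen_subalg_H:
  "gen_subalg H ((\<lambda>i. \<iota> (bvec (gen i))) ` {1..m} \<union> (\<lambda>k. zz (adj k)) ` {1..m - 1}) = acarrier H"
  unfolding gen_subalg_def
proof (intro equalityI Inf_greatest Inf_lower CollectI conjI)
  interpret HH: hopf_algebra H by (rule hopf_H)
  \<comment> \<open>The carrier is one of the intersected subalgebras, which gives one inclusion;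
    for the other, each of them is shown to be the whole carrier.\<close>
  show "is_subalg (acarrier H) H"
    unfolding is_subalg_def
  proof (intro conjI ballI subset_refl subspace_vec_on HH.one_closed)
    fix x y assume "x \<in> acarrier H" "y \<in> acarrier H"
    then show "x \<bullet>\<^bsub>H\<^esub> y \<in> acarrier H"
      using HH.mult_linear_left[of y] unfolding linear_map_def by blast
  qed
  have "\<iota> (bvec (gen i)) \<in> acarrier H" for i
    using gen_closed[of i] R.vbasis_eq by (intro \<iota>_closed) simp
  then show "(\<lambda>i. \<iota> (bvec (gen i))) ` {1..m} \<union> (\<lambda>k. zz (adj k)) ` {1..m - 1} \<subseteq> acarrier H"
    using zz_closed adj_permutes by blast
  fix U assume "U \<in> {U. is_subalg U H \<and> (\<lambda>i. \<iota> (bvec (gen i))) ` {1..m} \<union> (\<lambda>k. zz (adj k)) ` {1..m - 1} \<subseteq> U}"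
  then have U: "is_subalg U H" and gen: "\<And>i. i \<in> {1..m} \<Longrightarrow> \<iota> (bvec (gen i)) \<in> U"
    and adj: "\<And>k. k \<in> {1..m - 1} \<Longrightarrow> zz (adj k) \<in> U" by blast+
  note f = gen_generates[OF U gen]
  have "U = acarrier H"
    using f adj_generates[OF U subalg_\<iota>[OF U f] adj] sym_group_carrier by (intro subalg_eq_H U) blast+
  then show "acarrier H \<subseteq> U" by simp
qed

lemma dim_eq: "pm.dim (acarrier H) = n ^ m * fact m"
proof -
  have "card (carrier A) = n ^ m" unfolding carrier_A by (simp add: card_PiE)
  moreover have "card (carrier (sym_group m)) = fact m"
    unfolding sym_group_def by (simp add: card_permutations)
  ultimately show ?thesis unfolding dim_H by simp
qed

end

theorem theorem8:
  fixes n m :: nat and q :: "'k::field_char_0"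
  assumes "n \<ge> 2" and "m \<ge> 2"
    and "q ^ n = 1" and "\<And>k. 0 < k \<Longrightarrow> k < n \<Longrightarrow> q ^ k \<noteq> 1"
  shows "\<exists>(\<gamma> :: (nat \<Rightarrow> nat) \<Rightarrow> (nat \<Rightarrow> nat) \<Rightarrow> ((nat \<Rightarrow> int) \<Rightarrow>\<^sub>0 'k))
           (H :: ((nat \<Rightarrow> int) \<times> (nat \<Rightarrow> nat), 'k) hopf_data).
    let R = cyclic_power n m;
        s = (\<lambda>k. Transposition.transpose k (k + 1));
        x = (\<lambda>i. cyclic_gen n m i \<boxtimes> bvec \<one>\<^bsub>sym_group m\<^esub>);
        z = (\<lambda>k. aone R \<boxtimes> bvec (s k))
    in
      normalized_2cocycle R (sym_group m) perm_act \<gamma> \<and>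
      alg_data.truncate H = crossed_product R (sym_group m) perm_act \<gamma> \<and>
      hopf_algebra H \<and>
      semisimple_algebra H \<and>
      pm.dim (acarrier H) = n ^ m * fact m \<and>
      hopf_extension H (group_hopf (sym_group m)) R \<and>
      gen_subalg H (x ` {1..m} \<union> z ` {1..m-1}) = acarrier H \<and>
      (\<forall>i\<in>{1..m}. apow H (x i) n = aone H) \<and>
      (\<forall>i\<in>{1..m}. \<forall>j\<in>{1..m}. x i \<bullet>\<^bsub>H\<^esub> x j = x j \<bullet>\<^bsub>H\<^esub> x i) \<and>
      (\<forall>k\<in>{1..m-1}. \<forall>i\<in>{1..m}. z k \<bullet>\<^bsub>H\<^esub> x i = x (s k i) \<bullet>\<^bsub>H\<^esub> z k) \<and>
      (\<forall>k\<in>{1..m-1}. \<forall>l\<in>{1..m-1}. \<bar>int k - int l\<bar> > 1 \<longrightarrow>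
        z k \<bullet>\<^bsub>H\<^esub> z l = z l \<bullet>\<^bsub>H\<^esub> z k) \<and>
      (\<forall>k\<in>{1..m-2}.
        z k \<bullet>\<^bsub>H\<^esub> z (k+1) \<bullet>\<^bsub>H\<^esub> z k = z (k+1) \<bullet>\<^bsub>H\<^esub> z k \<bullet>\<^bsub>H\<^esub> z (k+1)) \<and>
      (\<forall>k\<in>{1..m-1}. z k \<bullet>\<^bsub>H\<^esub> z k =
        (1 / of_nat n) *\<^sub>p (\<Sum>i=0..n-1. \<Sum>j=0..n-1.
          (q powi (- int (i * j))) *\<^sub>p (apow H (x k) i \<bullet>\<^bsub>H\<^esub> apow H (x (k+1)) j))) \<and>
      (\<forall>i\<in>{1..m}. grouplike H (x i)) \<and>
      (\<forall>k\<in>{1..m-1}.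
        comult H (z k) =
          ((1 / of_nat n) *\<^sub>p (\<Sum>i=0..n-1. \<Sum>j=0..n-1.
            (q powi (- int (i * j))) *\<^sub>p (apow H (x k) i \<boxtimes> apow H (x (k+1)) j)))
          \<bullet>\<^bsub>tensor_alg H H\<^esub> (z k \<boxtimes> z k) \<and>
        counit H (z k) = 1 \<and>
        antipode H (z k) = z k)"
proof -
  interpret cyclic_sym n m q by unfold_locales (fact assms)+
  \<comment> \<open>The elements named in the claim are rewritten as
    \<open>\<iota> (bvec (gen i))\<close> and \<open>zz\<close>, for which the relations are
    established.\<close>
  have x: "cyclic_gen n m i \<boxtimes> bvec \<one>\<^bsub>sym_group m\<^esub> = \<iota> (bvec (gen i))" for i
    by (simp only: cyclic_gen_eq \<iota>_def gen_def)
  have z: "aone (cyclic_power n m) \<boxtimes> bvec w = zz w" for w by (simp only: zz_def)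
  have x_n: "apow H (\<iota> (bvec (gen i))) n = aone H" for i
    by (simp only: apow_\<iota>_bvec gen_closed gen_pow_n R.one_eq[symmetric] \<iota>_one)
  have x_comm: "\<iota> (bvec (gen i)) \<bullet>\<^bsub>H\<^esub> \<iota> (bvec (gen j)) = \<iota> (bvec (gen j)) \<bullet>\<^bsub>H\<^esub> \<iota> (bvec (gen i))" for i j
    using m_comm[OF gen_closed[of i] gen_closed[of j]] by (simp only: \<iota>_bvec_mult gen_closed)
  have S: "antipode H (zz (adj k)) = zz (adj k)" if "k \<in> {1..m - 1}" for k
    using that by (simp only: antipode_zz adj_in_sym inv_sym adj_permutes inv_adj)
  show ?thesis
    unfolding Let_def x z
    by (intro exI[of _ \<gamma>] exI[of _ H] conjI ballI impI cocycle truncate_H hopf_H semisimple_H dim_eq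
        extension_H[OF group_hopf_algebra_group_hopf[OF sym_group_is_group]] gen_subalg_H x_n x_comm
        zz_adj_gen zz_adj_commute zz_adj_braid zz_adj_square grouplike_\<iota>_bvec[OF gen_closed]
        comult_zz_adj counit_zz S)
qed

end
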